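(* Assume hypothesis (NA). Let $1<p<\infty$ and $s\in(0,1)$ with $sp<N$, let $\Omega\subset\mathbb{R}^N$ be an open bounded set with smooth boundary, let $a\in L^{N/(sp)}(\Omega)$ and $\mu>0$. Let $\{u_n\}_{n\in\mathbb{N}}\subset D^{s,p}_0(\Omega)$ be a Palais-Smale sequence at level $c$ for the functional $I$. Then there exist: (1) a (possibly trivial) weak solution $v^0\in D^{s,p}_0(\Omega)$ of $(-\Delta)^s_p u+a|u|^{p-2}u=\mu|u|^{p^*_s-2}u$ in $\Omega$, $u=0$ in $\mathbb{R}^N\setminus\Omega$; (2) a number $k\in\mathbb{N}$ and functions $v^1,\dots,v^k\in D^{s,p}_0(\mathbb{R}^N)\setminus\{0\}$ that are weak solutions of $(-\Delta)^s_p u=\mu|u|^{p^*_s-2}u$ in $\mathbb{R}^N$; (3) for $i=1,\dots,k$, sequences $\{\lambda^i_n\}_{n}\subset(0,\infty)$ with $\lambda^i_n\to0$ and $\{z^i_n\}_n\subset\{x\in\Omega:\operatorname{dist}(x,\partial\Omega)\ge\lambda^i_n\}$; such that, up to a subsequence, $$\lim_{n\to\infty}\Big[u_n-v^0-\sum_{i=1}^k(\lambda^i_n)^{\frac{sp-N}{p}}v^i\Big(\frac{\cdot-z^i_n}{\lambda^i_n}\Big)\Big]_{D^{s,p}(\mathbb{R}^N)}=0,$$ $$\lim_{n\to\infty}[u_n]^p_{D^{s,p}(\mathbb{R}^N)}=\sum_{i=0}^k[v^i]^p_{D^{s,p}(\mathbb{R}^N)},\qquad I(v^0)+\sum_{i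=1}^kI_\infty(v^i)=c.$$
   Context: Notation: $p^*_s=Np/(N-sp)$; $J_p(t)=|t|^{p-2}t$. Gagliardo seminorm $[u]_{D^{s,p}(\mathbb{R}^N)}=\big(\int_{\mathbb{R}^{2N}}\frac{|u(x)-u(y)|^p}{|x-y|^{N+sp}}dx\,dy\big)^{1/p}$. $D^{s,p}_0(\mathbb{R}^N)=\{u\in L^{p^*_s}(\mathbb{R}^N):[u]_{D^{s,p}(\mathbb{R}^N)}<\infty\}$ normed by the seminorm; for an open set $E\subset\mathbb{R}^N$, $D^{s,p}_0(E)=\{u\in D^{s,p}_0(\mathbb{R}^N): u=0\text{ a.e. in }\mathbb{R}^N\setminus E\}$, with dual $D^{-s,p'}(E)$. The functionals are $I(u)=\frac1p[u]^p_{D^{s,p}(\mathbb{R}^N)}+\frac1p\int_{\Omega}a|u|^p\,dx-\frac{\mu}{p^*_s}\int_{\mathbb{R}^N}|u|^{p^*_s}dx$ on $D^{s,p}_0(\Omega)$ and $I_\infty(u)=\frac1p[u]^p_{D^{s,p}(\mathbb{R}^N)}-\frac{\mu}{p^*_s}\int_{\mathbb{R}^N}|u|^{p^*_s}dx$ on $D^{s,p}_0(E)$; both are $C^1$. A weak solution $u\in D^{s,p}_0(E)$ of $(-\Delta)^s_pu+a|u|^{p-2}u=\mu|u|^{p^*_s-2}u$ in $E$, $u=0$ outside $E$, means $\int_{\mathbb{R}^{2N}}\frac{J_p(u(x)-u(y))(\varphi(x)-\varphi(y))}{|x-y|^{N+sp}}dxdy+\int a|u|^{p-2}u\varphi=\mu\int|u|^{p^*_s-2}u\varphi$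 for all $\varphi\in D^{s,p}_0(E)$ (with $a\equiv0$ for the equations without $a$). A Palais-Smale sequence for $I$ at level $c$ is a sequence with $I(u_n)\to c$ and $I'(u_n)\to0$ in $D^{-s,p'}(\Omega)$. Hypothesis (NA): for every half-space $\mathcal{H}\subset\mathbb{R}^N$, the only weak solution $u\in D^{s,p}_0(\mathcal{H})$ of $(-\Delta)^s_pu=\mu|u|^{p^*_s-2}u$ in $\mathcal{H}$, $u=0$ in $\mathbb{R}^N\setminus\mathcal{H}$, is $u=0$. *)

theory Defs
  imports "HOL-Analysis.Analysis"
begin

definition pstar :: "real \<Rightarrow> real \<Rightarrow> real \<Rightarrow> real" where
  "pstar N s p = N * p / (N - s * p)"

definition Jp :: "real \<Rightarrow> real \<Rightarrow> real" where
  "Jp p t = \<bar>t\<bar> powr (p - 2) * t"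

definition gag_nn :: "real \<Rightarrow> real \<Rightarrow> ('a::euclidean_space \<Rightarrow> real) \<Rightarrow> ennreal" where
  "gag_nn s p u = (\<integral>\<^sup>+ xy. ennreal (\<bar>u (fst xy) - u (snd xy)\<bar> powr p /
       norm (fst xy - snd xy) powr (real DIM('a) + s * p)) \<partial>(lborel \<Otimes>\<^sub>M lborel))"

text \<open>[u]^p as a real number (meaningful when finite).\<close>
definition gagp :: "real \<Rightarrow> real \<Rightarrow> ('a::euclidean_space \<Rightarrow> real) \<Rightarrow> real" where
  "gagp s p u = enn2real (gag_nn s p u)"

definition gag :: "real \<Rightarrow> real \<Rightarrow> ('a::euclidean_space \<Rightarrow> real) \<Rightarrow> real" where
  "gag s p u = gagp s p u powr (1 / p)"

definition Dsp :: "real \<Rightarrow> real \<Rightarrow> ('a::euclidean_space \<Rightarrow> real) \<Rightarrow> bool" where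
  "Dsp s p u \<longleftrightarrow> u \<in> borel_measurable lborel
     \<and> integrable lborel (\<lambda>x. \<bar>u x\<bar> powr pstar (real DIM('a)) s p)
     \<and> gag_nn s p u < \<infinity>"

definition Dsp0 :: "real \<Rightarrow> real \<Rightarrow> 'a::euclidean_space set \<Rightarrow> ('a \<Rightarrow> real) \<Rightarrow> bool" where
  "Dsp0 s p E u \<longleftrightarrow> Dsp s p u \<and> (AE x in lborel. x \<notin> E \<longrightarrow> u x = 0)"

text \<open>The weak form of (-Delta)^s_p u + a|u|^{p-2}u - mu|u|^{p*-2}u tested against phi;
  this is also I'(u) phi (resp. I_infty'(u) phi when a = 0).\<close>
definition weak_form :: "real \<Rightarrow> real \<Rightarrow> ('a::euclidean_space \<Rightarrow> real) \<Rightarrow> real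
     \<Rightarrow> ('a \<Rightarrow> real) \<Rightarrow> ('a \<Rightarrow> real) \<Rightarrow> real" where
  "weak_form s p a \<mu> u \<phi> =
     (\<integral>xy. Jp p (u (fst xy) - u (snd xy)) * (\<phi> (fst xy) - \<phi> (snd xy)) /
        norm (fst xy - snd xy) powr (real DIM('a) + s * p) \<partial>(lborel \<Otimes>\<^sub>M lborel))
     + (\<integral>x. a x * \<bar>u x\<bar> powr (p - 2) * u x * \<phi> x \<partial>lborel)
     - \<mu> * (\<integral>x. \<bar>u x\<bar> powr (pstar (real DIM('a)) s p - 2) * u x * \<phi> x \<partial>lborel)"

definition weak_sol :: "real \<Rightarrow> real \<Rightarrow> ('a::euclidean_space \<Rightarrow> real) \<Rightarrow> real
     \<Rightarrow> 'a set \<Rightarrow> ('a \<Rightarrow> real) \<Rightarrow> bool" where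
  "weak_sol s p a \<mu> E u \<longleftrightarrow> Dsp0 s p E u \<and> (\<forall>\<phi>. Dsp0 s p E \<phi> \<longrightarrow> weak_form s p a \<mu> u \<phi> = 0)"

definition Ifun :: "real \<Rightarrow> real \<Rightarrow> 'a::euclidean_space set \<Rightarrow> ('a \<Rightarrow> real) \<Rightarrow> real
     \<Rightarrow> ('a \<Rightarrow> real) \<Rightarrow> real" where
  "Ifun s p \<Omega> a \<mu> u = gagp s p u / p + (LINT x:\<Omega>|lborel. a x * \<bar>u x\<bar> powr p) / p
     - \<mu> / pstar (real DIM('a)) s p * (\<integral>x. \<bar>u x\<bar> powr pstar (real DIM('a)) s p \<partial>lborel)"

definition Iinf :: "real \<Rightarrow> real \<Rightarrow> real \<Rightarrow> ('a::euclidean_space \<Rightarrow> real) \<Rightarrow> real" where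
  "Iinf s p \<mu> u = gagp s p u / p
     - \<mu> / pstar (real DIM('a)) s p * (\<integral>x. \<bar>u x\<bar> powr pstar (real DIM('a)) s p \<partial>lborel)"

text \<open>Palais-Smale sequence at level c: I(u_n) -> c and ||I'(u_n)||_{D^{-s,p'}(Omega)} -> 0,
  the dual norm convergence written out.\<close>
definition PS_seq :: "real \<Rightarrow> real \<Rightarrow> 'a::euclidean_space set \<Rightarrow> ('a \<Rightarrow> real) \<Rightarrow> real
     \<Rightarrow> real \<Rightarrow> (nat \<Rightarrow> 'a \<Rightarrow> real) \<Rightarrow> bool" where
  "PS_seq s p \<Omega> a \<mu> c u \<longleftrightarrow> (\<forall>n. Dsp0 s p \<Omega> (u n))
     \<and> (\<lambda>n. Ifun s p \<Omega> a \<mu> (u n)) \<longlonglongrightarrow> c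
     \<and> (\<forall>\<epsilon>>0. eventually (\<lambda>n. \<forall>\<phi>. Dsp0 s p \<Omega> \<phi> \<longrightarrow>
            \<bar>weak_form s p a \<mu> (u n) \<phi>\<bar> \<le> \<epsilon> * gag s p \<phi>) sequentially)"

fun Ck_on :: "nat \<Rightarrow> 'a::euclidean_space set \<Rightarrow> ('a \<Rightarrow> real) \<Rightarrow> bool" where
  "Ck_on 0 S f = continuous_on S f"
| "Ck_on (Suc k) S f = (\<exists>f'. (\<forall>x\<in>S. (f has_derivative f' x) (at x))
        \<and> (\<forall>v. Ck_on k S (\<lambda>x. f' x v)))"

definition smooth_on :: "'a::euclidean_space set \<Rightarrow> ('a \<Rightarrow> real) \<Rightarrow> bool" where
  "smooth_on S f \<longleftrightarrow> (\<forall>k. Ck_on k S f)"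

definition smooth_boundary :: "'a::euclidean_space set \<Rightarrow> bool" where
  "smooth_boundary \<Omega> \<longleftrightarrow> (\<forall>x0\<in>frontier \<Omega>. \<exists>r>0. \<exists>\<rho> \<rho>'.
      smooth_on (ball x0 r) \<rho>
      \<and> (\<forall>x\<in>ball x0 r. (\<rho> has_derivative \<rho>' x) (at x) \<and> \<rho>' x \<noteq> (\<lambda>v. 0))
      \<and> \<Omega> \<inter> ball x0 r = {x\<in>ball x0 r. \<rho> x < 0})"

definition NA :: "real \<Rightarrow> real \<Rightarrow> real \<Rightarrow> 'a::euclidean_space itself \<Rightarrow> bool" where
  "NA s p \<mu> _ \<longleftrightarrow> (\<forall>\<nu> t. \<nu> \<noteq> (0::'a) \<longrightarrow> (\<forall>w. weak_sol s p (\<lambda>_. 0) \<mu> {x. x \<bullet> \<nu> > t} w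
        \<longrightarrow> (AE x in lborel. w x = 0)))"

end

theory Submission
  imports Defs "HOL-Complex_Analysis.Great_Picard"
begin

text \<open>Everything is phrased for the difference quotient \<open>G u (x, y) = (u x - u y) / norm (x - y) powr ((N + s * p) / p)\<close>,
so that the Gagliardo energy is an \<open>L\<^sup>p\<close> norm on pairs and almost everywhere convergence of \<open>u\<^sub>n\<close> already gives
almost everywhere convergence of \<open>G u\<^sub>n\<close>; the Brezis-Lieb lemma then splits energies and derivatives, and weak
limits of Palais-Smale sequences are solutions. A remainder that does not vanish has, by a Sobolev inequality
refined by a Morrey-type norm, balls on which its rescaled averages stay away from \<open>0\<close>; rescaling these balls to
the unit ball gives a nonzero limit profile. If the balls stay close to the boundary at their own scale, the profile
solves the equation in a half-space, which (NA) excludes; otherwise it solves it in the whole space. Subtracting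
the profile, cut off so as to stay supported in \<open>\<Omega>\<close>, lowers the energy by a fixed amount, so finitely many
steps suffice; no asymptotic orthogonality of the bubbles is needed.\<close>

section \<open>Lebesgue spaces and the Brezis-Lieb lemma\<close>

text \<open>The obstacle is criticality: translations and dilations preserve both
  \<open>Lint q\<close> and the energy, so of a bounded sequence only almost everywhere convergence
  of a subsequence survives, and the operator is nonlinear. The remedy is pointwise inequalities
  |F(a + b) - F(a)| \<le> e |a|^r + C |b|^r with arbitrary e: together with a uniform bound they
  turn almost everywhere convergence into convergence of the nonlinear terms in the dual norm,
  uniformly in the test function. The recursion runs on \<open>PSinf\<close>, whose unusual
  ingredient is that the L^1 norm tends to 0. On the bounded set \<Omega> this stands for weak
  convergence to 0. It forces every concentration scale l to 0, because an average that is large in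
  the critical normalisation costs L^1 mass of order l^(N - al), and it survives the subtraction of
  a bubble. Energies and critical norms are split only between consecutive remainders and the
  differences telescope, which is why the mutual positions of the bubbles never enter. The fixed
  amount of energy is the lower bound that Sobolev's inequality gives for nontrivial solutions on
  the whole space.\<close>

lemma powr_add_le:
  fixes a b q :: real
  assumes "0 < q" "0 \<le> a" "0 \<le> b"
  shows "(a + b) powr q \<le> 2 powr q * (a powr q + b powr q)"
proof -
  have "(a + b) powr q \<le> (2 * max a b) powr q"
    using assms by (intro powr_mono2) auto
  also have "\<dots> = 2 powr q * (max a b) powr q"
    using assms by (simp add: powr_mult)
  also have "\<dots> \<le> 2 powr q * (a powr q + b powr q)"
    by (intro mult_left_mono) (auto simp: max_def)
  finally show ?thesis .
qed

definition Lq :: "real \<Rightarrow> 'b measure \<Rightarrow> ('b \<Rightarrow> real) \<Rightarrow> bool" where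
  "Lq q M f \<longleftrightarrow> f \<in> borel_measurable M \<and> integrable M (\<lambda>x. \<bar>f x\<bar> powr q)"

text \<open>The q-th power of the norm, not the norm itself: the Brezis-Lieb splittings and the
  energy identities are additive in this quantity. The price is the constant 2 powr q in
  \<open>Lq_add\<close> in place of Minkowski's inequality.\<close>

definition Lint :: "real \<Rightarrow> 'b measure \<Rightarrow> ('b \<Rightarrow> real) \<Rightarrow> real" where
  "Lint q M f = (\<integral>x. \<bar>f x\<bar> powr q \<partial>M)"

lemma Lint_nonneg [simp]: "0 \<le> Lint q M f"
  by (simp add: Lint_def)

lemma Lq_measurable: "Lq q M f \<Longrightarrow> f \<in> borel_measurable M"
  by (simp add: Lq_def)

lemma Lq_integrable: "Lq q M f \<Longrightarrow> integrable M (\<lambda>x. \<bar>f x\<bar> powr q)"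
  by (simp add: Lq_def)

lemma Lq_dominated:
  assumes "integrable M h" "f \<in> borel_measurable M" "AE x in M. \<bar>f x\<bar> powr q \<le> h x"
  shows "Lq q M f" "Lint q M f \<le> (\<integral>x. h x \<partial>M)"
proof -
  have "integrable M (\<lambda>x. \<bar>f x\<bar> powr q)"
    by (rule Bochner_Integration.integrable_bound[OF assms(1)]) (use assms(2,3) in auto)
  then show "Lq q M f" "Lint q M f \<le> (\<integral>x. h x \<partial>M)"
    using assms unfolding Lq_def Lint_def by (auto intro: integral_mono_AE)
qed

lemma Lq_bound:
  assumes "0 < q" "Lq q M f" "g \<in> borel_measurable M" "AE x in M. \<bar>g x\<bar> \<le> \<bar>f x\<bar>"
  shows "Lq q M g" "Lint q M g \<le> Lint q M f"
proof -
  have *: "AE x in M. \<bar>g x\<bar> powr q \<le> \<bar>f x\<bar> powr q"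
    using assms(4) by eventually_elim (use assms(1) in \<open>auto intro: powr_mono2\<close>)
  show "Lq q M g" "Lint q M g \<le> Lint q M f"
    using Lq_dominated[OF Lq_integrable[OF assms(2)] assms(3) *] by (auto simp: Lint_def)
qed

lemma Lq_add:
  assumes "0 < q" "Lq q M f" "Lq q M g"
  shows "Lq q M (\<lambda>x. f x + g x)"
    "Lint q M (\<lambda>x. f x + g x) \<le> 2 powr q * (Lint q M f + Lint q M g)"
proof -
  let ?h = "\<lambda>x. 2 powr q * (\<bar>f x\<bar> powr q + \<bar>g x\<bar> powr q)"
  have i: "integrable M ?h"
    using assms by (auto simp: Lq_def)
  have *: "\<bar>f x + g x\<bar> powr q \<le> ?h x" for x
  proof -
    have "\<bar>f x + g x\<bar> powr q \<le> (\<bar>f x\<bar> + \<bar>g x\<bar>) powr q"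
      using assms by (intro powr_mono2) auto
    also have "\<dots> \<le> ?h x" using assms by (intro powr_add_le) auto
    finally show ?thesis .
  qed
  have "(\<lambda>x. f x + g x) \<in> borel_measurable M"
    using assms by (auto simp: Lq_def)
  from Lq_dominated[OF i this, of q] *
  have "Lq q M (\<lambda>x. f x + g x)" "Lint q M (\<lambda>x. f x + g x) \<le> integral\<^sup>L M ?h" by auto
  moreover have "integral\<^sup>L M ?h = 2 powr q * (Lint q M f + Lint q M g)"
    using assms by (simp add: Lq_def Lint_def)
  ultimately show "Lq q M (\<lambda>x. f x + g x)"
    "Lint q M (\<lambda>x. f x + g x) \<le> 2 powr q * (Lint q M f + Lint q M g)" by auto
qed

lemma Lq_cmult:
  assumes "Lq q M f"
  shows "Lq q M (\<lambda>x. c * f x)" "Lint q M (\<lambda>x. c * f x) = \<bar>c\<bar> powr q * Lint q M f"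
  using assms by (auto simp: Lq_def Lint_def abs_mult powr_mult)

lemma Lq_minus:
  assumes "Lq q M f"
  shows "Lq q M (\<lambda>x. - f x)" "Lint q M (\<lambda>x. - f x) = Lint q M f"
  using assms by (auto simp: Lq_def Lint_def)

lemma Lq_diff:
  assumes "0 < q" "Lq q M f" "Lq q M g"
  shows "Lq q M (\<lambda>x. f x - g x)"
    "Lint q M (\<lambda>x. f x - g x) \<le> 2 powr q * (Lint q M f + Lint q M g)"
  using Lq_add[OF assms(1,2) Lq_minus(1)[OF assms(3)]] Lq_minus(2)[OF assms(3)] by auto

lemma Lint_eq_0:
  assumes "Lq q M f" "Lint q M f = 0"
  shows "AE x in M. f x = 0"
proof -
  have "AE x in M. \<bar>f x\<bar> powr q = 0"
    using assms by (subst integral_nonneg_eq_0_iff_AE[symmetric]) (auto simp: Lq_def Lint_def)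
  then show ?thesis by simp
qed

lemma Lq_nn:
  assumes "f \<in> borel_measurable M"
  shows "Lq q M f \<longleftrightarrow> (\<integral>\<^sup>+x. ennreal (\<bar>f x\<bar> powr q) \<partial>M) < \<infinity>"
    "Lq q M f \<Longrightarrow> ennreal (Lint q M f) = (\<integral>\<^sup>+x. ennreal (\<bar>f x\<bar> powr q) \<partial>M)"
proof -
  show "Lq q M f \<longleftrightarrow> (\<integral>\<^sup>+x. ennreal (\<bar>f x\<bar> powr q) \<partial>M) < \<infinity>"
    using assms unfolding Lq_def by (subst integrable_iff_bounded) auto
  show "Lq q M f \<Longrightarrow> ennreal (Lint q M f) = (\<integral>\<^sup>+x. ennreal (\<bar>f x\<bar> powr q) \<partial>M)"
    unfolding Lq_def Lint_def by (subst nn_integral_eq_integral) auto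
qed

lemma Lq_of_nn_le:
  assumes "f \<in> borel_measurable M" "(\<integral>\<^sup>+x. ennreal (\<bar>f x\<bar> powr q) \<partial>M) \<le> ennreal K" "0 \<le> K"
  shows "Lq q M f" "Lint q M f \<le> K"
proof -
  show L: "Lq q M f"
    unfolding Lq_nn(1)[OF assms(1)] using assms(2) by (simp add: le_less_trans)
  show "Lint q M f \<le> K"
    using Lq_nn(2)[OF assms(1) L] assms(2,3) by (metis ennreal_le_iff)
qed

text \<open>Measurability of the limit is assumed separately because the measure may be incomplete,
  as \<open>lborel\<close> is: an almost everywhere limit need not be Borel.\<close>

lemma Lq_Fatou:
  assumes q: "0 < q" and g: "\<And>n. Lq q M (g n)" "\<And>n. Lint q M (g n) \<le> K"
    and lim: "AE x in M. (\<lambda>n. g n x) \<longlonglongrightarrow> w x" and w: "w \<in> borel_measurable M"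
  shows "Lq q M w" "Lint q M w \<le> K"
proof -
  have K: "0 \<le> K" using g(2)[of 0] Lint_nonneg[of q M "g 0"] by linarith
  have "(\<integral>\<^sup>+x. ennreal (\<bar>w x\<bar> powr q) \<partial>M) = (\<integral>\<^sup>+x. liminf (\<lambda>n. ennreal (\<bar>g n x\<bar> powr q)) \<partial>M)"
  proof (rule nn_integral_cong_AE)
    show "AE x in M. ennreal (\<bar>w x\<bar> powr q) = liminf (\<lambda>n. ennreal (\<bar>g n x\<bar> powr q))"
      using lim
    proof eventually_elim
      case (elim x)
      have "(\<lambda>n. \<bar>g n x\<bar> powr q) \<longlonglongrightarrow> \<bar>w x\<bar> powr q"
        using q by (intro tendsto_powr2 tendsto_rabs elim tendsto_const) auto
      then have "(\<lambda>n. ennreal (\<bar>g n x\<bar> powr q)) \<longlonglongrightarrow> ennreal (\<bar>w x\<bar> powr q)" by simp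
      then show ?case by (intro lim_imp_Liminf[symmetric]) auto
    qed
  qed
  also have "\<dots> \<le> liminf (\<lambda>n. \<integral>\<^sup>+x. ennreal (\<bar>g n x\<bar> powr q) \<partial>M)"
    using Lq_measurable[OF g(1)] by (intro nn_integral_liminf) measurable
  also have "\<dots> \<le> liminf (\<lambda>n. ennreal K)"
  proof (intro Liminf_mono always_eventually allI)
    fix n show "(\<integral>\<^sup>+x. ennreal (\<bar>g n x\<bar> powr q) \<partial>M) \<le> ennreal K"
      using Lq_nn(2)[OF Lq_measurable g(1)] g(1,2) by (metis ennreal_leI)
  qed
  also have "\<dots> = ennreal K" by (simp add: Liminf_const)
  finally show "Lq q M w" "Lint q M w \<le> K"
    using Lq_of_nn_le[OF w _ K] by auto
qed

lemma Holder:
  assumes pq: "1 < p" "1 < q" "1 / p + 1 / q = 1" and f: "Lq p M f" and g: "Lq q M g"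
  shows "integrable M (\<lambda>x. f x * g x)"
    "\<bar>\<integral>x. f x * g x \<partial>M\<bar> \<le> Lint p M f powr (1 / p) * Lint q M g powr (1 / q)"
    "(\<integral>x. \<bar>f x * g x\<bar> \<partial>M) \<le> Lint p M f powr (1 / p) * Lint q M g powr (1 / q)"
proof -
  have mf: "f \<in> borel_measurable M" and mg: "g \<in> borel_measurable M"
    using f g by (auto simp: Lq_def)
  have if': "integrable M (\<lambda>x. \<bar>f x\<bar> powr p)" and ig: "integrable M (\<lambda>x. \<bar>g x\<bar> powr q)"
    using f g by (auto simp: Lq_def)
  have young: "\<bar>f x * g x\<bar> \<le> \<bar>f x\<bar> powr p / p + \<bar>g x\<bar> powr q / q" for x
    using Youngs_inequality[OF _ _ pq(3), of "\<bar>f x\<bar>" "\<bar>g x\<bar>"] pq by (auto simp: abs_mult)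
  show int: "integrable M (\<lambda>x. f x * g x)"
    by (rule Bochner_Integration.integrable_bound[of M "\<lambda>x. \<bar>f x\<bar> powr p / p + \<bar>g x\<bar> powr q / q"])
       (use young if' ig mf mg pq in \<open>auto intro!: AE_I2 order_trans[OF young]\<close>)
  let ?F = "Lint p M f" and ?G = "Lint q M g"
  show main: "(\<integral>x. \<bar>f x * g x\<bar> \<partial>M) \<le> ?F powr (1 / p) * ?G powr (1 / q)"
  proof (cases "?F = 0 \<or> ?G = 0")
    case True
    then have "AE x in M. f x * g x = 0"
    proof
      assume "?F = 0" from Lint_eq_0[OF f this] show ?thesis by eventually_elim auto
    next
      assume "?G = 0" from Lint_eq_0[OF g this] show ?thesis by eventually_elim auto
    qed
    then have "(\<integral>x. \<bar>f x * g x\<bar> \<partial>M) = (\<integral>x. 0 \<partial>M)"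
      using mf mg by (intro integral_cong_AE) auto
    then show ?thesis by simp
  next
    case False
    then have F: "?F > 0" and G: "?G > 0"
      using Lint_nonneg[of p M f] Lint_nonneg[of q M g] by linarith+
    let ?A = "?F powr (1 / p)" and ?B = "?G powr (1 / q)"
    have A: "?A > 0" "?B > 0" using F G by auto
    have Ap: "?A powr p = ?F" "?B powr q = ?G" using pq F G by (auto simp: powr_powr)
    have "\<bar>f x * g x\<bar> / (?A * ?B) \<le> \<bar>f x\<bar> powr p / (?F * p) + \<bar>g x\<bar> powr q / (?G * q)" for x
      using Youngs_inequality[OF _ _ pq(3), of "\<bar>f x\<bar> / ?A" "\<bar>g x\<bar> / ?B"] pq A
      by (auto simp: abs_mult powr_divide Ap)
    then have "(\<integral>x. \<bar>f x * g x\<bar> / (?A * ?B) \<partial>M)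
        \<le> (\<integral>x. \<bar>f x\<bar> powr p / (?F * p) + \<bar>g x\<bar> powr q / (?G * q) \<partial>M)"
      using if' ig int by (intro integral_mono) auto
    also have "\<dots> = ?F / (?F * p) + ?G / (?G * q)"
      using if' ig by (simp add: Lint_def)
    also have "\<dots> = 1" using F G pq by simp
    finally show ?thesis using A by (simp add: divide_le_eq)
  qed
  have "\<bar>\<integral>x. f x * g x \<partial>M\<bar> \<le> (\<integral>x. \<bar>f x * g x\<bar> \<partial>M)"
    by (rule integral_abs_bound)
  then show "\<bar>\<integral>x. f x * g x \<partial>M\<bar> \<le> ?F powr (1 / p) * ?G powr (1 / q)"
    using main by linarith
qed

text \<open>By homogeneity one may divide by |a|, so only a = 1 and a = -1 matter. There continuity
  handles small b, and for |b| \<ge> d both values of F are at most a multiple of |b|^r. It is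
  applied to F = \<open>Jp q\<close> with r = q - 1 and to F(t) = |t|^q with r = q, and so yields
  both estimates used on the nonlinearities.\<close>

lemma homogeneous_perturbation:
  fixes F :: "real \<Rightarrow> real"
  assumes r: "0 < r" and hom: "\<And>c t. 0 < c \<Longrightarrow> F (c * t) = c powr r * F t"
    and bd: "\<And>t. \<bar>F t\<bar> \<le> \<bar>t\<bar> powr r" and ct: "isCont F 1" "isCont F (-1)" and e: "0 < e"
  shows "\<exists>C\<ge>0. \<forall>a b. \<bar>F (a + b) - F a\<bar> \<le> e * \<bar>a\<bar> powr r + C * \<bar>b\<bar> powr r"
proof -
  obtain d1 where d1: "d1 > 0" "\<And>t. \<bar>t - 1\<bar> < d1 \<Longrightarrow> \<bar>F t - F 1\<bar> < e"
    using ct(1) e unfolding continuous_at_eps_delta dist_real_def by metis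
  obtain d2 where d2: "d2 > 0" "\<And>t. \<bar>t - (-1)\<bar> < d2 \<Longrightarrow> \<bar>F t - F (-1)\<bar> < e"
    using ct(2) e unfolding continuous_at_eps_delta dist_real_def by metis
  define d where "d = min d1 d2"
  have d: "d > 0" using d1 d2 by (simp add: d_def)
  \<comment> \<open>For |t| \<ge> d one has |\<sigma> + t| \<le> 1 + |t| \<le> (1/d + 1) |t|; the
    second summand pays for F \<sigma>.\<close>
  define C where "C = (1 / d + 1) powr r + (1 / d) powr r"
  have C0: "C \<ge> 0" by (simp add: C_def)
  have key: "\<bar>F (\<sigma> + t) - F \<sigma>\<bar> \<le> e + C * \<bar>t\<bar> powr r" if \<sigma>: "\<sigma> = 1 \<or> \<sigma> = -1" for \<sigma> t :: real
  proof (cases "\<bar>t\<bar> < d")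
    case True
    then have "\<bar>F (\<sigma> + t) - F \<sigma>\<bar> < e"
      using \<sigma> d1(2)[of "\<sigma> + t"] d2(2)[of "\<sigma> + t"] by (auto simp: d_def)
    then show ?thesis using C0 by (smt (verit) mult_nonneg_nonneg powr_ge_zero)
  next
    case False
    have t: "1 \<le> \<bar>t\<bar> / d" using False d by simp
    have "\<bar>F (\<sigma> + t)\<bar> \<le> \<bar>\<sigma> + t\<bar> powr r" by (rule bd)
    also have "\<dots> \<le> ((1 / d + 1) * \<bar>t\<bar>) powr r"
      using r \<sigma> t by (intro powr_mono2) (auto simp: algebra_simps)
    also have "\<dots> = (1 / d + 1) powr r * \<bar>t\<bar> powr r" using d by (simp add: powr_mult)
    finally have 1: "\<bar>F (\<sigma> + t)\<bar> \<le> (1 / d + 1) powr r * \<bar>t\<bar> powr r" .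
    have "\<bar>F \<sigma>\<bar> \<le> \<bar>\<sigma>\<bar> powr r" by (rule bd)
    also have "\<dots> \<le> ((1 / d) * \<bar>t\<bar>) powr r" using r \<sigma> t by (intro powr_mono2) auto
    also have "\<dots> = (1 / d) powr r * \<bar>t\<bar> powr r" using d by (subst powr_mult[symmetric]) auto
    finally have 2: "\<bar>F \<sigma>\<bar> \<le> (1 / d) powr r * \<bar>t\<bar> powr r" .
    show ?thesis using 1 2 e by (simp add: C_def algebra_simps)
  qed
  \<comment> \<open>The extra 1 covers a = 0, where |F b| \<le> |b|^r is used instead of
    scaling.\<close>
  define D where "D = C + 1"
  have "\<bar>F (a + b) - F a\<bar> \<le> e * \<bar>a\<bar> powr r + D * \<bar>b\<bar> powr r" for a b
  proof (cases "a = 0")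
    case True
    have "F 0 = 0" using bd[of 0] r by simp
    then show ?thesis using True bd[of b] C0
      by (simp add: D_def algebra_simps) (smt (verit) mult_nonneg_nonneg powr_ge_zero)
  next
    case False
    then have a: "\<bar>a\<bar> > 0" by simp
    have e1: "F (a + b) = \<bar>a\<bar> powr r * F (sgn a + b / \<bar>a\<bar>)"
      using hom[OF a, of "sgn a + b / \<bar>a\<bar>"] a by (simp add: algebra_simps mult_sgn_abs abs_mult_sgn)
    have e2: "F a = \<bar>a\<bar> powr r * F (sgn a)"
      using hom[OF a, of "sgn a"] by (simp add: abs_mult_sgn)
    have "\<bar>F (a + b) - F a\<bar> = \<bar>a\<bar> powr r * \<bar>F (sgn a + b / \<bar>a\<bar>) - F (sgn a)\<bar>"
      unfolding e1 e2 by (simp add: abs_mult flip: right_diff_distrib)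
    also have "\<dots> \<le> \<bar>a\<bar> powr r * (e + C * \<bar>b / \<bar>a\<bar>\<bar> powr r)"
      using False by (intro mult_left_mono key) (auto simp: sgn_if)
    also have "\<dots> = e * \<bar>a\<bar> powr r + C * \<bar>b\<bar> powr r"
      using a by (simp add: powr_divide algebra_simps)
    also have "\<dots> \<le> e * \<bar>a\<bar> powr r + D * \<bar>b\<bar> powr r" by (simp add: D_def algebra_simps)
    finally show ?thesis .
  qed
  moreover have "D \<ge> 0" using C0 by (simp add: D_def)
  ultimately show ?thesis by blast
qed

section \<open>The nonlinearity \<open>Jp\<close> and its perturbation inequalities\<close>

lemma abs_Jp: "\<bar>Jp q t\<bar> = \<bar>t\<bar> powr (q - 1)"
proof (cases "t = 0")
  case False
  then have "\<bar>t\<bar> powr (q - 1) = \<bar>t\<bar> powr (q - 2) * \<bar>t\<bar> powr 1" by (subst powr_add[symmetric]) simp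
  then show ?thesis by (simp add: Jp_def abs_mult)
qed (simp add: Jp_def)

lemma Jp_mult_self: "Jp q t * t = \<bar>t\<bar> powr q"
proof (cases "t = 0")
  case False
  have "Jp q t * t = \<bar>t\<bar> powr (q - 2) * (\<bar>t\<bar> * \<bar>t\<bar>)" by (simp add: Jp_def)
  also have "\<bar>t\<bar> * \<bar>t\<bar> = \<bar>t\<bar> powr 2" using False by (simp add: power2_eq_square)
  also have "\<bar>t\<bar> powr (q - 2) * \<bar>t\<bar> powr 2 = \<bar>t\<bar> powr q" by (subst powr_add[symmetric]) simp
  finally show ?thesis .
qed (simp add: Jp_def)

lemma Jp_cmult: "0 < c \<Longrightarrow> Jp q (c * t) = c powr (q - 1) * Jp q t"
proof -
  assume c: "0 < c"
  have "c powr (q - 1) = c powr (q - 2) * c powr 1" by (subst powr_add[symmetric]) simp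
  then show ?thesis using c by (simp add: Jp_def abs_mult powr_mult)
qed

lemma Jp_measurable [measurable]: "Jp q \<in> borel_measurable borel"
  unfolding Jp_def by measurable

lemma tendsto_Jp:
  assumes "1 < q" "(f \<longlongrightarrow> l) F"
  shows "((\<lambda>x. Jp q (f x)) \<longlongrightarrow> Jp q l) F"
proof (cases "l = 0")
  case True
  have "((\<lambda>x. \<bar>f x\<bar> powr (q - 1)) \<longlongrightarrow> \<bar>l\<bar> powr (q - 1)) F"
    using assms by (intro tendsto_powr2 tendsto_rabs tendsto_const) auto
  then have "((\<lambda>x. \<bar>Jp q (f x)\<bar>) \<longlongrightarrow> 0) F" using True assms by (simp add: abs_Jp)
  then show ?thesis using True by (simp add: tendsto_rabs_zero_iff Jp_def)
next
  case False
  then show ?thesis unfolding Jp_def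
    by (intro tendsto_mult tendsto_powr tendsto_rabs assms tendsto_const) auto
qed

lemma Jp_conjugate_powr:
  assumes "1 < q" shows "\<bar>Jp q t\<bar> powr (q / (q - 1)) = \<bar>t\<bar> powr q"
  using assms by (simp add: abs_Jp powr_powr)

lemma conjugate_exponent:
  fixes q :: real assumes "1 < q"
  shows "1 < q / (q - 1)" "1 / (q / (q - 1)) + 1 / q = 1" "1 / q + 1 / (q / (q - 1)) = 1"
  using assms by (auto simp: field_simps)

lemma Lq_Jp:
  assumes "1 < q" "Lq q M f"
  shows "Lq (q / (q - 1)) M (\<lambda>x. Jp q (f x))" "Lint (q / (q - 1)) M (\<lambda>x. Jp q (f x)) = Lint q M f"
  using assms unfolding Lq_def Lint_def by (auto simp: Jp_conjugate_powr)

lemma Jp_perturbation: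
  assumes "1 < q" "0 < e"
  shows "\<exists>C\<ge>0. \<forall>a b. \<bar>Jp q (a + b) - Jp q a\<bar> \<le> e * \<bar>a\<bar> powr (q - 1) + C * \<bar>b\<bar> powr (q - 1)"
proof (rule homogeneous_perturbation)
  show "isCont (Jp q) 1" "isCont (Jp q) (- 1)"
    unfolding isCont_def by (intro tendsto_Jp tendsto_ident_at assms)+
qed (use assms in \<open>auto simp: Jp_cmult abs_Jp\<close>)

text \<open>The form needed for estimates in the dual exponent: the power q / (q - 1) turns |a|^(q -
  1) into |a|^q, which is what a bound on \<open>Lint q\<close> controls.\<close>

lemma Jp_perturbation_powr:
  assumes q: "1 < q" and e: "0 < e"
  shows "\<exists>C\<ge>0. \<forall>a b. \<bar>Jp q (a + b) - Jp q a\<bar> powr (q / (q - 1)) \<le> e * \<bar>a\<bar> powr q + C * \<bar>b\<bar> powr q"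
proof -
  let ?r = "q / (q - 1)"
  have r: "?r > 0" "(q - 1) * ?r = q" using q by auto
  \<comment> \<open>Chosen so that after the loss 2 powr ?r in \<open>powr_add_le\<close> exactly e
    remains.\<close>
  define e1 where "e1 = (e / 2 powr ?r) powr (1 / ?r)"
  have e1: "e1 > 0" "2 powr ?r * e1 powr ?r = e" using e q by (auto simp: e1_def powr_powr)
  obtain C where C: "C \<ge> 0" "\<And>a b. \<bar>Jp q (a + b) - Jp q a\<bar> \<le> e1 * \<bar>a\<bar> powr (q - 1) + C * \<bar>b\<bar> powr (q - 1)"
    using Jp_perturbation[OF q e1(1)] by auto
  have "\<bar>Jp q (a + b) - Jp q a\<bar> powr ?r \<le> e * \<bar>a\<bar> powr q + (2 powr ?r * C powr ?r) * \<bar>b\<bar> powr q" for a b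
  proof -
    have "\<bar>Jp q (a + b) - Jp q a\<bar> powr ?r \<le> (e1 * \<bar>a\<bar> powr (q - 1) + C * \<bar>b\<bar> powr (q - 1)) powr ?r"
      using r C by (intro powr_mono2) auto
    also have "\<dots> \<le> 2 powr ?r * ((e1 * \<bar>a\<bar> powr (q - 1)) powr ?r + (C * \<bar>b\<bar> powr (q - 1)) powr ?r)"
      using r C e1 by (intro powr_add_le) auto
    also have "\<dots> = (2 powr ?r * e1 powr ?r) * \<bar>a\<bar> powr q + (2 powr ?r * C powr ?r) * \<bar>b\<bar> powr q"
      using C e1(1) r by (simp add: powr_mult powr_powr algebra_simps)
    finally show ?thesis using e1 by simp
  qed
  then show ?thesis using C by (intro exI[of _ "2 powr ?r * C powr ?r"]) auto
qed

lemma abs_powr_perturbation: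
  assumes "0 < q" "0 < e"
  shows "\<exists>C\<ge>0. \<forall>a b. \<bar>\<bar>a + b\<bar> powr q - \<bar>a\<bar> powr q\<bar> \<le> e * \<bar>a\<bar> powr q + C * \<bar>b\<bar> powr (q::real)"
proof (rule homogeneous_perturbation)
  show "isCont (\<lambda>t. \<bar>t\<bar> powr q) 1" "isCont (\<lambda>t. \<bar>t\<bar> powr q) (-1)"
    by (auto intro!: continuous_intros)
qed (use assms in \<open>auto simp: abs_mult powr_mult\<close>)

section \<open>Splitting integrals along almost everywhere convergent sequences\<close>

lemma tendsto_0_of_eventually_le:
  fixes f :: "nat \<Rightarrow> real"
  assumes "\<And>n. 0 \<le> f n" "\<And>e. 0 < e \<Longrightarrow> eventually (\<lambda>n. f n \<le> e * K) sequentially"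
  shows "f \<longlonglongrightarrow> 0"
proof (rule LIMSEQ_I)
  fix r :: real assume r: "0 < r"
  let ?e = "r / (2 * (\<bar>K\<bar> + 1))"
  have "?e > 0" using r by auto
  from assms(2)[OF this] obtain n0 where n0: "\<And>n. n \<ge> n0 \<Longrightarrow> f n \<le> ?e * K"
    unfolding eventually_sequentially by auto
  have "?e * K \<le> ?e * (\<bar>K\<bar> + 1)" using r by (intro mult_left_mono) auto
  also have "\<dots> = r / 2" by (simp add: field_simps)
  also have "\<dots> < r" using r by simp
  finally have "norm (f n - 0) < r" if "n \<ge> n0" for n
    using n0[OF that] assms(1)[of n] by auto
  then show "\<exists>n0. \<forall>n\<ge>n0. norm (f n - 0) < r" by blast
qed

text \<open>The mechanism of the Brezis-Lieb lemma: subtracting \<open>e * A n\<close> leaves something dominated.\<close>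

lemma Brezis_Lieb_principle:
  fixes H A :: "nat \<Rightarrow> 'b \<Rightarrow> real"
  assumes H [measurable]: "\<And>n. H n \<in> borel_measurable M" and lim: "AE x in M. (\<lambda>n. H n x) \<longlonglongrightarrow> 0"
    and A: "\<And>n. integrable M (A n)" "\<And>n. (\<integral>x. A n x \<partial>M) \<le> K" "\<And>n x. 0 \<le> A n x"
    and B: "integrable M B" "\<And>x. 0 \<le> B x"
    and bound: "\<And>e. 0 < e \<Longrightarrow> \<exists>C. \<forall>n x. \<bar>H n x\<bar> \<le> e * A n x + C * B x"
  shows "\<And>n. integrable M (H n)" "(\<lambda>n. \<integral>x. \<bar>H n x\<bar> \<partial>M) \<longlonglongrightarrow> 0"
proof -
  have [measurable]: "\<And>n. A n \<in> borel_measurable M" "B \<in> borel_measurable M"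
    using A(1) B(1) by auto
  show int: "integrable M (H n)" for n
  proof -
    obtain C where C: "\<And>n x. \<bar>H n x\<bar> \<le> 1 * A n x + C * B x" using bound[of 1] by auto
    show ?thesis
    proof (rule Bochner_Integration.integrable_bound)
      show "integrable M (\<lambda>x. 1 * A n x + C * B x)" using A(1) B(1) by auto
      show "AE x in M. norm (H n x) \<le> norm (1 * A n x + C * B x)"
        using C by (intro AE_I2) (smt (verit) real_norm_def)
    qed auto
  qed
  show "(\<lambda>n. \<integral>x. \<bar>H n x\<bar> \<partial>M) \<longlonglongrightarrow> 0"
  proof (rule tendsto_0_of_eventually_le)
    fix e :: real assume e: "0 < e"
    obtain C where C: "\<And>n x. \<bar>H n x\<bar> \<le> e * A n x + C * B x" using bound[OF e] by auto
    define W where "W n x = max 0 (\<bar>H n x\<bar> - e * A n x)" for n x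
    have W [measurable]: "W n \<in> borel_measurable M" for n unfolding W_def by measurable
    have Wb: "\<bar>W n x\<bar> \<le> \<bar>C\<bar> * B x" for n x
      using C[of n x] B(2)[of x] abs_ge_self[of C] mult_right_mono[of C "\<bar>C\<bar>" "B x"]
      by (auto simp: W_def max_def)
    have "AE x in M. (\<lambda>n. W n x) \<longlonglongrightarrow> 0"
      using lim
    proof eventually_elim
      case (elim x)
      show ?case
      proof (rule Lim_null_comparison)
        show "(\<lambda>n. \<bar>H n x\<bar>) \<longlonglongrightarrow> 0" using elim tendsto_rabs_zero by blast
        show "eventually (\<lambda>n. norm (W n x) \<le> \<bar>H n x\<bar>) sequentially"
          using e A(3) by (intro always_eventually) (auto simp: W_def max_def mult_nonneg_nonneg)
      qed
    qed
    then have Wl: "(\<lambda>n. \<integral>x. W n x \<partial>M) \<longlonglongrightarrow> (\<integral>x. 0 \<partial>M)"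
      by (intro integral_dominated_convergence[where w = "\<lambda>x. \<bar>C\<bar> * B x"]) (use B(1) Wb in auto)
    have Wi: "integrable M (W n)" for n
      by (rule Bochner_Integration.integrable_bound[of M "\<lambda>x. \<bar>C\<bar> * B x"])
         (use Wb B in \<open>auto intro!: AE_I2 order_trans[OF Wb]\<close>)
    have "eventually (\<lambda>n. (\<integral>x. W n x \<partial>M) < e) sequentially"
      using Wl e by (auto dest: order_tendstoD(2))
    then show "eventually (\<lambda>n. (\<integral>x. \<bar>H n x\<bar> \<partial>M) \<le> e * (K + 1)) sequentially"
    proof eventually_elim
      case (elim n)
      have "(\<integral>x. \<bar>H n x\<bar> \<partial>M) \<le> (\<integral>x. W n x + e * A n x \<partial>M)"
        using int[of n] Wi[of n] A(1)[of n] by (intro integral_mono) (auto simp: W_def)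
      also have "\<dots> = (\<integral>x. W n x \<partial>M) + e * (\<integral>x. A n x \<partial>M)"
        using Wi[of n] A(1)[of n] by simp
      also have "\<dots> \<le> e + e * K" using elim A(2)[of n] e by (intro add_mono mult_left_mono) auto
      finally show ?case by (simp add: algebra_simps)
    qed
  qed auto
qed

lemma Lq_AE_limit:
  assumes q: "0 < q" and g: "\<And>n. Lq q M (g n)" "\<And>n. Lint q M (g n) \<le> K"
    and lim: "AE x in M. (\<lambda>n. g n x) \<longlonglongrightarrow> w x" and w: "w \<in> borel_measurable M"
  shows "Lq q M (\<lambda>x. g n x - w x)" "Lint q M (\<lambda>x. g n x - w x) \<le> 2 powr q * (2 * K)"
proof -
  note F = Lq_Fatou[OF q g lim w]
  show "Lq q M (\<lambda>x. g n x - w x)" by (rule Lq_diff[OF q g(1) F(1)])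
  have "Lint q M (\<lambda>x. g n x - w x) \<le> 2 powr q * (Lint q M (g n) + Lint q M w)"
    by (rule Lq_diff[OF q g(1) F(1)])
  also have "\<dots> \<le> 2 powr q * (2 * K)"
    using g(2)[of n] F(2) by (intro mult_left_mono) auto
  finally show "Lint q M (\<lambda>x. g n x - w x) \<le> 2 powr q * (2 * K)" .
qed

lemma Young_epsilon:
  assumes pq: "1 < p" "1 < q" "1 / p + 1 / q = 1" and e: "0 < (e::real)"
  shows "\<exists>C. \<forall>a b. \<bar>a * b\<bar> \<le> e * \<bar>a\<bar> powr p + C * \<bar>b\<bar> powr q"
proof -
  \<comment> \<open>With this weight d^p / p = e, so Young's inequality puts exactly e in front of
    |a|^p.\<close>
  define d where "d = (e * p) powr (1 / p)"
  have d: "d > 0" "d powr p = e * p" using e pq by (auto simp: d_def powr_powr)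
  have "\<bar>a * b\<bar> \<le> e * \<bar>a\<bar> powr p + (1 / (d powr q * q)) * \<bar>b\<bar> powr q" for a b
  proof -
    have "\<bar>a * b\<bar> = (d * \<bar>a\<bar>) * (\<bar>b\<bar> / d)" using d by (simp add: abs_mult)
    also have "\<dots> \<le> (d * \<bar>a\<bar>) powr p / p + (\<bar>b\<bar> / d) powr q / q"
      using Youngs_inequality[OF _ _ pq(3), of "d * \<bar>a\<bar>" "\<bar>b\<bar> / d"] pq d by auto
    also have "\<dots> = e * \<bar>a\<bar> powr p + (1 / (d powr q * q)) * \<bar>b\<bar> powr q"
      using d(1) pq by (simp add: powr_mult powr_divide d(2))
    finally show ?thesis .
  qed
  then show ?thesis by blast
qed

text \<open>Takes the place of weak compactness: a bounded sequence that converges almost everywhere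
  converges weakly to the same limit. Young's inequality with e supplies the bound asked for by
  \<open>Brezis_Lieb_principle\<close>. The first conclusion is stronger than weak convergence;
  tested with an indicator it gives L^1 convergence on sets of finite measure.\<close>

lemma Lq_weak_limit:
  assumes pq: "1 < p" "1 < q" "1 / p + 1 / q = 1"
    and g: "\<And>n. Lq p M (g n)" "\<And>n. Lint p M (g n) \<le> K"
    and lim: "AE x in M. (\<lambda>n. g n x) \<longlonglongrightarrow> w x" and w: "w \<in> borel_measurable M"
    and f: "Lq q M f"
  shows "(\<lambda>n. \<integral>x. \<bar>(g n x - w x) * f x\<bar> \<partial>M) \<longlonglongrightarrow> 0"
    "(\<lambda>n. \<integral>x. g n x * f x \<partial>M) \<longlonglongrightarrow> (\<integral>x. w x * f x \<partial>M)"
proof -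
  have p0: "0 < p" using pq by simp
  note D = Lq_AE_limit[OF p0 g lim w] and F = Lq_Fatou[OF p0 g lim w]
  have m [measurable]: "f \<in> borel_measurable M" "\<And>n. g n \<in> borel_measurable M" "w \<in> borel_measurable M"
    using f g w by (auto simp: Lq_def)
  show 1: "(\<lambda>n. \<integral>x. \<bar>(g n x - w x) * f x\<bar> \<partial>M) \<longlonglongrightarrow> 0"
  proof (rule Brezis_Lieb_principle(2))
    show "AE x in M. (\<lambda>n. (g n x - w x) * f x) \<longlonglongrightarrow> 0"
      using lim by eventually_elim (auto intro!: tendsto_mult_left_zero simp flip: Lim_null)
    show "integrable M (\<lambda>x. \<bar>g n x - w x\<bar> powr p)" for n using D(1) by (rule Lq_integrable)
    show "(\<integral>x. \<bar>g n x - w x\<bar> powr p \<partial>M) \<le> 2 powr p * (2 * K)" for n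
      using D(2) by (simp add: Lint_def)
    show "integrable M (\<lambda>x. \<bar>f x\<bar> powr q)" using f by (rule Lq_integrable)
    show "\<exists>C. \<forall>n x. \<bar>(g n x - w x) * f x\<bar> \<le> e * \<bar>g n x - w x\<bar> powr p + C * \<bar>f x\<bar> powr q"
      if "0 < e" for e using Young_epsilon[OF pq that] by blast
  qed auto
  have eq: "(\<integral>x. (g n x - w x) * f x \<partial>M) = (\<integral>x. g n x * f x \<partial>M) - (\<integral>x. w x * f x \<partial>M)" for n
    using Holder(1)[OF pq g(1) f] Holder(1)[OF pq F(1) f] by (simp add: left_diff_distrib)
  have "(\<lambda>n. (\<integral>x. g n x * f x \<partial>M) - (\<integral>x. w x * f x \<partial>M)) \<longlonglongrightarrow> 0"
  proof (rule Lim_null_comparison[OF _ 1])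
    show "eventually (\<lambda>n. norm ((\<integral>x. g n x * f x \<partial>M) - (\<integral>x. w x * f x \<partial>M))
        \<le> (\<integral>x. \<bar>(g n x - w x) * f x\<bar> \<partial>M)) sequentially"
      unfolding eq[symmetric] real_norm_def by (intro always_eventually allI integral_abs_bound)
  qed
  then show "(\<lambda>n. \<integral>x. g n x * f x \<partial>M) \<longlonglongrightarrow> (\<integral>x. w x * f x \<partial>M)"
    using Lim_null by blast
qed

text \<open>Integrating the pointwise inequality leaves e K + C \<open>Lint q M (b n)\<close>; for
  fixed e, hence fixed C, the second term tends to 0.\<close>

lemma Lint_perturbation:
  assumes q: "1 < q" and a: "\<And>n. Lq q M (a n)" "\<And>n. Lint q M (a n) \<le> K"
    and b: "\<And>n. Lq q M (b n)" "(\<lambda>n. Lint q M (b n)) \<longlonglongrightarrow> 0"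
  shows "(\<lambda>n. Lint q M (\<lambda>x. a n x + b n x) - Lint q M (a n)) \<longlonglongrightarrow> 0"
    "(\<lambda>n. Lint (q / (q - 1)) M (\<lambda>x. Jp q (a n x + b n x) - Jp q (a n x))) \<longlonglongrightarrow> 0"
    "\<And>n. Lq (q / (q - 1)) M (\<lambda>x. Jp q (a n x + b n x) - Jp q (a n x))"
proof -
  have q0: "0 < q" using q by simp
  have m [measurable]: "\<And>n. a n \<in> borel_measurable M" "\<And>n. b n \<in> borel_measurable M"
    using a b by (auto simp: Lq_def)
  have small: "eventually (\<lambda>n. e * Lint q M (a n) + C * Lint q M (b n) \<le> e * (K + 1)) sequentially"
    if e: "0 < e" for e C
  proof -
    have "(\<lambda>n. C * Lint q M (b n)) \<longlonglongrightarrow> 0"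
      using tendsto_mult[OF tendsto_const b(2), of C] by simp
    then have "eventually (\<lambda>n. C * Lint q M (b n) < e) sequentially"
      using e by (auto dest: order_tendstoD(2))
    then show ?thesis
    proof eventually_elim
      case (elim n)
      have "e * Lint q M (a n) \<le> e * K" using a(2)[of n] e by (intro mult_left_mono) auto
      then show ?case using elim unfolding distrib_left by linarith
    qed
  qed
  have int: "integrable M (\<lambda>x. e * \<bar>a n x\<bar> powr q + C * \<bar>b n x\<bar> powr q)"
    "(\<integral>x. e * \<bar>a n x\<bar> powr q + C * \<bar>b n x\<bar> powr q \<partial>M) = e * Lint q M (a n) + C * Lint q M (b n)"
    for e C n using a(1)[of n] b(1)[of n] by (auto simp: Lint_def Lq_def)
  show "Lq (q / (q - 1)) M (\<lambda>x. Jp q (a n x + b n x) - Jp q (a n x))" for n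
    by (rule Lq_diff(1)[OF _ Lq_Jp(1)[OF q Lq_add(1)[OF q0 a(1) b(1)]] Lq_Jp(1)[OF q a(1)]]) (use q in simp)
  show "(\<lambda>n. Lint (q / (q - 1)) M (\<lambda>x. Jp q (a n x + b n x) - Jp q (a n x))) \<longlonglongrightarrow> 0"
  proof (rule tendsto_0_of_eventually_le[where K = "K + 1"])
    fix e :: real assume e: "0 < e"
    obtain C where C: "\<And>a b. \<bar>Jp q (a + b) - Jp q a\<bar> powr (q / (q - 1)) \<le> e * \<bar>a\<bar> powr q + C * \<bar>b\<bar> powr q"
      using Jp_perturbation_powr[OF q e] by auto
    have *: "Lint (q / (q - 1)) M (\<lambda>x. Jp q (a n x + b n x) - Jp q (a n x))
        \<le> e * Lint q M (a n) + C * Lint q M (b n)" for n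
      unfolding int(2)[symmetric] by (rule Lq_dominated[OF int(1)]) (auto intro: C)
    show "eventually (\<lambda>n. Lint (q / (q - 1)) M (\<lambda>x. Jp q (a n x + b n x) - Jp q (a n x))
        \<le> e * (K + 1)) sequentially"
      by (intro eventually_mono[OF small[OF e, of C]] order_trans[OF *])
  qed simp
  have "(\<lambda>n. \<bar>Lint q M (\<lambda>x. a n x + b n x) - Lint q M (a n)\<bar>) \<longlonglongrightarrow> 0"
  proof (rule tendsto_0_of_eventually_le[where K = "K + 1"])
    fix e :: real assume e: "0 < e"
    obtain C where C: "\<And>a b. \<bar>\<bar>a + b\<bar> powr q - \<bar>a\<bar> powr q\<bar> \<le> e * \<bar>a\<bar> powr q + C * \<bar>b\<bar> powr q"
      using abs_powr_perturbation[OF q0 e] by auto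
    have *: "\<bar>Lint q M (\<lambda>x. a n x + b n x) - Lint q M (a n)\<bar> \<le> e * Lint q M (a n) + C * Lint q M (b n)" for n
    proof -
      have i: "integrable M (\<lambda>x. \<bar>a n x + b n x\<bar> powr q)" "integrable M (\<lambda>x. \<bar>a n x\<bar> powr q)"
        using Lq_add(1)[OF q0 a(1) b(1)] a(1) by (auto simp: Lq_def)
      have "\<bar>Lint q M (\<lambda>x. a n x + b n x) - Lint q M (a n)\<bar>
          = \<bar>\<integral>x. \<bar>a n x + b n x\<bar> powr q - \<bar>a n x\<bar> powr q \<partial>M\<bar>"
        unfolding Lint_def using i by simp
      also have "\<dots> \<le> (\<integral>x. \<bar>\<bar>a n x + b n x\<bar> powr q - \<bar>a n x\<bar> powr q\<bar> \<partial>M)" by (rule integral_abs_bound)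
      also have "\<dots> \<le> (\<integral>x. e * \<bar>a n x\<bar> powr q + C * \<bar>b n x\<bar> powr q \<partial>M)"
        using i by (intro integral_mono int(1) C) auto
      finally show ?thesis by (simp add: int(2))
    qed
    show "eventually (\<lambda>n. \<bar>Lint q M (\<lambda>x. a n x + b n x) - Lint q M (a n)\<bar> \<le> e * (K + 1)) sequentially"
      by (intro eventually_mono[OF small[OF e, of C]] order_trans[OF *])
  qed simp
  then show "(\<lambda>n. Lint q M (\<lambda>x. a n x + b n x) - Lint q M (a n)) \<longlonglongrightarrow> 0"
    by (rule tendsto_rabs_zero_cancel)
qed

text \<open>The perturbation inequality is used at a = g n - w and b = w, so that e multiplies a
  bounded sequence and C a fixed integrable function, as \<open>Brezis_Lieb_principle\<close>
  requires. The second conclusion is the splitting of the derivative; being a norm in the dual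
  exponent, it is uniform over test functions once paired with them.\<close>

lemma Brezis_Lieb:
  assumes q: "1 < q" and g: "\<And>n. Lq q M (g n)" "\<And>n. Lint q M (g n) \<le> K"
    and lim: "AE x in M. (\<lambda>n. g n x) \<longlonglongrightarrow> w x" and w: "w \<in> borel_measurable M"
  shows "(\<lambda>n. Lint q M (g n) - Lint q M (\<lambda>x. g n x - w x)) \<longlonglongrightarrow> Lint q M w"
    "(\<lambda>n. Lint (q / (q - 1)) M (\<lambda>x. Jp q (g n x) - Jp q (g n x - w x) - Jp q (w x))) \<longlonglongrightarrow> 0"
proof -
  have q0: "0 < q" using q by simp
  note D = Lq_AE_limit[OF q0 g lim w] and F = Lq_Fatou[OF q0 g lim w]
  have m [measurable]: "\<And>n. g n \<in> borel_measurable M" "w \<in> borel_measurable M"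
    using g w by (auto simp: Lq_def)
  have iD: "integrable M (\<lambda>x. \<bar>g n x - w x\<bar> powr q)" for n using D(1) by (rule Lq_integrable)
  have bD: "(\<integral>x. \<bar>g n x - w x\<bar> powr q \<partial>M) \<le> 2 powr q * (2 * K)" for n using D(2) by (simp add: Lint_def)
  have iw: "integrable M (\<lambda>x. \<bar>w x\<bar> powr q)" using F(1) by (rule Lq_integrable)
  have ig: "integrable M (\<lambda>x. \<bar>g n x\<bar> powr q)" for n using g(1) by (rule Lq_integrable)
  have "(\<lambda>n. \<integral>x. \<bar>\<bar>g n x\<bar> powr q - \<bar>g n x - w x\<bar> powr q - \<bar>w x\<bar> powr q\<bar> \<partial>M) \<longlonglongrightarrow> 0"
  proof (rule Brezis_Lieb_principle(2)[OF _ _ iD bD _ iw])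
    show "AE x in M. (\<lambda>n. \<bar>g n x\<bar> powr q - \<bar>g n x - w x\<bar> powr q - \<bar>w x\<bar> powr q) \<longlonglongrightarrow> 0"
      using lim
    proof eventually_elim
      case (elim x)
      have "(\<lambda>n. \<bar>g n x\<bar> powr q - \<bar>g n x - w x\<bar> powr q - \<bar>w x\<bar> powr q) \<longlonglongrightarrow>
          \<bar>w x\<bar> powr q - \<bar>w x - w x\<bar> powr q - \<bar>w x\<bar> powr q"
        using q by (intro tendsto_diff tendsto_powr2 tendsto_rabs elim tendsto_const) auto
      then show ?case using q by simp
    qed
    fix e :: real assume e: "0 < e"
    obtain C where C: "\<And>a b. \<bar>\<bar>a + b\<bar> powr q - \<bar>a\<bar> powr q\<bar> \<le> e * \<bar>a\<bar> powr q + C * \<bar>b\<bar> powr q"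
      using abs_powr_perturbation[OF q0 e] by auto
    have "\<bar>\<bar>g n x\<bar> powr q - \<bar>g n x - w x\<bar> powr q - \<bar>w x\<bar> powr q\<bar>
        \<le> e * \<bar>g n x - w x\<bar> powr q + (C + 1) * \<bar>w x\<bar> powr q" for n x
    proof -
      have "\<bar>\<bar>g n x\<bar> powr q - \<bar>g n x - w x\<bar> powr q\<bar>
          \<le> e * \<bar>g n x - w x\<bar> powr q + C * \<bar>w x\<bar> powr q"
        using C[of "g n x - w x" "w x"] by simp
      moreover have "0 \<le> \<bar>w x\<bar> powr q" by simp
      ultimately show ?thesis unfolding distrib_right by linarith
    qed
    then show "\<exists>C. \<forall>n x. \<bar>\<bar>g n x\<bar> powr q - \<bar>g n x - w x\<bar> powr q - \<bar>w x\<bar> powr q\<bar>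
        \<le> e * \<bar>g n x - w x\<bar> powr q + C * \<bar>w x\<bar> powr q" by blast
  qed auto
  then have "(\<lambda>n. (Lint q M (g n) - Lint q M (\<lambda>x. g n x - w x)) - Lint q M w) \<longlonglongrightarrow> 0"
  proof (rule Lim_null_comparison[rotated])
    have "\<bar>(Lint q M (g n) - Lint q M (\<lambda>x. g n x - w x)) - Lint q M w\<bar>
        \<le> (\<integral>x. \<bar>\<bar>g n x\<bar> powr q - \<bar>g n x - w x\<bar> powr q - \<bar>w x\<bar> powr q\<bar> \<partial>M)" for n
    proof -
      have *: "(Lint q M (g n) - Lint q M (\<lambda>x. g n x - w x)) - Lint q M w
        = (\<integral>x. \<bar>g n x\<bar> powr q - \<bar>g n x - w x\<bar> powr q - \<bar>w x\<bar> powr q \<partial>M)"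
        unfolding Lint_def using ig[of n] iD[of n] iw by simp
      show ?thesis unfolding * by (rule integral_abs_bound)
    qed
    then show "eventually (\<lambda>n. norm ((Lint q M (g n) - Lint q M (\<lambda>x. g n x - w x)) - Lint q M w)
        \<le> (\<integral>x. \<bar>\<bar>g n x\<bar> powr q - \<bar>g n x - w x\<bar> powr q - \<bar>w x\<bar> powr q\<bar> \<partial>M)) sequentially" by simp
  qed
  then show "(\<lambda>n. Lint q M (g n) - Lint q M (\<lambda>x. g n x - w x)) \<longlonglongrightarrow> Lint q M w"
    using Lim_null by blast
  let ?r = "q / (q - 1)"
  have r: "?r > 1" using conjugate_exponent[OF q] by simp
  have "(\<lambda>n. \<integral>x. \<bar>\<bar>Jp q (g n x) - Jp q (g n x - w x) - Jp q (w x)\<bar> powr ?r\<bar> \<partial>M) \<longlonglongrightarrow> 0"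
  proof (rule Brezis_Lieb_principle(2)[OF _ _ iD bD _ iw])
    show "AE x in M. (\<lambda>n. \<bar>Jp q (g n x) - Jp q (g n x - w x) - Jp q (w x)\<bar> powr ?r) \<longlonglongrightarrow> 0"
      using lim
    proof eventually_elim
      case (elim x)
      have "(\<lambda>n. \<bar>Jp q (g n x) - Jp q (g n x - w x) - Jp q (w x)\<bar> powr ?r) \<longlonglongrightarrow>
          \<bar>Jp q (w x) - Jp q (w x - w x) - Jp q (w x)\<bar> powr ?r"
        using q by (intro tendsto_diff tendsto_powr2 tendsto_rabs tendsto_Jp elim tendsto_const) auto
      then show ?case using r by (simp add: Jp_def)
    qed
    fix e :: real assume e: "0 < e"
    \<comment> \<open>Separating off \<open>Jp q (w x)\<close> costs a factor 2 powr ?r, which e'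
      absorbs.\<close>
    define e' where "e' = e / 2 powr ?r"
    have e': "e' > 0" "2 powr ?r * e' = e" using e by (auto simp: e'_def)
    obtain C where C: "\<And>a b. \<bar>Jp q (a + b) - Jp q a\<bar> powr ?r \<le> e' * \<bar>a\<bar> powr q + C * \<bar>b\<bar> powr q"
      using Jp_perturbation_powr[OF q e'(1)] by auto
    have "\<bar>\<bar>Jp q (g n x) - Jp q (g n x - w x) - Jp q (w x)\<bar> powr ?r\<bar>
        \<le> e * \<bar>g n x - w x\<bar> powr q + (2 powr ?r * (C + 1)) * \<bar>w x\<bar> powr q" for n x
    proof -
      let ?X = "\<bar>Jp q (g n x) - Jp q (g n x - w x)\<bar>"
      have "\<bar>Jp q (g n x) - Jp q (g n x - w x) - Jp q (w x)\<bar> powr ?r \<le> (?X + \<bar>Jp q (w x)\<bar>) powr ?r"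
        using r by (intro powr_mono2) auto
      also have "\<dots> \<le> 2 powr ?r * (?X powr ?r + \<bar>Jp q (w x)\<bar> powr ?r)"
        using r by (intro powr_add_le) auto
      also have "\<dots> \<le> 2 powr ?r * ((e' * \<bar>g n x - w x\<bar> powr q + C * \<bar>w x\<bar> powr q) + \<bar>w x\<bar> powr q)"
        using C[of "g n x - w x" "w x"] by (intro mult_left_mono add_mono) (auto simp: Jp_conjugate_powr[OF q])
      also have "\<dots> = (2 powr ?r * e') * \<bar>g n x - w x\<bar> powr q + (2 powr ?r * (C + 1)) * \<bar>w x\<bar> powr q"
        by (simp add: algebra_simps)
      finally show ?thesis by (simp add: e'(2))
    qed
    then show "\<exists>C. \<forall>n x. \<bar>\<bar>Jp q (g n x) - Jp q (g n x - w x) - Jp q (w x)\<bar> powr ?r\<bar>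
        \<le> e * \<bar>g n x - w x\<bar> powr q + C * \<bar>w x\<bar> powr q" by blast
  qed auto
  then show "(\<lambda>n. Lint ?r M (\<lambda>x. Jp q (g n x) - Jp q (g n x - w x) - Jp q (w x))) \<longlonglongrightarrow> 0"
    by (simp add: Lint_def)
qed

section \<open>Affine changes of variables and norm-preserving rescaling\<close>

lemma nn_integral_affine:
  fixes f :: "'b::euclidean_space \<Rightarrow> ennreal"
  assumes [measurable]: "f \<in> borel_measurable borel" and l: "0 < l"
  shows "(\<integral>\<^sup>+x. f x \<partial>lborel) = ennreal (l powr DIM('b)) * (\<integral>\<^sup>+x. f (t + l *\<^sub>R x) \<partial>lborel)"
proof -
  have [measurable]: "(\<lambda>x. t + l *\<^sub>R x) \<in> borel_measurable borel" by simp
  show ?thesis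
    using l by (subst lborel_affine[of l t])
     (simp_all add: nn_integral_density nn_integral_distr nn_integral_cmult powr_realpow)
qed

lemma AE_affine:
  fixes P :: "'b::euclidean_space \<Rightarrow> bool"
  assumes [measurable]: "Measurable.pred borel P" and l: "0 < l" and P: "AE x in lborel. P x"
  shows "AE x in lborel. P (t + l *\<^sub>R x)"
proof -
  have m [measurable]: "(\<lambda>x. t + l *\<^sub>R x) \<in> borel_measurable borel" by simp
  have "AE x in density (distr lborel borel (\<lambda>x. t + l *\<^sub>R x)) (\<lambda>_. ennreal (\<bar>l\<bar>^DIM('b))). P x"
    by (subst lborel_affine[OF less_imp_neq[OF l, symmetric], of t, symmetric]) (rule P)
  then show ?thesis using l by (simp add: AE_density AE_distr_iff)
qed

lemma integral_affine:
  fixes f :: "'b::euclidean_space \<Rightarrow> real"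
  assumes [measurable]: "f \<in> borel_measurable borel" and l: "0 < l"
  shows "(\<integral>x. f x \<partial>lborel) = l powr DIM('b) * (\<integral>x. f (t + l *\<^sub>R x) \<partial>lborel)"
proof -
  have [measurable]: "(\<lambda>x. t + l *\<^sub>R x) \<in> borel_measurable borel" by simp
  show ?thesis
    using l by (subst lborel_affine[of l t])
     (simp_all add: integral_density integral_distr powr_realpow)
qed

text \<open>Zoom into t at scale l, normalised to be an isometry of L^q (\<open>Lq_rsc\<close>). The
  same operator serves for functions of one variable with the critical exponent and for difference
  quotients on pairs with exponent p (\<open>G_rsc\<close>).\<close>

definition rsc :: "real \<Rightarrow> 'b::euclidean_space \<Rightarrow> real \<Rightarrow> ('b \<Rightarrow> real) \<Rightarrow> 'b \<Rightarrow> real" where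
  "rsc q t l f x = l powr (DIM('b) / q) * f (t + l *\<^sub>R x)"

lemma rsc_measurable [measurable (raw)]:
  assumes [measurable]: "f \<in> borel_measurable borel"
  shows "rsc q t l f \<in> borel_measurable borel"
proof -
  have [measurable]: "(\<lambda>x. t + l *\<^sub>R x) \<in> borel_measurable borel" by simp
  show ?thesis unfolding rsc_def[abs_def] by measurable
qed

lemma Lq_rsc:
  fixes f :: "'b::euclidean_space \<Rightarrow> real"
  assumes q: "0 < q" and l: "0 < l" and f: "Lq q lborel f"
  shows "Lq q lborel (rsc q t l f)" "Lint q lborel (rsc q t l f) = Lint q lborel f"
proof -
  have m [measurable]: "f \<in> borel_measurable borel" using f by (simp add: Lq_def)
  have [measurable]: "(\<lambda>x. t + l *\<^sub>R x) \<in> borel_measurable borel" by simp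
  have eq: "ennreal (\<bar>rsc q t l f x\<bar> powr q) = ennreal (l powr DIM('b)) * ennreal (\<bar>f (t + l *\<^sub>R x)\<bar> powr q)" for x
    using q l by (simp add: rsc_def abs_mult powr_mult powr_powr flip: ennreal_mult)
  have "(\<integral>\<^sup>+x. ennreal (\<bar>rsc q t l f x\<bar> powr q) \<partial>lborel) = (\<integral>\<^sup>+x. ennreal (\<bar>f x\<bar> powr q) \<partial>lborel)"
    unfolding eq by (subst nn_integral_cmult) (simp_all add: nn_integral_affine[OF _ l, of "\<lambda>x. ennreal (\<bar>f x\<bar> powr q)" t])
  then have *: "(\<integral>\<^sup>+x. ennreal (\<bar>rsc q t l f x\<bar> powr q) \<partial>lborel) = ennreal (Lint q lborel f)"
    using Lq_nn(2)[OF _ f] by simp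
  have r: "rsc q t l f \<in> borel_measurable lborel" by simp
  show L: "Lq q lborel (rsc q t l f)" unfolding Lq_nn(1)[OF r] * by simp
  show "Lint q lborel (rsc q t l f) = Lint q lborel f"
    using Lq_nn(2)[OF r L] * by (simp add: ennreal_inj)
qed

text \<open>The homogeneity q - 1 of \<open>Jp q\<close> and the homogeneity 1 in g add up to q, so
  the weights produce exactly the Jacobian.\<close>

lemma integral_rsc:
  fixes f g :: "'b::euclidean_space \<Rightarrow> real"
  assumes q: "1 < q" and l: "0 < l" and [measurable]: "f \<in> borel_measurable borel" "g \<in> borel_measurable borel"
  shows "(\<integral>x. Jp q (rsc q t l f x) * rsc q t l g x \<partial>lborel) = (\<integral>x. Jp q (f x) * g x \<partial>lborel)"
proof -
  have c: "(l powr (DIM('b) / q)) powr (q - 1) * l powr (DIM('b) / q) = l powr DIM('b)"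
    using q l by (simp add: powr_powr field_simps flip: powr_add)
  have "Jp q (rsc q t l f x) * rsc q t l g x
     = l powr DIM('b) * (Jp q (f (t + l *\<^sub>R x)) * g (t + l *\<^sub>R x))" for x
    unfolding rsc_def using l q by (subst Jp_cmult) (auto simp flip: c)
  then have "(\<integral>x. Jp q (rsc q t l f x) * rsc q t l g x \<partial>lborel)
     = l powr DIM('b) * (\<integral>x. Jp q (f (t + l *\<^sub>R x)) * g (t + l *\<^sub>R x) \<partial>lborel)" by simp
  also have "\<dots> = (\<integral>x. Jp q (f x) * g x \<partial>lborel)"
    by (rule integral_affine[symmetric]) (use l in auto)
  finally show ?thesis .
qed

section \<open>Gagliardo seminorms\<close>

lemma convergent_of_summable_diff:
  fixes f :: "nat \<Rightarrow> real"
  assumes "summable (\<lambda>n. f (Suc n) - f n)"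
  shows "convergent f"
proof -
  have "(\<lambda>n. f 0 + (\<Sum>k<n. f (Suc k) - f k)) \<longlonglongrightarrow> f 0 + (\<Sum>k. f (Suc k) - f k)"
    using assms by (intro tendsto_add tendsto_const summable_LIMSEQ)
  then show ?thesis by (auto simp: sum_lessThan_telescope convergent_def)
qed

text \<open>The Riesz-Fischer argument on an exhaustion: the j-th increment of the subsequence is
  controlled on A j only, which is enough because every point eventually lies in A j.\<close>

lemma Cauchy_Lq_AE_subseq:
  fixes f :: "nat \<Rightarrow> 'b \<Rightarrow> real"
  assumes q: "0 < q" and f [measurable]: "\<And>n. f n \<in> borel_measurable M"
    and A [measurable]: "\<And>j. A j \<in> sets M"
    and cover: "\<And>x. x \<in> space M \<Longrightarrow> eventually (\<lambda>j. x \<in> A j) sequentially"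
    and L: "\<And>j n m. Lq q M (\<lambda>x. indicator (A j) x * (f n x - f m x))"
    and C: "\<And>j e. 0 < e \<Longrightarrow> \<exists>n0. \<forall>n\<ge>n0. \<forall>m\<ge>n0. Lint q M (\<lambda>x. indicator (A j) x * (f n x - f m x)) \<le> e"
  shows "\<exists>\<tau> w. strict_mono \<tau> \<and> w \<in> borel_measurable M \<and> (AE x in M. (\<lambda>n. f (\<tau> n) x) \<longlonglongrightarrow> w x)"
proof -
  \<comment> \<open>One factor 2^(-j) gives summability. The other is the q-th power of 2^(-j): it
    makes the integrals of 2^(j q) |g j|^q summable, and once this quantity is below 1 at a point,
    |g j| < 2^(-j) there.\<close>
  define e where "e j = ((1/2)^j) powr q * (1/2::real)^j" for j :: nat
  have e: "e j > 0" for j by (simp add: e_def)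
  define n0 where "n0 j = (SOME k. \<forall>n\<ge>k. \<forall>m\<ge>k. Lint q M (\<lambda>x. indicator (A j) x * (f n x - f m x)) \<le> e j)" for j
  have n0: "Lint q M (\<lambda>x. indicator (A j) x * (f n x - f m x)) \<le> e j" if "n \<ge> n0 j" "m \<ge> n0 j" for j n m
    using someI_ex[OF C[OF e[of j], of j]] that unfolding n0_def by blast
  \<comment> \<open>The sum puts \<tau> j above all thresholds up to j; the added j makes \<tau>
    strictly increasing.\<close>
  define \<tau> where "\<tau> j = (\<Sum>i\<le>j. n0 i) + j" for j
  have \<tau>: "strict_mono \<tau>" unfolding \<tau>_def by (rule strict_monoI_Suc) simp
  have \<tau>n: "n0 j \<le> \<tau> j" for j
    unfolding \<tau>_def using member_le_sum[of j "{..j}" n0] by simp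
  have \<tau>S: "n0 j \<le> \<tau> (Suc j)" for j
    using \<tau>n[of j] strict_monoD[OF \<tau>, of j "Suc j"] by simp
  define g where "g j x = indicator (A j) x * (f (\<tau> (Suc j)) x - f (\<tau> j) x)" for j x
  have g [measurable]: "g j \<in> borel_measurable M" for j unfolding g_def[abs_def] by measurable
  have gL: "Lq q M (g j)" "Lint q M (g j) \<le> e j" for j
    using L n0[OF \<tau>S \<tau>n] unfolding g_def[abs_def] by auto
  define W where "W j x = ennreal (2 powr (j * q) * \<bar>g j x\<bar> powr q)" for j :: nat and x
  have W [measurable]: "W j \<in> borel_measurable M" for j unfolding W_def[abs_def] by measurable
  have Wj: "(\<integral>\<^sup>+x. W j x \<partial>M) \<le> ennreal ((1/2)^j)" for j
  proof -
    have "(\<integral>\<^sup>+x. W j x \<partial>M) = ennreal (2 powr (j * q)) * (\<integral>\<^sup>+x. ennreal (\<bar>g j x\<bar> powr q) \<partial>M)"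
      unfolding W_def by (simp add: ennreal_mult nn_integral_cmult)
    also have "\<dots> = ennreal (2 powr (j * q) * Lint q M (g j))"
      using Lq_nn(2)[OF g gL(1)] by (simp add: ennreal_mult)
    also have "\<dots> \<le> ennreal (2 powr (j * q) * e j)"
      using gL(2) by (intro ennreal_leI mult_left_mono) auto
    also have "2 powr (j * q) * e j = (1/2)^j"
    proof -
      have "(1/2::real)^j = 2 powr (- real j)" by (simp add: powr_minus_divide powr_realpow power_one_over)
      then have "((1/2::real)^j) powr q = 2 powr (- (j * q))" by (simp add: powr_powr)
      then show ?thesis by (simp add: e_def powr_minus)
    qed
    finally show ?thesis .
  qed
  have "(\<integral>\<^sup>+x. (\<Sum>j. W j x) \<partial>M) = (\<Sum>j. \<integral>\<^sup>+x. W j x \<partial>M)"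
    by (rule nn_integral_suminf) auto
  also have "\<dots> \<le> (\<Sum>j. ennreal ((1/2)^j))" by (intro suminf_le Wj summableI)
  also have "\<dots> = ennreal (\<Sum>j. (1/2)^j)" by (intro suminf_ennreal2 summable_geometric) auto
  also have "\<dots> < \<infinity>" by simp
  finally have "AE x in M. (\<Sum>j. W j x) \<noteq> \<infinity>"
    by (intro nn_integral_noteq_infinite) auto
  then have conv: "AE x in M. convergent (\<lambda>n. f (\<tau> n) x)"
  proof (rule AE_mp, intro AE_I2 impI)
    fix x assume x: "x \<in> space M" and fin: "(\<Sum>j. W j x) \<noteq> \<infinity>"
    have "summable (\<lambda>j. 2 powr (j * q) * \<bar>g j x\<bar> powr q)"
      using fin unfolding W_def by (intro summable_suminf_not_top) auto
    then have "(\<lambda>j. 2 powr (j * q) * \<bar>g j x\<bar> powr q) \<longlonglongrightarrow> 0" by (rule summable_LIMSEQ_zero)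
    then have "eventually (\<lambda>j. 2 powr (j * q) * \<bar>g j x\<bar> powr q < 1) sequentially"
      by (rule order_tendstoD(2)) simp
    then have "eventually (\<lambda>j. norm (f (\<tau> (Suc j)) x - f (\<tau> j) x) \<le> (1/2)^j) sequentially"
      using cover[OF x]
    proof eventually_elim
      case (elim j)
      have "(2 ^ j * \<bar>g j x\<bar>) powr q = 2 powr (j * q) * \<bar>g j x\<bar> powr q"
        by (simp add: powr_mult powr_powr powr_realpow[symmetric])
      then have "(2 ^ j * \<bar>g j x\<bar>) powr q < 1 powr q" using elim by simp
      then have "2 ^ j * \<bar>g j x\<bar> < 1"
        using q by (metis linorder_not_less powr_mono2 zero_le_one less_imp_le)
      then show ?case using elim by (simp add: g_def power_one_over field_simps)
    qed
    then have "summable (\<lambda>j. f (\<tau> (Suc j)) x - f (\<tau> j) x)"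
      by (rule summable_comparison_test_ev) (auto intro: summable_geometric)
    then show "convergent (\<lambda>n. f (\<tau> n) x)" by (rule convergent_of_summable_diff)
  qed
  define w where "w x = lim (\<lambda>n. f (\<tau> n) x)" for x
  have "w \<in> borel_measurable M" unfolding w_def[abs_def] by (rule borel_measurable_lim_metric) auto
  moreover have "AE x in M. (\<lambda>n. f (\<tau> n) x) \<longlonglongrightarrow> w x"
    using conv by eventually_elim (simp add: w_def convergent_LIMSEQ_iff)
  ultimately show ?thesis using \<tau> by blast
qed

lemma AE_lborel_fst_snd:
  assumes "AE x in (lborel :: 'b::euclidean_space measure). P x"
  shows "AE z in (lborel :: ('b \<times> 'b) measure). P (fst z) \<and> P (snd z)"
proof -
  obtain S where S: "{x. \<not> P x} \<subseteq> S" "emeasure lborel S = 0" "S \<in> sets borel"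
    using assms by (auto elim: AE_E)
  have "emeasure (lborel \<Otimes>\<^sub>M lborel) (S \<times> (UNIV :: 'b set)) = 0"
    using S by (subst lborel.emeasure_pair_measure_Times) auto
  then have 1: "S \<times> (UNIV :: 'b set) \<in> null_sets (lborel :: ('b \<times> 'b) measure)"
    using S(3) unfolding lborel_prod by (auto simp: null_sets_def intro!: borel_Times)
  have "emeasure (lborel \<Otimes>\<^sub>M lborel) ((UNIV :: 'b set) \<times> S) = 0"
    using S by (subst lborel.emeasure_pair_measure_Times) auto
  then have 2: "(UNIV :: 'b set) \<times> S \<in> null_sets (lborel :: ('b \<times> 'b) measure)"
    using S(3) unfolding lborel_prod by (auto simp: null_sets_def intro!: borel_Times)
  show ?thesis
    using AE_not_in[OF 1] AE_not_in[OF 2] by eventually_elim (use S(1) in \<open>auto simp: mem_Times_iff\<close>)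
qed

lemma Lq_indicator:
  assumes "B \<in> sets M" "emeasure M B = ennreal m" "0 \<le> m"
  shows "Lq q M (indicator B)" "Lint q M (indicator B) = m"
proof -
  have "(\<lambda>x. \<bar>indicator B x :: real\<bar> powr q) = indicator B" by (auto simp: indicator_def)
  moreover have "emeasure M B < \<infinity>" "measure M B = m" using assms by (auto simp: measure_def)
  ultimately show "Lq q M (indicator B)" "Lint q M (indicator B) = m"
    unfolding Lq_def Lint_def using assms(1) by auto
qed

lemma Lq_integrable_on:
  assumes q: "1 < q" and f: "Lq q M f" and B: "B \<in> sets M" "emeasure M B = ennreal m" "0 \<le> m"
  shows "integrable M (\<lambda>x. indicator B x * f x)"
    "\<bar>\<integral>x. indicator B x * f x \<partial>M\<bar> \<le> Lint q M f powr (1 / q) * m powr (1 - 1 / q)"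
    "(\<integral>x. \<bar>indicator B x * f x\<bar> \<partial>M) \<le> Lint q M f powr (1 / q) * m powr (1 - 1 / q)"
proof -
  have e: "1 / (q / (q - 1)) = 1 - 1 / q" using q by (simp add: field_simps)
  note H = Holder[OF q conjugate_exponent(1,3)[OF q] f Lq_indicator(1)[OF B]]
  show "integrable M (\<lambda>x. indicator B x * f x)"
    "\<bar>\<integral>x. indicator B x * f x \<partial>M\<bar> \<le> Lint q M f powr (1 / q) * m powr (1 - 1 / q)"
    "(\<integral>x. \<bar>indicator B x * f x\<bar> \<partial>M) \<le> Lint q M f powr (1 / q) * m powr (1 - 1 / q)"
    using H unfolding Lq_indicator(2)[OF B] e by (simp_all add: mult.commute)
qed

lemma emeasure_ball_scale:
  fixes z :: "'b::euclidean_space"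
  assumes "0 < r"
  shows "emeasure lborel (ball z r) = ennreal (unit_ball_vol DIM('b) * r powr DIM('b))"
  using assms by (simp add: emeasure_ball powr_realpow)

text \<open>\<open>al\<close> equals N / q: multiplying u (z + l x) by l^al preserves both the
  critical norm and the energy. N, q and al are parameters tied down by equations so that they act
  as atomic symbols.\<close>

locale fractional =
  fixes s p N q al :: real and T :: "'a::euclidean_space itself"
  assumes p1: "1 < p" and s0: "0 < s" and s1: "s < 1" and sp: "s * p < N"
    and N_def: "N = real DIM('a)" and q_def: "q = pstar N s p" and al_def: "al = (N - s * p) / p"
begin

abbreviation vol :: real where "vol \<equiv> unit_ball_vol N"

lemma p0: "0 < p" and sp0: "0 < s * p" and N0: "0 < N" and Nsp: "0 < N - s * p"
  using p1 s0 sp by (auto simp: N_def)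

lemma p_less_q: "p < q"
proof -
  have "p * (N - s * p) < N * p" using p0 sp0 by (simp add: algebra_simps)
  then show ?thesis using Nsp by (simp add: q_def pstar_def less_divide_eq)
qed

lemma q1: "1 < q" and q0: "0 < q" using p_less_q p1 by auto

lemma N_div_q: "N / q = al" using Nsp N0 p0 by (simp add: q_def pstar_def al_def)

lemma vol0: "0 < vol" using N0 by simp

definition G :: "('a \<Rightarrow> real) \<Rightarrow> 'a \<times> 'a \<Rightarrow> real" where
  "G u z = (u (fst z) - u (snd z)) / norm (fst z - snd z) powr ((N + s * p) / p)"

lemma G_measurable [measurable (raw)]:
  assumes [measurable]: "u \<in> borel_measurable borel"
  shows "G u \<in> borel_measurable borel"
proof -
  have "G u \<in> borel_measurable (borel \<Otimes>\<^sub>M borel)"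
    unfolding G_def[abs_def] by measurable
  then show ?thesis by (simp add: borel_prod)
qed

lemma G_add: "G (\<lambda>x. u x + v x) = (\<lambda>z. G u z + G v z)"
  and G_diff: "G (\<lambda>x. u x - v x) = (\<lambda>z. G u z - G v z)"
  and G_cmult: "G (\<lambda>x. c * u x) = (\<lambda>z. c * G u z)"
  by (auto simp: G_def fun_eq_iff add_divide_distrib diff_divide_distrib algebra_simps)

lemma abs_G_powr: "\<bar>G u z\<bar> powr p = \<bar>u (fst z) - u (snd z)\<bar> powr p / norm (fst z - snd z) powr (N + s * p)"
  using p0 by (simp add: G_def abs_divide powr_divide powr_powr)

lemma gag_nn_eq: "gag_nn s p u = (\<integral>\<^sup>+z. ennreal (\<bar>G u z\<bar> powr p) \<partial>lborel)"
  by (simp add: gag_nn_def abs_G_powr lborel_prod flip: N_def)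

lemma Dsp_iff: "Dsp s p (u :: 'a \<Rightarrow> real) \<longleftrightarrow> Lq q lborel u \<and> Lq p lborel (G u)"
proof (cases "u \<in> borel_measurable lborel")
  case True
  then have "G u \<in> borel_measurable lborel" by simp
  then show ?thesis using True Lq_nn(1)[of "G u" lborel p] by (auto simp: Dsp_def Lq_def gag_nn_eq q_def N_def)
qed (auto simp: Dsp_def Lq_def)

lemma Dsp_measurable: "Dsp s p (u :: 'a \<Rightarrow> real) \<Longrightarrow> u \<in> borel_measurable borel"
  by (simp add: Dsp_def)

lemma DspD: "Dsp s p (u :: 'a \<Rightarrow> real) \<Longrightarrow> Lq q lborel u" "Dsp s p u \<Longrightarrow> Lq p lborel (G u)"
  by (auto simp: Dsp_iff)

lemma gagp_eq:
  assumes "Dsp s p (u :: 'a \<Rightarrow> real)" shows "gagp s p u = Lint p lborel (G u)"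
proof -
  have "gag_nn s p u = ennreal (Lint p lborel (G u))"
    using Lq_nn(2)[OF _ DspD(2)[OF assms]] Dsp_measurable[OF assms] by (simp add: gag_nn_eq)
  then show ?thesis by (simp add: gagp_def)
qed

lemma gagp_nonneg [simp]: "0 \<le> gagp s p u"
  by (simp add: gagp_def)

lemma Dsp_add:
  assumes "Dsp s p (u :: 'a \<Rightarrow> real)" "Dsp s p v"
  shows "Dsp s p (\<lambda>x. u x + v x)" "gagp s p (\<lambda>x. u x + v x) \<le> 2 powr p * (gagp s p u + gagp s p v)"
proof -
  show *: "Dsp s p (\<lambda>x. u x + v x)"
    using assms Lq_add(1)[OF q0] Lq_add(1)[OF p0] by (auto simp: Dsp_iff G_add)
  show "gagp s p (\<lambda>x. u x + v x) \<le> 2 powr p * (gagp s p u + gagp s p v)"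
    using Lq_add(2)[OF p0 DspD(2)[OF assms(1)] DspD(2)[OF assms(2)]] by (simp add: gagp_eq * assms G_add)
qed

lemma Dsp_cmult:
  assumes "Dsp s p (u :: 'a \<Rightarrow> real)"
  shows "Dsp s p (\<lambda>x. c * u x)" "gagp s p (\<lambda>x. c * u x) = \<bar>c\<bar> powr p * gagp s p u"
proof -
  show *: "Dsp s p (\<lambda>x. c * u x)"
    using assms unfolding Dsp_iff G_cmult by (blast intro: Lq_cmult(1))
  show "gagp s p (\<lambda>x. c * u x) = \<bar>c\<bar> powr p * gagp s p u"
    using Lq_cmult(2)[OF DspD(2)[OF assms(1)]] by (simp add: gagp_eq * assms G_cmult)
qed

lemma Dsp_diff:
  assumes "Dsp s p (u :: 'a \<Rightarrow> real)" "Dsp s p v"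
  shows "Dsp s p (\<lambda>x. u x - v x)" "gagp s p (\<lambda>x. u x - v x) \<le> 2 powr p * (gagp s p u + gagp s p v)"
  using Dsp_add[OF assms(1) Dsp_cmult(1)[OF assms(2), of "-1"]] Dsp_cmult(2)[OF assms(2), of "-1"] by auto

lemma Dsp_zero: "Dsp s p (\<lambda>x::'a. 0)" "gagp s p (\<lambda>x::'a. 0) = 0"
proof -
  have "G (\<lambda>x. 0) = (\<lambda>z. 0)" by (simp add: G_def fun_eq_iff)
  then show *: "Dsp s p (\<lambda>x::'a. 0)" by (simp add: Dsp_iff Lq_def)
  show "gagp s p (\<lambda>x::'a. 0) = 0" unfolding gagp_eq[OF *] by (simp add: G_def Lint_def)
qed

lemma Dsp_sum:
  assumes "finite I" "\<And>i. i \<in> I \<Longrightarrow> Dsp s p (u i :: 'a \<Rightarrow> real)"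
  shows "Dsp s p (\<lambda>x. \<Sum>i\<in>I. u i x)"
  using assms by (induction I rule: finite_induct) (auto intro: Dsp_zero(1) Dsp_add(1))

text \<open>The p-th power of the nonlocal gradient |D^s u| at x; its integral is the energy. It
  takes values in \<open>ennreal\<close> because it may be infinite at some points.\<close>

definition Dx :: "('a \<Rightarrow> real) \<Rightarrow> 'a \<Rightarrow> ennreal" where
  "Dx u x = (\<integral>\<^sup>+y. ennreal (\<bar>G u (x, y)\<bar> powr p) \<partial>lborel)"

lemma Dx_measurable [measurable (raw)]:
  assumes [measurable]: "u \<in> borel_measurable borel"
  shows "Dx u \<in> borel_measurable borel"
proof -
  have [measurable]: "(\<lambda>z. ennreal (\<bar>G u z\<bar> powr p)) \<in> borel_measurable (lborel \<Otimes>\<^sub>M lborel)"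
    unfolding lborel_prod by simp
  show ?thesis unfolding Dx_def[abs_def]
    using lborel.borel_measurable_nn_integral_fst[of "\<lambda>z. ennreal (\<bar>G u z\<bar> powr p)" lborel] by simp
qed

lemma nn_integral_Dx:
  assumes "Dsp s p (u :: 'a \<Rightarrow> real)"
  shows "(\<integral>\<^sup>+x. Dx u x \<partial>lborel) = ennreal (gagp s p u)"
proof -
  have [measurable]: "u \<in> borel_measurable borel" using assms by (rule Dsp_measurable)
  have "(\<lambda>z. ennreal (\<bar>G u z\<bar> powr p)) \<in> borel_measurable (lborel \<Otimes>\<^sub>M lborel)"
    unfolding lborel_prod by simp
  from lborel.nn_integral_fst[OF this]
  have "(\<integral>\<^sup>+x. Dx u x \<partial>lborel) = (\<integral>\<^sup>+z. ennreal (\<bar>G u z\<bar> powr p) \<partial>lborel)"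
    unfolding Dx_def lborel_prod by simp
  also have "\<dots> = ennreal (gagp s p u)"
    using Lq_nn(2)[OF _ DspD(2)[OF assms]] by (simp add: gagp_eq assms)
  finally show ?thesis .
qed

text \<open>u x minus the mean of u over B is the mean of u x - u y over y in B. Hoelder's
  inequality bounds it by the L^p norm of this difference, and on B the kernel of the energy is at
  least \<rho>^(-N - s p). Allowing balls B not centred at x makes it possible to compare two
  points, or a point and a grid node, through one and the same ball.\<close>

lemma local_mean:
  assumes [measurable]: "u \<in> borel_measurable borel" and B: "B \<in> sets borel" "emeasure lborel B = ennreal m" "0 < m"
    and sub: "B \<subseteq> cball x \<rho>" and \<rho>: "0 < \<rho>" and int: "integrable lborel (\<lambda>y. indicator B y * u y)"
  shows "ennreal (\<bar>u x - (\<integral>y. indicator B y * u y \<partial>lborel) / m\<bar> powr p) \<le> ennreal (\<rho> powr (N + s * p) / m) * Dx u x"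
proof (cases "Dx u x = \<infinity>")
  case True
  have "ennreal (\<rho> powr (N + s * p) / m) \<noteq> 0" using B \<rho> by simp
  then show ?thesis using True by (simp add: ennreal_mult_eq_top_iff)
next
  case False
  then obtain d where d: "Dx u x = ennreal d" "0 \<le> d" by (cases "Dx u x") auto
  define h where "h y = indicator B y * (u x - u y)" for y
  have [measurable]: "B \<in> sets borel" by fact
  have hm [measurable]: "h \<in> borel_measurable lborel" unfolding h_def[abs_def] by measurable
  have [measurable]: "(\<lambda>y. G u (x, y)) \<in> borel_measurable borel" by (simp add: G_def)
  have "\<bar>h y\<bar> powr p \<le> \<rho> powr (N + s * p) * \<bar>G u (x, y)\<bar> powr p" for y
  proof (cases "y \<in> B \<and> y \<noteq> x")
    case True
    then have n: "0 < norm (x - y)" "norm (x - y) \<le> \<rho>" using sub by (auto simp: dist_norm)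
    have "norm (x - y) powr (N + s * p) \<le> \<rho> powr (N + s * p)"
      using n N0 sp0 by (intro powr_mono2) auto
    then have "\<bar>u x - u y\<bar> powr p * norm (x - y) powr (N + s * p) \<le> \<bar>u x - u y\<bar> powr p * \<rho> powr (N + s * p)"
      by (intro mult_left_mono) auto
    then show ?thesis using True n by (simp add: h_def abs_G_powr field_simps)
  qed (auto simp: h_def)
  then have "(\<integral>\<^sup>+y. ennreal (\<bar>h y\<bar> powr p) \<partial>lborel) \<le> (\<integral>\<^sup>+y. ennreal (\<rho> powr (N + s * p)) * ennreal (\<bar>G u (x, y)\<bar> powr p) \<partial>lborel)"
    by (intro nn_integral_mono) (simp flip: ennreal_mult)
  also have "\<dots> = ennreal (\<rho> powr (N + s * p)) * Dx u x"
    unfolding Dx_def by (rule nn_integral_cmult) measurable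
  also have "\<dots> = ennreal (\<rho> powr (N + s * p) * d)" using d by (simp add: ennreal_mult)
  finally have hL: "Lq p lborel h" "Lint p lborel h \<le> \<rho> powr (N + s * p) * d"
    using Lq_of_nn_le[OF hm] d by auto
  note H = Lq_integrable_on[OF p1 hL(1) _ B(2)]
  have e1: "(\<integral>y. indicator B y * h y \<partial>lborel) = m * u x - (\<integral>y. indicator B y * u y \<partial>lborel)"
  proof -
    have "integrable lborel (\<lambda>y. indicator B y * u x)" using Lq_indicator(1)[of B lborel m 1] B by (auto simp: Lq_def)
    moreover have "(\<integral>y. indicator B y * u x \<partial>lborel) = m * u x" using B by (simp add: measure_def)
    moreover have "indicator B y * h y = indicator B y * u x - indicator B y * u y" for y
      by (auto simp: h_def indicator_def)
    ultimately show ?thesis using int by simp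
  qed
  have "\<bar>u x - (\<integral>y. indicator B y * u y \<partial>lborel) / m\<bar> = \<bar>\<integral>y. indicator B y * h y \<partial>lborel\<bar> / m"
  proof -
    have "u x - (\<integral>y. indicator B y * u y \<partial>lborel) / m = (m * u x - (\<integral>y. indicator B y * u y \<partial>lborel)) / m"
      using B by (simp add: diff_divide_distrib)
    then show ?thesis unfolding e1 using B by (simp only: abs_divide abs_of_pos)
  qed
  also have "\<dots> \<le> (Lint p lborel h powr (1 / p) * m powr (1 - 1 / p)) / m"
    using H B by (intro divide_right_mono) auto
  also have "\<dots> = Lint p lborel h powr (1 / p) * m powr (- (1 / p))"
    using B powr_diff[of m "1 - 1 / p" 1] by simp
  finally have "\<bar>u x - (\<integral>y. indicator B y * u y \<partial>lborel) / m\<bar> powr p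
      \<le> (Lint p lborel h powr (1 / p) * m powr (- (1 / p))) powr p"
    using p0 by (intro powr_mono2) auto
  also have "\<dots> = Lint p lborel h / m"
    using p0 B by (simp add: powr_divide powr_powr powr_minus_divide)
  also have "\<dots> \<le> (\<rho> powr (N + s * p) * d) / m" using hL(2) B by (intro divide_right_mono) auto
  also have "\<dots> = \<rho> powr (N + s * p) / m * d" by simp
  finally have "ennreal (\<bar>u x - (\<integral>y. indicator B y * u y \<partial>lborel) / m\<bar> powr p) \<le> ennreal (\<rho> powr (N + s * p) / m * d)"
    by (rule ennreal_leI)
  then show ?thesis using d B by (simp add: ennreal_mult'[symmetric])
qed

end

section \<open>Sobolev inequality and local compactness\<close>

lemma powr_le_cancel:
  fixes a b q :: real
  assumes "0 < q" "0 \<le> b" "a powr q \<le> b powr q"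
  shows "a \<le> b"
  using assms powr_less_mono2[of q b a] by force

context fractional
begin

lemma emeasure_ball_N: "0 < r \<Longrightarrow> emeasure lborel (ball (z::'a) r) = ennreal (vol * r powr N)"
  by (simp add: emeasure_ball_scale N_def)

lemma integrable_on_ball:
  assumes "Lq q lborel (u :: 'a \<Rightarrow> real)" "0 < r"
  shows "integrable lborel (\<lambda>y. indicator (ball z r) y * u y)"
    "\<bar>\<integral>y. indicator (ball z r) y * u y \<partial>lborel\<bar> \<le> Lint q lborel u powr (1 / q) * (vol * r powr N) powr (1 - 1 / q)"
  using Lq_integrable_on[OF q1 assms(1) _ emeasure_ball_N[OF assms(2)]] vol0 by auto

text \<open>Hedberg's argument: |u x| is at most the oscillation on a ball of radius r, of order r^s
  D with D^p the nonlocal gradient at x, plus the mean, of order M r^(-al). At the balancing radius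
  both equal M^(s p / N) D^(1 - s p / N), whose q-th power is M^(q - p) D^p.\<close>

lemma Hedberg:
  assumes u: "Dsp s p (u :: 'a \<Rightarrow> real)" and M: "0 < M"
    and bd: "\<And>r. 0 < r \<Longrightarrow> \<bar>\<integral>y. indicator (ball x r) y * u y \<partial>lborel\<bar> \<le> M * r powr (N - al)"
    and d: "Dx u x = ennreal d" "0 \<le> d"
  shows "\<bar>u x\<bar> powr q \<le> (vol powr (- (1 / p)) + 1 / vol) powr q * M powr (q - p) * d"
proof -
  define C where "C = vol powr (- (1 / p)) + 1 / vol"
  have C: "C > 0" using vol0 by (simp add: C_def add_pos_pos)
  \<comment> \<open>The balancing radius divides by D, so d, which may be 0, is first replaced by
    any positive e above it; the limit is taken at the end.\<close>
  have key: "\<bar>u x\<bar> powr q \<le> C powr q * M powr (q - p) * e" if e: "d \<le> e" "0 < e" for e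
  proof -
    define D where "D = e powr (1 / p)"
    have D: "D > 0" "D powr p = e" using e p0 by (auto simp: D_def powr_powr)
    \<comment> \<open>The solution of r^s D = M r^(-al), since s + al = N / p.\<close>
    define r where "r = (M / D) powr (p / N)"
    have r: "r > 0" using M D by (simp add: r_def)
    define I where "I = (\<integral>y. indicator (ball x r) y * u y \<partial>lborel)"
    have m0: "0 < vol * r powr N" using vol0 r by simp
    have "ennreal (\<bar>u x - I / (vol * r powr N)\<bar> powr p) \<le> ennreal (r powr (N + s * p) / (vol * r powr N)) * Dx u x"
      unfolding I_def
      by (rule local_mean[OF Dsp_measurable[OF u] _ emeasure_ball_N[OF r] m0 _ r])
         (auto intro: integrable_on_ball DspD u r)
    also have "\<dots> = ennreal (r powr (N + s * p) / (vol * r powr N) * d)"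
      using d vol0 by (simp add: ennreal_mult'[symmetric])
    also have "r powr (N + s * p) / (vol * r powr N) * d = r powr (s * p) / vol * d"
      using r by (simp add: powr_add)
    finally have "\<bar>u x - I / (vol * r powr N)\<bar> powr p \<le> r powr (s * p) / vol * d"
      using d vol0 by (subst (asm) ennreal_le_iff) auto
    also have "\<dots> \<le> r powr (s * p) / vol * e" using e vol0 by (intro mult_left_mono) auto
    also have "\<dots> = (vol powr (- (1 / p)) * r powr s * D) powr p"
      using p0 vol0 D r by (simp add: powr_mult powr_powr powr_minus_divide powr_divide)
    finally have 1: "\<bar>u x - I / (vol * r powr N)\<bar> \<le> vol powr (- (1 / p)) * r powr s * D"
      by (rule powr_le_cancel[OF p0, rotated]) (use D in simp)
    have "\<bar>I / (vol * r powr N)\<bar> \<le> M * r powr (N - al) / (vol * r powr N)"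
      using divide_right_mono[OF bd[OF r], of "vol * r powr N"] m0
      by (simp only: I_def abs_divide abs_of_pos)
    also have "\<dots> = 1 / vol * (M * r powr (- al))"
      using r by (simp add: powr_diff powr_minus field_simps)
    finally have 2: "\<bar>I / (vol * r powr N)\<bar> \<le> 1 / vol * (M * r powr (- al))" .
    define X where "X = M powr (s * p / N) * D powr (1 - s * p / N)"
    have e1: "r powr s * D = X"
    proof -
      have "r powr s * D = (M / D) powr (s * p / N) * D powr 1"
        using D by (simp add: r_def powr_powr mult.commute)
      also have "\<dots> = X" using M D by (simp add: X_def powr_divide powr_diff)
      finally show ?thesis .
    qed
    have e2: "M * r powr (- al) = X"
    proof -
      have a: "p / N * - al = - (1 - s * p / N)" using p0 N0 by (simp add: al_def field_simps)
      have "M * r powr (- al) = M powr 1 * (M / D) powr (- (1 - s * p / N))"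
        using M by (simp only: r_def powr_powr a powr_one)
      also have "\<dots> = M powr 1 * M powr (- (1 - s * p / N)) * D powr (1 - s * p / N)"
        using M D(1) powr_minus_divide[of "M / D" "1 - s * p / N"] powr_minus_divide[of M "1 - s * p / N"]
        by (simp only: powr_divide less_imp_le) simp
      also have "\<dots> = X" by (simp only: X_def powr_add[symmetric]) simp
      finally show ?thesis .
    qed
    have X0: "X > 0" using M D by (simp add: X_def)
    have "\<bar>u x\<bar> \<le> vol powr (- (1 / p)) * (r powr s * D) + 1 / vol * (M * r powr (- al))"
      using order_trans[OF abs_triangle_ineq add_mono[OF 1 2]] by (simp add: mult.assoc)
    also have "\<dots> = C * X" unfolding e1 e2 C_def by (simp add: algebra_simps)
    finally have "\<bar>u x\<bar> powr q \<le> (C * X) powr q" using q0 by (intro powr_mono2) auto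
    also have "\<dots> = C powr q * (M powr (s * p / N * q) * D powr ((1 - s * p / N) * q))"
      using C X0 M D by (simp add: X_def powr_mult powr_powr)
    also have "s * p / N * q = q - p"
      using N0 Nsp by (simp add: q_def pstar_def field_simps)
    also have "(1 - s * p / N) * q = p"
      using N0 Nsp by (simp add: q_def pstar_def field_simps)
    finally show ?thesis using D by simp
  qed
  have "\<bar>u x\<bar> powr q \<le> C powr q * M powr (q - p) * d"
  proof (rule field_le_epsilon)
    fix e :: real assume e: "0 < e"
    let ?K = "C powr q * M powr (q - p)"
    have K: "?K > 0" using C M by simp
    have "0 < e / ?K" by (rule divide_pos_pos[OF e K])
    then have "\<bar>u x\<bar> powr q \<le> ?K * (d + e / ?K)" using d(2) by (intro key) linarith+
    also have "\<dots> = ?K * d + e" using C M by (simp add: distrib_left)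
    finally show "\<bar>u x\<bar> powr q \<le> ?K * d + e" .
  qed
  then show ?thesis by (simp add: C_def)
qed

definition Csob :: real where "Csob = (vol powr (- (1 / p)) + 1 / vol) powr q"

lemma Csob_pos: "0 < Csob"
proof -
  have "0 < vol powr (- (1 / p)) + 1 / vol" using vol0 by (intro add_pos_pos) auto
  then show ?thesis by (simp add: Csob_def)
qed

text \<open>Sobolev's inequality with part of the critical norm replaced by a Morrey-type norm; it
  produces bubbles directly.\<close>

lemma refined_Sobolev:
  assumes u: "Dsp s p (u :: 'a \<Rightarrow> real)" and M: "0 < M"
    and bd: "\<And>z r. 0 < r \<Longrightarrow> \<bar>\<integral>y. indicator (ball z r) y * u y \<partial>lborel\<bar> \<le> M * r powr (N - al)"
  shows "Lint q lborel u \<le> Csob * M powr (q - p) * gagp s p u"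
proof -
  have m [measurable]: "u \<in> borel_measurable borel" using u by (rule Dsp_measurable)
  let ?K = "Csob * M powr (q - p)"
  have K: "0 \<le> ?K" using Csob_pos by simp
  have "(\<integral>\<^sup>+x. Dx u x \<partial>lborel) \<noteq> \<infinity>" unfolding nn_integral_Dx[OF u] by simp
  then have "AE x in lborel. Dx u x \<noteq> \<infinity>" by (intro nn_integral_noteq_infinite) auto
  then have "AE x in lborel. ennreal (\<bar>u x\<bar> powr q) \<le> ennreal ?K * Dx u x"
  proof eventually_elim
    case (elim x)
    then obtain d where d: "Dx u x = ennreal d" "0 \<le> d" by (cases "Dx u x") auto
    have "\<bar>u x\<bar> powr q \<le> ?K * d" using Hedberg[OF u M bd d] by (simp add: Csob_def)
    then show ?case using d K by (simp flip: ennreal_mult)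
  qed
  then have "(\<integral>\<^sup>+x. ennreal (\<bar>u x\<bar> powr q) \<partial>lborel) \<le> (\<integral>\<^sup>+x. ennreal ?K * Dx u x \<partial>lborel)"
    by (rule nn_integral_mono_AE)
  also have "\<dots> = ennreal ?K * ennreal (gagp s p u)"
    unfolding nn_integral_Dx[OF u, symmetric] by (rule nn_integral_cmult) measurable
  also have "\<dots> = ennreal (?K * gagp s p u)" using K by (simp add: ennreal_mult)
  finally show ?thesis using K by (intro Lq_of_nn_le(2)) auto
qed

text \<open>With X = \<open>Lint q lborel u\<close>, Hoelder's inequality allows M proportional to
  X^(1/q) in the refined inequality. The right side then carries X^(1 - p/q), which can be cancelled
  because X is finite by membership in \<open>Dsp\<close>.\<close>

lemma Sobolev: "\<exists>C>0. \<forall>u::'a \<Rightarrow> real. Dsp s p u \<longrightarrow> Lint q lborel u \<le> C * gagp s p u powr (q / p)"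
proof (intro exI conjI allI impI)
  let ?K = "Csob * (vol powr (1 - 1 / q)) powr (q - p)"
  have K: "?K > 0" using Csob_pos vol0 by simp
  show "0 < ?K powr (q / p)" using Csob_pos vol0 by simp
  fix u :: "'a \<Rightarrow> real" assume u: "Dsp s p u"
  let ?X = "Lint q lborel u"
  show "?X \<le> ?K powr (q / p) * gagp s p u powr (q / p)"
  proof (cases "?X = 0")
    case False
    then have X: "?X > 0" using Lint_nonneg[of q lborel u] by linarith
    define M where "M = ?X powr (1 / q) * vol powr (1 - 1 / q)"
    have M: "M > 0" using X vol0 by (simp add: M_def)
    have "\<bar>\<integral>y. indicator (ball z r) y * u y \<partial>lborel\<bar> \<le> M * r powr (N - al)" if r: "0 < r" for z r
    proof -
      have a: "N * (1 - 1 / q) = N - al" by (simp add: N_div_q[symmetric] algebra_simps)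
      have "\<bar>\<integral>y. indicator (ball z r) y * u y \<partial>lborel\<bar> \<le> ?X powr (1 / q) * (vol * r powr N) powr (1 - 1 / q)"
        by (rule integrable_on_ball(2)[OF DspD(1)[OF u] r])
      also have "\<dots> = M * r powr (N - al)"
        using vol0 by (simp add: M_def powr_mult powr_powr a)
      finally show ?thesis .
    qed
    from refined_Sobolev[OF u M this]
    have "?X \<le> Csob * M powr (q - p) * gagp s p u" .
    also have "M powr (q - p) = ?X powr (1 - p / q) * (vol powr (1 - 1 / q)) powr (q - p)"
    proof -
      have "1 / q * (q - p) = 1 - p / q" using q0 by (simp add: field_simps)
      then show ?thesis unfolding M_def using X vol0 by (simp add: powr_mult powr_powr)
    qed
    also have "Csob * (?X powr (1 - p / q) * (vol powr (1 - 1 / q)) powr (q - p)) * gagp s p u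
       = ?X powr (1 - p / q) * (?K * gagp s p u)" by simp
    finally have "?X \<le> ?X powr (1 - p / q) * (?K * gagp s p u)" .
    then have "?X / ?X powr (1 - p / q) \<le> ?K * gagp s p u" using X by (simp add: divide_le_eq mult.commute)
    also have "?X / ?X powr (1 - p / q) = ?X powr (p / q)"
      using X powr_diff[of ?X 1 "1 - p / q"] by simp
    finally have "(?X powr (p / q)) powr (q / p) \<le> (?K * gagp s p u) powr (q / p)"
      using q0 p0 by (intro powr_mono2) auto
    then show ?thesis using X q0 p0 K by (simp add: powr_powr powr_mult)
  qed simp
qed

text \<open>Both u x and u (x + h) are compared with the mean of u over the ball of radius |h| about
  x; from x + h this ball is seen within distance 2 |h|, whence the factor 2 powr (N + s *
  p).\<close>

lemma translation_estimate:
  fixes u :: "'a \<Rightarrow> real"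
  assumes u: "Dsp s p u" and h: "h \<noteq> 0"
  shows "Lq p lborel (\<lambda>x. u (x + h) - u x)"
    "Lint p lborel (\<lambda>x. u (x + h) - u x) \<le> 2 powr p * (1 + 2 powr (N + s * p)) / vol * norm h powr (s * p) * gagp s p u"
proof -
  have m [measurable]: "u \<in> borel_measurable borel" using u by (rule Dsp_measurable)
  define R where "R = norm h"
  have R: "R > 0" using h by (simp add: R_def)
  define A where "A = R powr (s * p) / vol"
  define B where "B = 2 powr (N + s * p) * A"
  have A: "A > 0" "B > 0" using R vol0 by (auto simp: A_def B_def)
  have pw: "ennreal (\<bar>u (x + h) - u x\<bar> powr p) \<le> ennreal (2 powr p) * (ennreal B * Dx u (x + h) + ennreal A * Dx u x)" for x
  proof -
    define I where "I = (\<integral>y. indicator (ball x R) y * u y \<partial>lborel) / (vol * R powr N)"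
    have m0: "0 < vol * R powr N" using vol0 R by simp
    have sub: "ball x R \<subseteq> cball (x + h) (2 * R)"
    proof
      fix y assume "y \<in> ball x R"
      then have "norm (x - y) < R" by (simp add: dist_norm)
      then have "norm ((x - y) + h) \<le> R + R" using norm_triangle_ineq[of "x - y" h] by (simp add: R_def)
      then show "y \<in> cball (x + h) (2 * R)" by (simp add: dist_norm algebra_simps)
    qed
    note lm = local_mean[OF m _ emeasure_ball_N[OF R] m0 _ _ integrable_on_ball(1)[OF DspD(1)[OF u] R]]
    have "ennreal (\<bar>u x - I\<bar> powr p) \<le> ennreal (R powr (N + s * p) / (vol * R powr N)) * Dx u x"
      unfolding I_def by (rule lm) (use R in auto)
    moreover have "R powr (N + s * p) / (vol * R powr N) = A" using R by (simp add: A_def powr_add)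
    ultimately have 1: "ennreal (\<bar>u x - I\<bar> powr p) \<le> ennreal A * Dx u x" by simp
    have "ennreal (\<bar>u (x + h) - I\<bar> powr p) \<le> ennreal ((2 * R) powr (N + s * p) / (vol * R powr N)) * Dx u (x + h)"
      unfolding I_def by (rule lm) (use R sub in auto)
    moreover have "(2 * R) powr (N + s * p) / (vol * R powr N) = B"
      using R by (simp add: A_def B_def powr_add powr_mult)
    ultimately have 2: "ennreal (\<bar>u (x + h) - I\<bar> powr p) \<le> ennreal B * Dx u (x + h)" by simp
    have "\<bar>u (x + h) - u x\<bar> powr p \<le> (\<bar>u (x + h) - I\<bar> + \<bar>u x - I\<bar>) powr p"
      using p0 by (intro powr_mono2) auto
    also have "\<dots> \<le> 2 powr p * (\<bar>u (x + h) - I\<bar> powr p + \<bar>u x - I\<bar> powr p)"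
      using p0 by (intro powr_add_le) auto
    finally have "ennreal (\<bar>u (x + h) - u x\<bar> powr p)
        \<le> ennreal (2 powr p) * (ennreal (\<bar>u (x + h) - I\<bar> powr p) + ennreal (\<bar>u x - I\<bar> powr p))"
      by (simp flip: ennreal_mult ennreal_plus)
    also have "\<dots> \<le> ennreal (2 powr p) * (ennreal B * Dx u (x + h) + ennreal A * Dx u x)"
      by (intro mult_left_mono add_mono 1 2) auto
    finally show ?thesis .
  qed
  have [measurable]: "(\<lambda>x. Dx u (x + h)) \<in> borel_measurable borel" "(\<lambda>x. u (x + h)) \<in> borel_measurable borel"
    by (auto intro!: measurable_compose[OF _ Dx_measurable[OF m]] measurable_compose[OF _ m])
  have tr: "(\<integral>\<^sup>+x. Dx u (x + h) \<partial>lborel) = ennreal (gagp s p u)"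
    using nn_integral_affine[of "Dx u" 1 h] nn_integral_Dx[OF u] by (simp add: add.commute)
  have "(\<integral>\<^sup>+x. ennreal (\<bar>u (x + h) - u x\<bar> powr p) \<partial>lborel)
      \<le> (\<integral>\<^sup>+x. ennreal (2 powr p) * (ennreal B * Dx u (x + h) + ennreal A * Dx u x) \<partial>lborel)"
    by (intro nn_integral_mono pw)
  also have "\<dots> = ennreal (2 powr p) * (ennreal B * ennreal (gagp s p u) + ennreal A * ennreal (gagp s p u))"
    by (simp add: nn_integral_cmult nn_integral_add tr nn_integral_Dx[OF u])
  also have "\<dots> = ennreal (2 powr p * (B + A) * gagp s p u)"
    using A by (simp add: algebra_simps flip: ennreal_mult ennreal_plus)
  finally have le: "(\<integral>\<^sup>+x. ennreal (\<bar>u (x + h) - u x\<bar> powr p) \<partial>lborel) \<le> ennreal (2 powr p * (B + A) * gagp s p u)" .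
  have mm: "(\<lambda>x. u (x + h) - u x) \<in> borel_measurable lborel" by simp
  have nn: "0 \<le> 2 powr p * (B + A) * gagp s p u" using A by simp
  note L = Lq_of_nn_le[OF mm le]
  show "Lq p lborel (\<lambda>x. u (x + h) - u x)" using L(1) A by simp
  have "2 powr p * (B + A) * gagp s p u
     = 2 powr p * (1 + 2 powr (N + s * p)) / vol * norm h powr (s * p) * gagp s p u"
    by (simp add: A_def B_def R_def add_divide_distrib algebra_simps)
  then show "Lint p lborel (\<lambda>x. u (x + h) - u x)
      \<le> 2 powr p * (1 + 2 powr (N + s * p)) / vol * norm h powr (s * p) * gagp s p u"
    using L(2) nn by simp
qed

text \<open>For pushing a test function slightly into a half-space and recovering it in the
  limit.\<close>

lemma translation_AE_subseq:
  fixes u :: "'a \<Rightarrow> real"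
  assumes u: "Dsp s p u" and h: "h \<longlonglongrightarrow> 0" "\<And>n. h n \<noteq> 0"
  shows "\<exists>r::nat\<Rightarrow>nat. strict_mono r \<and> (AE x in lborel. (\<lambda>n. u (x + h (r n))) \<longlonglongrightarrow> u x)"
proof -
  let ?f = "\<lambda>n x. \<bar>u (x + h n) - u x\<bar> powr p"
  let ?K = "2 powr p * (1 + 2 powr (N + s * p)) / vol"
  have i: "integrable lborel (?f n)" for n
    using translation_estimate(1)[OF u h(2)] by (rule Lq_integrable)
  have "(\<lambda>n. \<integral>x. norm (?f n x) \<partial>lborel) \<longlonglongrightarrow> 0"
  proof (rule Lim_null_comparison)
    have "(\<lambda>n. ?K * norm (h n) powr (s * p) * gagp s p u) \<longlonglongrightarrow> ?K * norm (0::'a) powr (s * p) * gagp s p u"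
      using sp0 by (intro tendsto_mult tendsto_const tendsto_powr2 tendsto_norm h) auto
    then show "(\<lambda>n. ?K * norm (h n) powr (s * p) * gagp s p u) \<longlonglongrightarrow> 0" using sp0 by simp
    show "eventually (\<lambda>n. norm (\<integral>x. norm (?f n x) \<partial>lborel) \<le> ?K * norm (h n) powr (s * p) * gagp s p u) sequentially"
      using translation_estimate(2)[OF u h(2)] by (intro always_eventually) (simp add: Lint_def)
  qed
  from tendsto_L1_AE_subseq[OF i this] obtain r :: "nat \<Rightarrow> nat" where r: "strict_mono r"
    "AE x in lborel. (\<lambda>n. ?f (r n) x) \<longlonglongrightarrow> 0" by auto
  have "AE x in lborel. (\<lambda>n. u (x + h (r n))) \<longlonglongrightarrow> u x"
    using r(2)
  proof eventually_elim
    case (elim x)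
    have "(\<lambda>n. (?f (r n) x) powr (1 / p)) \<longlonglongrightarrow> 0 powr (1 / p)"
      using p0 by (intro tendsto_powr2 elim tendsto_const) auto
    then have "(\<lambda>n. \<bar>u (x + h (r n)) - u x\<bar>) \<longlonglongrightarrow> 0" using p0 by (simp add: powr_powr)
    then show ?case using tendsto_rabs_zero_cancel Lim_null by blast
  qed
  then show ?thesis using r(1) by blast
qed

section \<open>Averages on a grid and local compactness\<close>

definition gr :: "real \<Rightarrow> 'a \<Rightarrow> 'a" where
  "gr e x = (\<Sum>b\<in>Basis. (e * of_int \<lfloor>(x \<bullet> b) / e\<rfloor>) *\<^sub>R b)"

lemma gr_dist: "0 < e \<Longrightarrow> norm (x - gr e x) \<le> e * N"
proof -
  assume e: "0 < e"
  have "norm (x - gr e x) \<le> (\<Sum>b\<in>Basis. \<bar>(x - gr e x) \<bullet> b\<bar>)" by (rule norm_le_l1)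
  also have "\<dots> \<le> (\<Sum>b\<in>(Basis::'a set). e)"
  proof (rule sum_mono)
    fix b :: 'a assume b: "b \<in> Basis"
    have "gr e x \<bullet> b = e * of_int \<lfloor>(x \<bullet> b) / e\<rfloor>"
      using b by (simp add: gr_def inner_sum_left inner_Basis if_distrib sum.delta cong: if_cong)
    then have "(x - gr e x) \<bullet> b = e * ((x \<bullet> b) / e - of_int \<lfloor>(x \<bullet> b) / e\<rfloor>)"
      using e by (simp add: inner_diff_left right_diff_distrib)
    moreover have "0 \<le> (x \<bullet> b) / e - of_int \<lfloor>(x \<bullet> b) / e\<rfloor>" "(x \<bullet> b) / e - of_int \<lfloor>(x \<bullet> b) / e\<rfloor> \<le> 1"
      by linarith+
    ultimately show "\<bar>(x - gr e x) \<bullet> b\<bar> \<le> e" using e by (simp add: abs_mult mult_left_le)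
  qed
  also have "\<dots> = e * N" by (simp add: N_def)
  finally show ?thesis .
qed

lemma gr_countable: "countable (range (gr e))"
proof -
  have "range (gr e) \<subseteq> (\<lambda>f. \<Sum>b\<in>Basis. (e * of_int (f b)) *\<^sub>R b) ` (PiE Basis (\<lambda>_. UNIV :: int set))"
  proof
    fix y assume "y \<in> range (gr e)"
    then obtain x where x: "y = gr e x" by auto
    let ?f = "\<lambda>b\<in>Basis. \<lfloor>(x \<bullet> b) / e\<rfloor>"
    have "y = (\<Sum>b\<in>Basis. (e * of_int (?f b)) *\<^sub>R b)" unfolding x gr_def by (rule sum.cong) auto
    moreover have "?f \<in> PiE Basis (\<lambda>_. UNIV)" by simp
    ultimately show "y \<in> (\<lambda>f. \<Sum>b\<in>Basis. (e * of_int (f b)) *\<^sub>R b) ` (PiE Basis (\<lambda>_. UNIV :: int set))" by blast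
  qed
  moreover have "countable (PiE (Basis::'a set) (\<lambda>_. UNIV :: int set))" by (intro countable_PiE) auto
  ultimately show ?thesis by (meson countable_image countable_subset)
qed

lemma gr_measurable: "gr e \<in> measurable borel (count_space (range (gr e)))"
proof -
  have [measurable]: "gr e \<in> borel_measurable borel"
    unfolding gr_def[abs_def] by measurable
  have "{x. gr e x = a} \<in> sets borel" for a
  proof -
    have "gr e -` {a} \<inter> space borel \<in> sets borel" by measurable
    moreover have "gr e -` {a} \<inter> space borel = {x. gr e x = a}" by auto
    ultimately show ?thesis by metis
  qed
  then show ?thesis
    by (subst measurable_count_space_eq_countable[OF gr_countable]) (auto simp: vimage_def)
qed

text \<open>The mean is taken about the grid node of x and not about x itself: for fixed e only
  countably many means occur, so one diagonal subsequence makes the averages converge at every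
  x.\<close>

definition av :: "real \<Rightarrow> ('a \<Rightarrow> real) \<Rightarrow> 'a \<Rightarrow> real" where
  "av e u x = (\<integral>y. indicator (ball (gr e x) e) y * u y \<partial>lborel) / (vol * e powr N)"

lemma av_measurable [measurable]: "av e u \<in> borel_measurable borel"
  unfolding av_def[abs_def]
  by (rule measurable_compose[OF gr_measurable]) simp

lemma av_estimate:
  assumes u: "Dsp s p (u :: 'a \<Rightarrow> real)" and e: "0 < e"
  shows "Lq p lborel (\<lambda>x. u x - av e u x)"
    "Lint p lborel (\<lambda>x. u x - av e u x) \<le> (N + 1) powr (N + s * p) / vol * e powr (s * p) * gagp s p u"
proof -
  have m [measurable]: "u \<in> borel_measurable borel" using u by (rule Dsp_measurable)
  let ?C = "(N + 1) powr (N + s * p) / vol * e powr (s * p)"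
  have C: "0 \<le> ?C" using vol0 by simp
  have "ennreal (\<bar>u x - av e u x\<bar> powr p) \<le> ennreal ?C * Dx u x" for x
  proof -
    have sub: "ball (gr e x) e \<subseteq> cball x ((N + 1) * e)"
    proof
      fix y assume "y \<in> ball (gr e x) e"
      then have "dist (gr e x) y < e" by simp
      moreover have "dist x (gr e x) \<le> e * N" using gr_dist[OF e, of x] by (simp add: dist_norm)
      ultimately show "y \<in> cball x ((N + 1) * e)"
        using dist_triangle[of x y "gr e x"] by (simp add: algebra_simps)
    qed
    have "ennreal (\<bar>u x - av e u x\<bar> powr p) \<le> ennreal (((N + 1) * e) powr (N + s * p) / (vol * e powr N)) * Dx u x"
      unfolding av_def
      by (rule local_mean[OF m _ emeasure_ball_N[OF e] _ sub _ integrable_on_ball(1)[OF DspD(1)[OF u] e]])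
         (use vol0 e N0 in auto)
    also have "((N + 1) * e) powr (N + s * p) / (vol * e powr N) = ?C"
      using e N0 by (simp add: powr_mult powr_add)
    finally show ?thesis .
  qed
  then have "(\<integral>\<^sup>+x. ennreal (\<bar>u x - av e u x\<bar> powr p) \<partial>lborel) \<le> (\<integral>\<^sup>+x. ennreal ?C * Dx u x \<partial>lborel)"
    by (rule nn_integral_mono)
  also have "\<dots> = ennreal ?C * ennreal (gagp s p u)"
    unfolding nn_integral_Dx[OF u, symmetric] by (rule nn_integral_cmult) measurable
  also have "\<dots> = ennreal (?C * gagp s p u)" by (rule ennreal_mult'[OF C, symmetric])
  finally have le: "(\<integral>\<^sup>+x. ennreal (\<bar>u x - av e u x\<bar> powr p) \<partial>lborel) \<le> ennreal (?C * gagp s p u)" .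
  have mm: "(\<lambda>x. u x - av e u x) \<in> borel_measurable lborel" by simp
  have nn: "0 \<le> ?C * gagp s p u" by (intro mult_nonneg_nonneg[OF C]) simp
  show "Lq p lborel (\<lambda>x. u x - av e u x)" "Lint p lborel (\<lambda>x. u x - av e u x) \<le> ?C * gagp s p u"
    using Lq_of_nn_le[OF mm le nn] by auto
qed

lemma ball_integral_bound:
  assumes "Dsp s p (u :: 'a \<Rightarrow> real)" "0 < e" "e \<le> 1" "Lint q lborel u \<le> L"
  shows "\<bar>\<integral>y. indicator (ball c e) y * u y \<partial>lborel\<bar> \<le> L powr (1 / q) * vol powr (1 - 1 / q)"
proof -
  have "\<bar>\<integral>y. indicator (ball c e) y * u y \<partial>lborel\<bar>
      \<le> Lint q lborel u powr (1 / q) * (vol * e powr N) powr (1 - 1 / q)"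
    by (rule integrable_on_ball(2)[OF DspD(1)[OF assms(1)] assms(2)])
  also have "\<dots> \<le> L powr (1 / q) * vol powr (1 - 1 / q)"
  proof (intro mult_mono powr_mono2)
    have "e powr N \<le> 1 powr N" using assms N0 by (intro powr_mono2) auto
    then show "vol * e powr N \<le> vol" using vol0 by (simp add: mult_left_le)
  qed (use assms q1 vol0 in auto)
  finally show ?thesis .
qed

text \<open>The difference of two members splits into the errors of replacing each by its averages,
  small uniformly in n by \<open>av_estimate\<close>, and the difference of the averages, which
  tends to 0 in L^p of every ball by dominated convergence. Hence the subsequence is Cauchy in L^p
  of every ball. Only the almost everywhere limit is recorded, since it is what the Brezis-Lieb
  arguments take as input.\<close>

lemma Rellich:
  fixes u :: "nat \<Rightarrow> 'a \<Rightarrow> real"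
  assumes u: "\<And>n. Dsp s p (u n)" and K: "\<And>n. gagp s p (u n) \<le> K"
  shows "\<exists>r w. strict_mono r \<and> w \<in> borel_measurable borel \<and> (AE x in lborel. (\<lambda>n. u (r n) x) \<longlonglongrightarrow> w x)"
proof -
  obtain C where C: "C > 0" "\<And>v::'a \<Rightarrow> real. Dsp s p v \<Longrightarrow> Lint q lborel v \<le> C * gagp s p v powr (q / p)"
    using Sobolev by auto
  have K0: "0 \<le> K" using K[of 0] gagp_nonneg[of "u 0"] by linarith
  define L where "L = C * K powr (q / p)"
  have uL: "Lint q lborel (u n) \<le> L" for n
  proof -
    have "C * gagp s p (u n) powr (q / p) \<le> L"
      unfolding L_def using C(1) K q0 p0 by (intro mult_left_mono powr_mono2) auto
    then show ?thesis using C(2)[OF u[of n]] by linarith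
  qed
  define ep where "ep k = (1/2::real)^k" for k :: nat
  have ep: "0 < ep k" "ep k \<le> 1" for k by (auto simp: ep_def power_le_one)
  define I where "I n kc = (\<integral>y. indicator (ball (snd kc) (ep (fst kc))) y * u n y \<partial>lborel)" for n kc
  define M where "M = L powr (1 / q) * vol powr (1 - 1 / q)"
  have IM: "norm (I n kc) \<le> M" for n kc
    unfolding I_def M_def real_norm_def by (rule ball_integral_bound[OF u ep uL])
  \<comment> \<open>All integrals over balls of radius 2^(-k) about the nodes of the k-th grid:
    countably many bounded sequences, which one diagonal subsequence makes convergent.\<close>
  have "countable (SIGMA k:UNIV. range (gr (ep k)))" by (intro countable_SIGMA gr_countable) auto
  from function_convergent_subsequence[OF this, of I M] IM
  obtain r :: "nat \<Rightarrow> nat" where r: "strict_mono r"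
    "\<And>kc. kc \<in> (SIGMA k:UNIV. range (gr (ep k))) \<Longrightarrow> \<exists>l. (\<lambda>n. I (r n) kc) \<longlonglongrightarrow> l" by blast
  define v where "v n = u (r n)" for n
  have v: "Dsp s p (v n)" "gagp s p (v n) \<le> K" for n by (auto simp: v_def u K)
  have [measurable]: "v n \<in> borel_measurable borel" for n using v(1) by (rule Dsp_measurable)
  define l where "l k x = lim (\<lambda>n. av (ep k) (v n) x)" for k x
  have avI: "av (ep k) (v n) x = I (r n) (k, gr (ep k) x) / (vol * ep k powr N)" for k n x
    by (simp add: av_def I_def v_def)
  have l: "(\<lambda>n. av (ep k) (v n) x) \<longlonglongrightarrow> l k x" for k x
  proof -
    obtain y where "(\<lambda>n. I (r n) (k, gr (ep k) x)) \<longlonglongrightarrow> y" using r(2)[of "(k, gr (ep k) x)"] by auto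
    then have "(\<lambda>n. av (ep k) (v n) x) \<longlonglongrightarrow> y / (vol * ep k powr N)"
      unfolding avI using vol0 ep[of k] by (intro tendsto_divide tendsto_const) auto
    then show ?thesis unfolding l_def by (simp add: limI)
  qed
  have [measurable]: "l k \<in> borel_measurable borel" for k
    unfolding l_def[abs_def] by (rule borel_measurable_lim_metric) auto
  define A where "A k = M / (vol * ep k powr N)" for k
  have Ab: "\<bar>av (ep k) (v n) x\<bar> \<le> A k" for k n x
    unfolding avI A_def abs_divide using IM[of "r n" "(k, gr (ep k) x)"] vol0 ep[of k]
    by (simp add: abs_mult divide_right_mono)
  have lb: "\<bar>l k x\<bar> \<le> A k" for k x
    by (rule LIMSEQ_le_const2[OF tendsto_rabs[OF l]]) (use Ab in blast)
  define B where "B j = ball (0::'a) (real j)" for j :: nat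
  have B [measurable]: "B j \<in> sets borel" for j by (simp add: B_def)
  have Bfin: "integrable lborel (indicator (B j) :: 'a \<Rightarrow> real)" for j
    by (rule integrable_real_indicator) (use emeasure_bounded_finite[OF bounded_ball, of "0::'a" "real j"] in \<open>auto simp: B_def\<close>)
  \<comment> \<open>Compared with the limit \<open>l k\<close> and not with a second index, so that
    a single dominated convergence applies.\<close>
  define bb where "bb k j n x = indicator (B j) x * (av (ep k) (v n) x - l k x)" for k j n x
  have bbm [measurable]: "bb k j n \<in> borel_measurable borel" for k j n unfolding bb_def[abs_def] by measurable
  have bbb: "\<bar>bb k j n x\<bar> powr p \<le> (2 * A k) powr p * indicator (B j) x" for k j n x
  proof (cases "x \<in> B j")
    case True
    have "\<bar>bb k j n x\<bar> \<le> 2 * A k" using True Ab[of k n x] lb[of k x] by (auto simp: bb_def)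
    then have "\<bar>bb k j n x\<bar> powr p \<le> (2 * A k) powr p" using p0 by (intro powr_mono2) auto
    then show ?thesis using True by simp
  qed (simp add: bb_def)
  have bbi: "integrable lborel (\<lambda>x. (2 * A k) powr p * indicator (B j) x)" for k j using Bfin by simp
  have bbL: "Lq p lborel (bb k j n)" for k j n
    by (rule Lq_dominated(1)[OF bbi[of k j]]) (use bbb in auto)
  have bb0: "(\<lambda>n. Lint p lborel (bb k j n)) \<longlonglongrightarrow> 0" for k j
  proof -
    have "(\<lambda>n. \<bar>bb k j n x\<bar> powr p) \<longlonglongrightarrow> 0" for x
    proof -
      have "(\<lambda>n. \<bar>bb k j n x\<bar> powr p) \<longlonglongrightarrow> \<bar>indicator (B j) x * (l k x - l k x)\<bar> powr p"
        unfolding bb_def using p0 by (intro tendsto_powr2 tendsto_rabs tendsto_mult tendsto_diff tendsto_const l) auto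
      then show ?thesis using p0 by simp
    qed
    then have "(\<lambda>n. \<integral>x. \<bar>bb k j n x\<bar> powr p \<partial>lborel) \<longlonglongrightarrow> (\<integral>x. 0 \<partial>(lborel::'a measure))"
      by (intro integral_dominated_convergence[OF _ _ bbi[of k j]]) (use bbb in auto)
    then show ?thesis by (simp add: Lint_def)
  qed
  define aa where "aa k j n x = indicator (B j) x * (v n x - av (ep k) (v n) x)" for k j n x
  have aam [measurable]: "aa k j n \<in> borel_measurable borel" for k j n unfolding aa_def[abs_def] by measurable
  define Ca where "Ca = (N + 1) powr (N + s * p) / vol * K"
  have Ca: "Ca \<ge> 0" using vol0 K0 by (simp add: Ca_def)
  have aaL: "Lq p lborel (aa k j n)" "Lint p lborel (aa k j n) \<le> Ca * ep k powr (s * p)" for k j n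
  proof -
    note E = av_estimate[OF v(1)[of n] ep(1)[of k]]
    have *: "AE x in lborel. \<bar>aa k j n x\<bar> \<le> \<bar>v n x - av (ep k) (v n) x\<bar>"
      by (auto simp: aa_def indicator_def)
    show "Lq p lborel (aa k j n)" by (rule Lq_bound(1)[OF p0 E(1) _ *]) simp
    have "Lint p lborel (aa k j n) \<le> Lint p lborel (\<lambda>x. v n x - av (ep k) (v n) x)"
      by (rule Lq_bound(2)[OF p0 E(1) _ *]) simp
    also have "\<dots> \<le> (N + 1) powr (N + s * p) / vol * ep k powr (s * p) * gagp s p (v n)" by (rule E(2))
    also have "\<dots> \<le> (N + 1) powr (N + s * p) / vol * ep k powr (s * p) * K"
      using v(2) vol0 by (intro mult_left_mono) auto
    finally show "Lint p lborel (aa k j n) \<le> Ca * ep k powr (s * p)" by (simp add: Ca_def mult_ac)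
  qed
  let ?d = "\<lambda>j n m x. indicator (B j) x * (v n x - v m x)"
  have dec: "?d j n m = (\<lambda>x. (aa k j n x - aa k j m x) + (bb k j n x - bb k j m x))" for j n m k
    by (auto simp: aa_def bb_def fun_eq_iff algebra_simps)
  have dL: "Lq p lborel (?d j n m)" for j n m
    unfolding dec[of j n m 0] by (intro Lq_add(1) Lq_diff(1) p0 aaL bbL)
  have dle: "Lint p lborel (?d j n m) \<le> 2 powr p * (2 powr p * (Ca * ep k powr (s * p) + Ca * ep k powr (s * p))
      + 2 powr p * (Lint p lborel (bb k j n) + Lint p lborel (bb k j m)))" for j n m k
  proof -
    have "Lint p lborel (?d j n m) \<le> 2 powr p * (Lint p lborel (\<lambda>x. aa k j n x - aa k j m x) + Lint p lborel (\<lambda>x. bb k j n x - bb k j m x))"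
      unfolding dec[of j n m k] by (intro Lq_add(2) Lq_diff(1) p0 aaL bbL)
    also have "\<dots> \<le> 2 powr p * (2 powr p * (Lint p lborel (aa k j n) + Lint p lborel (aa k j m))
      + 2 powr p * (Lint p lborel (bb k j n) + Lint p lborel (bb k j m)))"
      by (intro mult_left_mono add_mono Lq_diff(2) p0 aaL bbL) auto
    also have "\<dots> \<le> 2 powr p * (2 powr p * (Ca * ep k powr (s * p) + Ca * ep k powr (s * p))
      + 2 powr p * (Lint p lborel (bb k j n) + Lint p lborel (bb k j m)))"
      by (intro mult_left_mono add_mono aaL order_refl) auto
    finally show ?thesis .
  qed
  have "\<exists>\<tau> w. strict_mono \<tau> \<and> w \<in> borel_measurable lborel \<and> (AE x in lborel. (\<lambda>n. v (\<tau> n) x) \<longlonglongrightarrow> w x)"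
  proof (rule Cauchy_Lq_AE_subseq[where A = B, OF p0])
    show "eventually (\<lambda>j. x \<in> B j) sequentially" for x
    proof -
      obtain j0 where "norm x < real j0" using reals_Archimedean2 by blast
      then have "x \<in> B j" if "j \<ge> j0" for j using that by (simp add: B_def)
      then show ?thesis unfolding eventually_sequentially by blast
    qed
    show "Lq p lborel (?d j n m)" for j n m by (rule dL)
    fix j :: nat and e :: real assume e: "0 < e"
    \<comment> \<open>First the mesh is fixed so that the averaging errors stay below e / 2; only
      then is n0 chosen, depending on that mesh.\<close>
    have "(\<lambda>k. 2 powr p * (2 powr p * (Ca * ep k powr (s * p) + Ca * ep k powr (s * p)))) \<longlonglongrightarrow>
      2 powr p * (2 powr p * (Ca * 0 powr (s * p) + Ca * 0 powr (s * p)))"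
      unfolding ep_def using sp0 by (intro tendsto_mult tendsto_add tendsto_powr2 tendsto_const LIMSEQ_realpow_zero) auto
    then have "(\<lambda>k. 2 powr p * (2 powr p * (Ca * ep k powr (s * p) + Ca * ep k powr (s * p)))) \<longlonglongrightarrow> 0" using sp0 by simp
    then have "eventually (\<lambda>k. 2 powr p * (2 powr p * (Ca * ep k powr (s * p) + Ca * ep k powr (s * p))) < e / 2) sequentially"
      by (rule order_tendstoD(2)) (use e in simp)
    then obtain k where k: "2 powr p * (2 powr p * (Ca * ep k powr (s * p) + Ca * ep k powr (s * p))) < e / 2"
      by (auto simp: eventually_sequentially)
    define d where "d = e / 4 / (2 powr p * 2 powr p)"
    have d: "d > 0" "2 powr p * (2 powr p * (d + d)) = e / 2" using e by (auto simp: d_def)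
    have "eventually (\<lambda>n. Lint p lborel (bb k j n) < d) sequentially"
      by (rule order_tendstoD(2)[OF bb0 d(1)])
    then obtain n0 where n0: "\<And>n. n \<ge> n0 \<Longrightarrow> Lint p lborel (bb k j n) < d" by (auto simp: eventually_sequentially)
    have "Lint p lborel (?d j n m) \<le> e" if "n \<ge> n0" "m \<ge> n0" for n m
    proof -
      have "2 powr p * (2 powr p * (Lint p lborel (bb k j n) + Lint p lborel (bb k j m))) \<le> 2 powr p * (2 powr p * (d + d))"
        using n0[OF that(1)] n0[OF that(2)] by (intro mult_left_mono add_mono) auto
      then show ?thesis using dle[of j n m k] k d(2) unfolding distrib_left[of "2 powr p" "2 powr p * x" for x] by linarith
    qed
    then show "\<exists>n0. \<forall>n\<ge>n0. \<forall>m\<ge>n0. Lint p lborel (?d j n m) \<le> e" by blast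
  qed auto
  then obtain \<tau> w where \<tau>: "strict_mono \<tau>" "w \<in> borel_measurable borel" "AE x in lborel. (\<lambda>n. v (\<tau> n) x) \<longlonglongrightarrow> w x"
    by auto
  then have "strict_mono (r \<circ> \<tau>)" using r(1) by (simp add: strict_mono_o)
  then show ?thesis using \<tau> unfolding v_def by (intro exI[of _ "r \<circ> \<tau>"] exI[of _ w]) auto
qed

end

text \<open>The version for subtracting an approximation h n of w, here a cut-off profile: w - h n
  is a strongly vanishing perturbation of the bounded sequence g n - w, to which
  \<open>Lint_perturbation\<close> applies.\<close>

lemma Brezis_Lieb_strong:
  assumes q: "1 < q" and g: "\<And>n. Lq q M (g n)" "\<And>n. Lint q M (g n) \<le> K"
    and lim: "AE x in M. (\<lambda>n. g n x) \<longlonglongrightarrow> w x" and w: "w \<in> borel_measurable M"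
    and h: "\<And>n. Lq q M (h n)" "(\<lambda>n. Lint q M (\<lambda>x. w x - h n x)) \<longlonglongrightarrow> 0"
  shows "(\<lambda>n. Lint q M (g n) - Lint q M (\<lambda>x. g n x - h n x)) \<longlonglongrightarrow> Lint q M w"
    "(\<lambda>n. Lint (q / (q - 1)) M (\<lambda>x. Jp q (g n x) - Jp q (g n x - h n x) - Jp q (w x))) \<longlonglongrightarrow> 0"
proof -
  have q0: "0 < q" using q by simp
  let ?r = "q / (q - 1)"
  have r0: "0 < ?r" using q by simp
  note D = Lq_AE_limit[OF q0 g lim w] and F = Lq_Fatou[OF q0 g lim w]
  note BL = Brezis_Lieb[OF q g lim w]
  have b: "Lq q M (\<lambda>x. w x - h n x)" for n by (rule Lq_diff(1)[OF q0 F(1) h(1)])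
  note P = Lint_perturbation[OF q D b h(2)]
  have e: "(g n x - w x) + (w x - h n x) = g n x - h n x" for n x by simp
  have "(\<lambda>n. (Lint q M (g n) - Lint q M (\<lambda>x. g n x - w x))
      - (Lint q M (\<lambda>x. (g n x - w x) + (w x - h n x)) - Lint q M (\<lambda>x. g n x - w x))) \<longlonglongrightarrow> Lint q M w - 0"
    by (intro tendsto_diff BL(1) P(1))
  then show "(\<lambda>n. Lint q M (g n) - Lint q M (\<lambda>x. g n x - h n x)) \<longlonglongrightarrow> Lint q M w"
    unfolding e by simp
  let ?A = "\<lambda>n x. Jp q (g n x) - Jp q (g n x - w x) - Jp q (w x)"
  let ?B = "\<lambda>n x. Jp q ((g n x - w x) + (w x - h n x)) - Jp q (g n x - w x)"
  have AL: "Lq ?r M (?A n)" for n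
    by (intro Lq_diff(1) r0 Lq_Jp(1) q g D F)
  have *: "(\<lambda>n. 2 powr ?r * (Lint ?r M (?A n) + Lint ?r M (?B n))) \<longlonglongrightarrow> 2 powr ?r * (0 + 0)"
    by (intro tendsto_mult tendsto_const tendsto_add BL(2) P(2))
  have lim0: "(\<lambda>n. Lint ?r M (\<lambda>x. ?A n x - ?B n x)) \<longlonglongrightarrow> 0"
  proof (rule Lim_null_comparison)
    show "(\<lambda>n. 2 powr ?r * (Lint ?r M (?A n) + Lint ?r M (?B n))) \<longlonglongrightarrow> 0" using * by simp
    show "eventually (\<lambda>n. norm (Lint ?r M (\<lambda>x. ?A n x - ?B n x))
        \<le> 2 powr ?r * (Lint ?r M (?A n) + Lint ?r M (?B n))) sequentially"
      unfolding real_norm_def abs_of_nonneg[OF Lint_nonneg]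
      by (intro always_eventually allI Lq_diff(2)[OF r0 AL P(3)])
  qed
  have eq: "(\<lambda>x. ?A n x - ?B n x) = (\<lambda>x. Jp q (g n x) - Jp q (g n x - h n x) - Jp q (w x))" for n
    unfolding e by (simp add: fun_eq_iff)
  show "(\<lambda>n. Lint ?r M (\<lambda>x. Jp q (g n x) - Jp q (g n x - h n x) - Jp q (w x))) \<longlonglongrightarrow> 0"
    using lim0 unfolding eq .
qed

lemma rsc_inverse:
  assumes "0 < l"
  shows "rsc q (- ((1 / l) *\<^sub>R t)) (1 / l) (rsc q t l f) = f"
    "rsc q t l (rsc q (- ((1 / l) *\<^sub>R t)) (1 / l) f) = f"
  using assms by (auto simp: rsc_def fun_eq_iff powr_divide algebra_simps)

text \<open>The case d = 0 is the diagonal of the space of pairs, where division by 0 gives 0 on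
  both sides.\<close>

lemma scaled_quotient:
  fixes b :: real
  assumes "b \<noteq> 0" shows "(a * u - a * v) / d = a * b * ((u - v) / (b * d))"
  using assms by (cases "d = 0") (auto simp: field_simps)

lemma rsc_diff: "rsc q t l (\<lambda>x. f x - g x) = (\<lambda>x. rsc q t l f x - rsc q t l g x)"
  by (simp add: rsc_def fun_eq_iff algebra_simps)

section \<open>Integrability of powers of the norm\<close>

lemma dyadic_ex:
  fixes x :: real assumes "1 \<le> x"
  shows "\<exists>k::nat. 2 ^ k \<le> x \<and> x < 2 ^ (Suc k)"
proof -
  obtain n0 where n0: "x < 2 ^ n0" using real_arch_pow[of 2 x] by auto
  define n where "n = (LEAST n. x < 2 ^ n)"
  have n: "x < 2 ^ n" unfolding n_def using n0 by (rule LeastI)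
  with assms have "n \<noteq> 0" by (cases n) auto
  then obtain k where k: "n = Suc k" by (cases n) auto
  have "\<not> x < 2 ^ k" using not_less_Least[of k "\<lambda>n. x < 2 ^ n"] k by (simp add: n_def)
  then show ?thesis using n k by (intro exI[of _ k]) auto
qed

text \<open>Each point of the support is charged to one ball of the sequence, and the charges form a
  geometric series. The balls may overlap since only an upper bound is wanted.\<close>

lemma nn_integral_dyadic_finite:
  fixes f :: "'a::euclidean_space \<Rightarrow> ennreal"
  assumes f: "\<And>x. f x \<noteq> 0 \<Longrightarrow> \<exists>k. f x \<le> ennreal (c k) \<and> norm x < r k"
    and r: "\<And>k. 0 < r k" and c: "\<And>k. 0 \<le> c k" and le: "\<And>k. c k * r k powr DIM('a) \<le> C * \<rho> ^ k"
    and \<rho>: "0 \<le> \<rho>" "\<rho> < 1" and C: "0 \<le> C"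
  shows "(\<integral>\<^sup>+x. f x \<partial>lborel) < \<infinity>"
proof -
  let ?g = "\<lambda>k x. ennreal (c k) * indicator (ball (0::'a) (r k)) x"
  have [measurable]: "ball (0::'a) (r k) \<in> sets borel" for k by simp
  have "f x \<le> (\<Sum>k. ?g k x)" for x
  proof (cases "f x = 0")
    case False
    then obtain k where k: "f x \<le> ennreal (c k)" "norm x < r k" using f by blast
    define h where "h k = ?g k x" for k
    have "f x \<le> h k" using k by (simp add: h_def)
    also have "h k \<le> (\<Sum>k. h k)" using sum_le_suminf[of h "{k}"] by (simp add: summableI)
    finally show ?thesis by (simp add: h_def)
  qed simp
  then have "(\<integral>\<^sup>+x. f x \<partial>lborel) \<le> (\<integral>\<^sup>+x. (\<Sum>k. ?g k x) \<partial>lborel)" by (rule nn_integral_mono)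
  also have "\<dots> = (\<Sum>k. \<integral>\<^sup>+x. ?g k x \<partial>lborel)" by (rule nn_integral_suminf) measurable
  also have "\<dots> = (\<Sum>k. ennreal (c k) * ennreal (unit_ball_vol DIM('a) * r k powr DIM('a)))"
    by (simp add: nn_integral_cmult_indicator emeasure_ball_scale[OF r])
  also have "\<dots> \<le> (\<Sum>k. ennreal (unit_ball_vol DIM('a) * (C * \<rho> ^ k)))"
  proof (intro suminf_le summableI)
    fix k
    have "c k * (unit_ball_vol DIM('a) * r k powr DIM('a)) = unit_ball_vol DIM('a) * (c k * r k powr DIM('a))" by simp
    also have "\<dots> \<le> unit_ball_vol DIM('a) * (C * \<rho> ^ k)" by (intro mult_left_mono le) auto
    finally show "ennreal (c k) * ennreal (unit_ball_vol DIM('a) * r k powr DIM('a)) \<le> ennreal (unit_ball_vol DIM('a) * (C * \<rho> ^ k))"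
      using c by (simp add: ennreal_mult'[symmetric] ennreal_leI)
  qed
  also have "\<dots> = ennreal (\<Sum>k. unit_ball_vol DIM('a) * (C * \<rho> ^ k))"
    using \<rho> C by (intro suminf_ennreal2 summable_mult summable_geometric) auto
  also have "\<dots> < \<infinity>" by simp
  finally show ?thesis .
qed

lemma nn_integral_powr_at_infinity:
  assumes b: "real DIM('a) < \<beta>"
  shows "(\<integral>\<^sup>+x. ennreal (indicator {x. 1 \<le> norm x} (x::'a::euclidean_space) * norm x powr (- \<beta>)) \<partial>lborel) < \<infinity>"
proof (rule nn_integral_dyadic_finite[where c = "\<lambda>k. (2 ^ k) powr (- \<beta>)" and r = "\<lambda>k. 2 ^ Suc k"
      and C = "2 powr DIM('a)" and \<rho> = "2 powr (real DIM('a) - \<beta>)"])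
  fix x :: 'a assume "ennreal (indicator {x. 1 \<le> norm x} x * norm x powr (- \<beta>)) \<noteq> 0"
  then have "1 \<le> norm x" by (auto simp: indicator_def split: if_splits)
  then obtain k where k: "2 ^ k \<le> norm x" "norm x < 2 ^ Suc k" using dyadic_ex by blast
  have "norm x powr (- \<beta>) \<le> (2 ^ k) powr (- \<beta>)" using k b by (intro powr_mono2') auto
  then show "\<exists>k. ennreal (indicator {x. 1 \<le> norm x} x * norm x powr (- \<beta>)) \<le> ennreal ((2 ^ k) powr (- \<beta>)) \<and> norm x < 2 ^ Suc k"
    using k by (intro exI[of _ k]) (auto simp: indicator_def intro!: ennreal_leI)
next
  fix k :: nat
  have "(2 ^ k) powr (- \<beta>) * (2 ^ Suc k) powr real DIM('a)
     = 2 powr (- real k * \<beta>) * 2 powr (real (Suc k) * real DIM('a))"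
    unfolding powr_realpow[symmetric, OF zero_less_numeral] powr_powr by simp
  also have "\<dots> = 2 powr DIM('a) * 2 powr ((real DIM('a) - \<beta>) * real k)"
    unfolding powr_add[symmetric] by (simp add: algebra_simps)
  also have "2 powr ((real DIM('a) - \<beta>) * real k) = (2 powr (real DIM('a) - \<beta>)) ^ k"
    by (simp add: powr_powr[symmetric] powr_realpow)
  finally show "(2 ^ k) powr (- \<beta>) * (2 ^ Suc k) powr real DIM('a) \<le> 2 powr DIM('a) * (2 powr (real DIM('a) - \<beta>)) ^ k"
    by simp
next
  show "2 powr (real DIM('a) - \<beta>) < 1" using b powr_less_mono[of "real DIM('a) - \<beta>" 0 2] by simp
qed auto

lemma nn_integral_powr_at_zero:
  assumes g: "\<gamma> < real DIM('a)"
  shows "(\<integral>\<^sup>+x. ennreal (indicator {x. norm x < 1} (x::'a::euclidean_space) * norm x powr (- \<gamma>)) \<partial>lborel) < \<infinity>"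
\<comment> \<open>The factor 1 + 2 powr \<gamma> serves both signs: for \<gamma> \<ge> 0 the upper
  end of the dyadic interval of 1 / |x| is used, for \<gamma> < 0 the lower end. Negative values can
  occur in \<open>ker_bounded\<close>, where \<gamma> = N + s p - p.\<close>
proof (rule nn_integral_dyadic_finite[where c = "\<lambda>k. (1 + 2 powr \<gamma>) * (2 ^ k) powr \<gamma>" and r = "\<lambda>k. 2 * (1 / 2) ^ k"
      and C = "(1 + 2 powr \<gamma>) * 2 powr DIM('a)" and \<rho> = "2 powr (\<gamma> - real DIM('a))"])
  fix x :: 'a assume "ennreal (indicator {x. norm x < 1} x * norm x powr (- \<gamma>)) \<noteq> 0"
  then have x: "norm x < 1" "0 < norm x" by (auto simp: indicator_def split: if_splits)
  then have "1 \<le> 1 / norm x" by simp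
  then obtain k where k: "2 ^ k \<le> 1 / norm x" "1 / norm x < 2 ^ Suc k" using dyadic_ex by blast
  have nx: "norm x < 2 * (1 / 2) ^ k"
  proof -
    have "norm x * 2 ^ k \<le> 1" using k(1) x by (simp add: field_simps)
    then show ?thesis by (simp add: power_one_over field_simps)
  qed
  have "norm x powr (- \<gamma>) = (1 / norm x) powr \<gamma>" using x by (simp add: powr_divide powr_minus_divide)
  also have "\<dots> \<le> (1 + 2 powr \<gamma>) * (2 ^ k) powr \<gamma>"
  proof (cases "0 \<le> \<gamma>")
    case True
    have "(1 / norm x) powr \<gamma> \<le> (2 * 2 ^ k) powr \<gamma>" using k x True by (intro powr_mono2) auto
    also have "\<dots> = 2 powr \<gamma> * (2 ^ k) powr \<gamma>" by (simp add: powr_mult)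
    also have "\<dots> \<le> (1 + 2 powr \<gamma>) * (2 ^ k) powr \<gamma>" by (intro mult_right_mono) auto
    finally show ?thesis .
  next
    case False
    have "(1 / norm x) powr \<gamma> \<le> (2 ^ k) powr \<gamma>" using k x False by (intro powr_mono2') auto
    also have "\<dots> \<le> (1 + 2 powr \<gamma>) * (2 ^ k) powr \<gamma>" by (simp add: distrib_right)
    finally show ?thesis .
  qed
  finally show "\<exists>k. ennreal (indicator {x. norm x < 1} x * norm x powr (- \<gamma>))
      \<le> ennreal ((1 + 2 powr \<gamma>) * (2 ^ k) powr \<gamma>) \<and> norm x < 2 * (1 / 2) ^ k"
    using nx x by (intro exI[of _ k]) (auto simp: indicator_def intro!: ennreal_leI)
next
  fix k :: nat
  have h: "(1 / 2 :: real) ^ k = 2 powr (- real k)"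
    by (simp add: powr_minus_divide powr_realpow power_one_over)
  have "(2 ^ k) powr \<gamma> * (2 * (1 / 2) ^ k) powr real DIM('a)
     = 2 powr (real k * \<gamma>) * (2 powr DIM('a) * 2 powr (- real k * real DIM('a)))"
    unfolding h powr_realpow[symmetric, OF zero_less_numeral] powr_powr by (simp add: powr_mult powr_powr)
  also have "\<dots> = 2 powr DIM('a) * 2 powr ((\<gamma> - real DIM('a)) * real k)"
    unfolding powr_add[symmetric] by (simp add: algebra_simps)
  also have "2 powr ((\<gamma> - real DIM('a)) * real k) = (2 powr (\<gamma> - real DIM('a))) ^ k"
    by (simp add: powr_powr[symmetric] powr_realpow)
  finally have "(2 ^ k) powr \<gamma> * (2 * (1 / 2) ^ k) powr real DIM('a) = 2 powr DIM('a) * (2 powr (\<gamma> - real DIM('a))) ^ k" .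
  then show "(1 + 2 powr \<gamma>) * (2 ^ k) powr \<gamma> * (2 * (1 / 2) ^ k) powr real DIM('a)
      \<le> (1 + 2 powr \<gamma>) * 2 powr DIM('a) * (2 powr (\<gamma> - real DIM('a))) ^ k"
    by (simp only: mult.assoc order_refl)
next
  show "2 powr (\<gamma> - real DIM('a)) < 1" using g powr_less_mono[of "\<gamma> - real DIM('a)" 0 2] by simp
qed (auto intro: add_nonneg_nonneg)

section \<open>Piecewise linear cut-offs\<close>

definition cutoff :: "real \<Rightarrow> 'a::euclidean_space \<Rightarrow> real" where
  "cutoff R x = max 0 (min 1 (2 - norm x / R))"

lemma cutoff_measurable [measurable]: "cutoff R \<in> borel_measurable borel"
  unfolding cutoff_def[abs_def] by measurable

lemma cutoff_bounds: "0 \<le> cutoff R x" "cutoff R x \<le> 1" "\<bar>1 - cutoff R x\<bar> \<le> 1" "\<bar>cutoff R x\<bar> \<le> 1"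
  by (auto simp: cutoff_def)

lemma cutoff_eq_0: "0 < R \<Longrightarrow> 2 * R \<le> norm x \<Longrightarrow> cutoff R x = 0"
  by (auto simp: cutoff_def field_simps)

lemma cutoff_Lipschitz:
  assumes "0 < R" shows "\<bar>cutoff R x - cutoff R y\<bar> \<le> min 1 (norm (x - y) / R)"
proof -
  have "\<bar>norm x - norm y\<bar> \<le> norm (x - y)" by (rule norm_triangle_ineq3)
  then have "\<bar>norm x / R - norm y / R\<bar> \<le> norm (x - y) / R"
    using assms by (simp add: divide_right_mono flip: diff_divide_distrib)
  moreover have "\<bar>cutoff R x - cutoff R y\<bar> \<le> \<bar>norm x / R - norm y / R\<bar>" by (auto simp: cutoff_def)
  moreover have "\<bar>cutoff R x - cutoff R y\<bar> \<le> 1" using cutoff_bounds[of R x] cutoff_bounds[of R y] by linarith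
  ultimately show ?thesis by linarith
qed

lemma cutoff_tendsto_1:
  assumes "filterlim \<rho> at_top sequentially"
  shows "(\<lambda>n. cutoff (\<rho> n) x) \<longlonglongrightarrow> 1"
proof (rule tendsto_eventually)
  have "eventually (\<lambda>n. norm x + 1 \<le> \<rho> n) sequentially"
    using assms unfolding filterlim_at_top by blast
  then show "eventually (\<lambda>n. cutoff (\<rho> n) x = 1) sequentially"
  proof eventually_elim
    case (elim n)
    then have "0 < \<rho> n" "norm x \<le> \<rho> n" using norm_ge_zero[of x] by linarith+
    then have "norm x / \<rho> n \<le> 1" by simp
    then show ?case by (auto simp: cutoff_def)
  qed
qed

section \<open>Scaling invariance, the weak form, and passage to the limit in it\<close>

context fractional
begin

lemma rsc_q: "rsc q z l u x = l powr al * u (z + l *\<^sub>R (x::'a))"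
  by (simp add: rsc_def N_div_q flip: N_def)

text \<open>On pairs the dimension is 2N, and 2N / p = al + (N + s p) / p: the first summand is the
  weight of \<open>rsc q\<close>, the second comes from the denominator of G. Invariance of the
  energy is thus again invariance of an L^p norm.\<close>

lemma G_rsc: "0 < l \<Longrightarrow> G (rsc q z l u) = rsc p (z, z) l (G u)"
proof
  fix xy :: "'a \<times> 'a" assume l: "0 < l"
  obtain x y where xy: "xy = (x, y)" by (cases xy)
  let ?k = "(N + s * p) / p"
  have n: "norm ((z + l *\<^sub>R x) - (z + l *\<^sub>R y)) powr ?k = l powr ?k * norm (x - y) powr ?k"
    using l by (simp add: powr_mult flip: scaleR_diff_right)
  have e: "l powr (2 * N / p) = l powr al * l powr ?k"
    unfolding powr_add[symmetric] using p0 by (simp add: al_def add_divide_distrib[symmetric])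
  have d: "real DIM('a \<times> 'a) = 2 * N" by (simp add: N_def)
  have "l powr ?k \<noteq> 0" using l by simp
  then show "G (rsc q z l u) xy = rsc p (z, z) l (G u) xy"
    unfolding xy rsc_def[of p] G_def
    by (simp only: fst_conv snd_conv rsc_q n fst_add snd_add fst_scaleR snd_scaleR d e) (rule scaled_quotient)
qed

lemma Dsp_rsc:
  assumes u: "Dsp s p (u :: 'a \<Rightarrow> real)" and l: "0 < l"
  shows "Dsp s p (rsc q z l u)" "gagp s p (rsc q z l u) = gagp s p u" "Lint q lborel (rsc q z l u) = Lint q lborel u"
proof -
  show *: "Dsp s p (rsc q z l u)"
    unfolding Dsp_iff G_rsc[OF l] using Lq_rsc(1)[OF q0 l DspD(1)[OF u]] Lq_rsc(1)[OF p0 l DspD(2)[OF u]] by simp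
  show "gagp s p (rsc q z l u) = gagp s p u"
    unfolding gagp_eq[OF *] gagp_eq[OF u] G_rsc[OF l] by (rule Lq_rsc(2)[OF p0 l DspD(2)[OF u]])
  show "Lint q lborel (rsc q z l u) = Lint q lborel u" by (rule Lq_rsc(2)[OF q0 l DspD(1)[OF u]])
qed

lemma gag_eq: "gag s p (u :: 'a \<Rightarrow> real) = gagp s p u powr (1 / p)"
  by (simp add: gag_def)

text \<open>The denominator with exponent N + s p is shared out: p - 1 parts of (N + s p) / p go
  into \<open>Jp p (G u z)\<close> and one part into \<open>G \<phi> z\<close>. The weak form
  becomes a duality pairing, to which Hoelder's inequality and the weak limits apply.\<close>

lemma weak_form_eq:
  "weak_form s p a \<mu> u \<phi> = (\<integral>z. Jp p (G u z) * G \<phi> z \<partial>lborel) + (\<integral>x. a x * (Jp p (u x) * \<phi> x) \<partial>lborel)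
     - \<mu> * (\<integral>x. Jp q (u x) * \<phi> (x::'a) \<partial>lborel)"
proof -
  have "Jp p (u (fst z) - u (snd z)) * (\<phi> (fst z) - \<phi> (snd z)) / norm (fst z - snd z) powr (N + s * p)
     = Jp p (G u z) * G \<phi> z" for z
  proof (cases "fst z = snd z")
    case False
    let ?n = "norm (fst z - snd z)"
    let ?k = "?n powr ((N + s * p) / p)"
    have k: "?k > 0" using False by simp
    have "?k powr (p - 1) * ?k = ?n powr ((N + s * p) / p * (p - 1) + (N + s * p) / p)"
      by (simp add: powr_powr powr_add)
    also have "(N + s * p) / p * (p - 1) + (N + s * p) / p = N + s * p" using p0 by (simp add: field_simps)
    finally have e: "?n powr (N + s * p) = ?k powr (p - 1) * ?k" by simp
    have "Jp p (G u z) = (1 / ?k) powr (p - 1) * Jp p (u (fst z) - u (snd z))"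
      using Jp_cmult[of "1 / ?k" p "u (fst z) - u (snd z)"] k by (simp add: G_def)
    then show ?thesis unfolding e using k by (simp add: G_def powr_divide)
  qed (simp add: G_def)
  then have "weak_form s p a \<mu> u \<phi> = (\<integral>z. Jp p (G u z) * G \<phi> z \<partial>(lborel \<Otimes>\<^sub>M lborel))
     + (\<integral>x. a x * (Jp p (u x) * \<phi> x) \<partial>lborel) - \<mu> * (\<integral>x. Jp q (u x) * \<phi> x \<partial>lborel)"
    unfolding weak_form_def by (simp add: Jp_def q_def mult.assoc flip: N_def)
  then show ?thesis unfolding lborel_prod .
qed

abbreviation WF :: "real \<Rightarrow> ('a \<Rightarrow> real) \<Rightarrow> ('a \<Rightarrow> real) \<Rightarrow> real" where
  "WF \<mu> u \<phi> \<equiv> weak_form s p (\<lambda>_. 0) \<mu> u \<phi>"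

lemma WF_eq: "WF \<mu> u \<phi> = (\<integral>z. Jp p (G u z) * G \<phi> z \<partial>lborel) - \<mu> * (\<integral>x. Jp q (u x) * \<phi> x \<partial>lborel)"
  by (simp add: weak_form_eq)

lemma WF_rsc:
  assumes l: "0 < l" and [measurable]: "u \<in> borel_measurable borel" "\<phi> \<in> borel_measurable borel"
  shows "WF \<mu> (rsc q z l u) (rsc q z l \<phi>) = WF \<mu> u \<phi>"
  unfolding WF_eq G_rsc[OF l]
  by (subst integral_rsc[OF p1 l], simp, simp, subst integral_rsc[OF q1 l]) simp_all

lemma WF_self:
  assumes "Dsp s p u" shows "WF \<mu> u u = gagp s p u - \<mu> * Lint q lborel u"
  unfolding WF_eq gagp_eq[OF assms] by (simp add: Jp_mult_self Lint_def)

lemma pairing_bound: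
  assumes F: "Lq (p / (p - 1)) lborel F" and \<phi>: "Dsp s p \<phi>"
  shows "integrable lborel (\<lambda>z. F z * G \<phi> z)"
    "\<bar>\<integral>z. F z * G \<phi> z \<partial>lborel\<bar> \<le> Lint (p / (p - 1)) lborel F powr (1 - 1 / p) * gag s p \<phi>"
proof -
  have e: "1 / (p / (p - 1)) = 1 - 1 / p" using p1 by (simp add: field_simps)
  note H = Holder[OF conjugate_exponent(1)[OF p1] p1 conjugate_exponent(2)[OF p1] F DspD(2)[OF \<phi>]]
  show "integrable lborel (\<lambda>z. F z * G \<phi> z)"
    "\<bar>\<integral>z. F z * G \<phi> z \<partial>lborel\<bar> \<le> Lint (p / (p - 1)) lborel F powr (1 - 1 / p) * gag s p \<phi>"
    using H unfolding e by (auto simp: gag_eq gagp_eq[OF \<phi>])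
qed

lemma critical_integrable:
  assumes F: "Lq (q / (q - 1)) lborel F" and \<phi>: "Dsp s p (\<phi> :: 'a \<Rightarrow> real)"
  shows "integrable lborel (\<lambda>x. F x * \<phi> x)"
  by (rule Holder(1)[OF conjugate_exponent(1)[OF q1] q1 conjugate_exponent(2)[OF q1] F DspD(1)[OF \<phi>]])

text \<open>Hoelder's inequality followed by Sobolev's: smallness in the exponent conjugate to q is
  smallness in the dual norm.\<close>

lemma critical_bound:
  "\<exists>C>0. \<forall>F \<phi>. Lq (q / (q - 1)) lborel F \<longrightarrow> Dsp s p (\<phi>::'a \<Rightarrow> real) \<longrightarrow>
     \<bar>\<integral>x. F x * \<phi> x \<partial>lborel\<bar> \<le> C * Lint (q / (q - 1)) lborel F powr (1 - 1 / q) * gag s p \<phi>"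
proof -
  obtain C where C: "C > 0" "\<And>v::'a \<Rightarrow> real. Dsp s p v \<Longrightarrow> Lint q lborel v \<le> C * gagp s p v powr (q / p)"
    using Sobolev by auto
  have e: "1 / (q / (q - 1)) = 1 - 1 / q" using q1 by (simp add: field_simps)
  have "\<bar>\<integral>x. F x * \<phi> x \<partial>lborel\<bar> \<le> C powr (1 / q) * Lint (q / (q - 1)) lborel F powr (1 - 1 / q) * gag s p \<phi>"
    if F: "Lq (q / (q - 1)) lborel F" and \<phi>: "Dsp s p (\<phi>::'a \<Rightarrow> real)" for F \<phi>
  proof -
    have "\<bar>\<integral>x. F x * \<phi> x \<partial>lborel\<bar> \<le> Lint (q / (q - 1)) lborel F powr (1 - 1 / q) * Lint q lborel \<phi> powr (1 / q)"
      using Holder(2)[OF conjugate_exponent(1)[OF q1] q1 conjugate_exponent(2)[OF q1] F DspD(1)[OF \<phi>]] unfolding e .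
    also have "\<dots> \<le> Lint (q / (q - 1)) lborel F powr (1 - 1 / q) * (C * gagp s p \<phi> powr (q / p)) powr (1 / q)"
      using C(2)[OF \<phi>] q0 by (intro mult_left_mono powr_mono2) auto
    also have "(C * gagp s p \<phi> powr (q / p)) powr (1 / q) = C powr (1 / q) * gag s p \<phi>"
      using C(1) q0 by (simp add: powr_mult powr_powr gag_eq)
    finally show ?thesis by (simp add: mult_ac)
  qed
  then show ?thesis using C(1) by (intro exI[of _ "C powr (1 / q)"]) auto
qed

text \<open>The estimate ranges over all of \<open>Dsp\<close>, whatever the support of \<phi>: it
  will be applied to rescaled test functions, whose supports vary with n while \<open>gag\<close>
  stays the same.\<close>

lemma WF_split:
  assumes D: "\<And>n. Dsp s p (U n)" "\<And>n. Dsp s p (V n)" "\<And>n. Dsp s p (W n)"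
    and 1: "(\<lambda>n. Lint (p / (p - 1)) lborel (\<lambda>z. Jp p (G (U n) z) - Jp p (G (V n) z) - Jp p (G (W n) z))) \<longlonglongrightarrow> 0"
    and 2: "(\<lambda>n. Lint (q / (q - 1)) lborel (\<lambda>x. Jp q (U n x) - Jp q (V n x) - Jp q (W n x))) \<longlonglongrightarrow> 0"
    and e: "0 < e"
  shows "eventually (\<lambda>n. \<forall>\<phi>. Dsp s p \<phi> \<longrightarrow> \<bar>WF \<mu> (U n) \<phi> - WF \<mu> (V n) \<phi> - WF \<mu> (W n) \<phi>\<bar> \<le> e * gag s p \<phi>) sequentially"
proof -
  obtain C where C: "C > 0" "\<And>F \<phi>::'a \<Rightarrow> real. Lq (q / (q - 1)) lborel F \<Longrightarrow> Dsp s p \<phi> \<Longrightarrow>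
     \<bar>\<integral>x. F x * \<phi> x \<partial>lborel\<bar> \<le> C * Lint (q / (q - 1)) lborel F powr (1 - 1 / q) * gag s p \<phi>"
    using critical_bound by auto
  define F where "F n z = Jp p (G (U n) z) - Jp p (G (V n) z) - Jp p (G (W n) z)" for n z
  define H where "H n x = Jp q (U n x) - Jp q (V n x) - Jp q (W n x)" for n x
  note JG = Lq_Jp(1)[OF p1 DspD(2)] and JU = Lq_Jp(1)[OF q1 DspD(1)]
  have pc: "0 < p / (p - 1)" "0 < q / (q - 1)" using p1 q1 by auto
  have FL: "Lq (p / (p - 1)) lborel (F n)" for n unfolding F_def[abs_def] by (intro Lq_diff(1) pc JG D)
  have HL: "Lq (q / (q - 1)) lborel (H n)" for n unfolding H_def[abs_def] by (intro Lq_diff(1) pc JU D)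
  let ?b = "\<lambda>n. Lint (p / (p - 1)) lborel (F n) powr (1 - 1 / p) + \<bar>\<mu>\<bar> * (C * Lint (q / (q - 1)) lborel (H n) powr (1 - 1 / q))"
  have "?b \<longlonglongrightarrow> 0 powr (1 - 1 / p) + \<bar>\<mu>\<bar> * (C * 0 powr (1 - 1 / q))"
    using 1 2 p1 q1 unfolding F_def H_def
    by (intro tendsto_add tendsto_mult tendsto_const tendsto_powr2) auto
  then have "?b \<longlonglongrightarrow> 0" by simp
  then have "eventually (\<lambda>n. ?b n < e) sequentially" by (rule order_tendstoD(2)) (rule e)
  then show ?thesis
  proof (rule eventually_mono, intro allI impI)
    fix n and \<phi> :: "'a \<Rightarrow> real" assume b: "?b n < e" and \<phi>: "Dsp s p \<phi>"
    have i1: "integrable lborel (\<lambda>z. Jp p (G (X n) z) * G \<phi> z)" if "\<And>n. Dsp s p (X n)" for X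
      by (rule pairing_bound(1)[OF JG[OF that] \<phi>])
    have i2: "integrable lborel (\<lambda>x. Jp q (X n x) * \<phi> x)" if "\<And>n. Dsp s p (X n)" for X
      by (rule critical_integrable[OF JU[OF that] \<phi>])
    have "(\<integral>z. F n z * G \<phi> z \<partial>lborel) = (\<integral>z. Jp p (G (U n) z) * G \<phi> z \<partial>lborel)
        - (\<integral>z. Jp p (G (V n) z) * G \<phi> z \<partial>lborel) - (\<integral>z. Jp p (G (W n) z) * G \<phi> z \<partial>lborel)"
      unfolding F_def left_diff_distrib using i1[of U, OF D(1)] i1[of V, OF D(2)] i1[of W, OF D(3)] by simp
    moreover have "(\<integral>x. H n x * \<phi> x \<partial>lborel) = (\<integral>x. Jp q (U n x) * \<phi> x \<partial>lborel)
        - (\<integral>x. Jp q (V n x) * \<phi> x \<partial>lborel) - (\<integral>x. Jp q (W n x) * \<phi> x \<partial>lborel)"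
      unfolding H_def left_diff_distrib using i2[of U, OF D(1)] i2[of V, OF D(2)] i2[of W, OF D(3)] by simp
    ultimately have "WF \<mu> (U n) \<phi> - WF \<mu> (V n) \<phi> - WF \<mu> (W n) \<phi>
        = (\<integral>z. F n z * G \<phi> z \<partial>lborel) - \<mu> * (\<integral>x. H n x * \<phi> x \<partial>lborel)"
      by (simp add: WF_eq right_diff_distrib)
    also have "\<bar>\<dots>\<bar> \<le> \<bar>\<integral>z. F n z * G \<phi> z \<partial>lborel\<bar> + \<bar>\<mu>\<bar> * \<bar>\<integral>x. H n x * \<phi> x \<partial>lborel\<bar>"
      unfolding abs_mult[symmetric] by (rule abs_triangle_ineq4)
    also have "\<dots> \<le> Lint (p / (p - 1)) lborel (F n) powr (1 - 1 / p) * gag s p \<phi>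
        + \<bar>\<mu>\<bar> * (C * Lint (q / (q - 1)) lborel (H n) powr (1 - 1 / q) * gag s p \<phi>)"
      by (intro add_mono mult_left_mono pairing_bound(2) C FL HL \<phi>) auto
    also have "\<dots> = ?b n * gag s p \<phi>" by (simp only: distrib_right mult.assoc)
    also have "\<dots> \<le> e * gag s p \<phi>" using b by (intro mult_right_mono) (auto simp: gag_eq)
    finally show "\<bar>WF \<mu> (U n) \<phi> - WF \<mu> (V n) \<phi> - WF \<mu> (W n) \<phi>\<bar> \<le> e * gag s p \<phi>" .
  qed
qed

lemma AE_G_tendsto:
  assumes "AE x in lborel. (\<lambda>n. u n x) \<longlonglongrightarrow> w (x::'a)"
  shows "AE z in lborel. (\<lambda>n. G (u n) z) \<longlonglongrightarrow> G w z"
  using AE_lborel_fst_snd[OF assms]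
  by eventually_elim (auto simp: G_def divide_inverse intro!: tendsto_intros)

lemma Dsp_limit:
  fixes u :: "nat \<Rightarrow> 'a \<Rightarrow> real"
  assumes u: "\<And>n. Dsp s p (u n)" "\<And>n. gagp s p (u n) \<le> K"
    and lim: "AE x in lborel. (\<lambda>n. u n x) \<longlonglongrightarrow> w x" and w: "w \<in> borel_measurable borel"
  shows "Dsp s p w" "\<exists>L. \<forall>n. Lint q lborel (u n) \<le> L"
proof -
  obtain C where C: "C > 0" "\<And>v::'a \<Rightarrow> real. Dsp s p v \<Longrightarrow> Lint q lborel v \<le> C * gagp s p v powr (q / p)"
    using Sobolev by auto
  have L: "Lint q lborel (u n) \<le> C * K powr (q / p)" for n
  proof -
    have "C * gagp s p (u n) powr (q / p) \<le> C * K powr (q / p)"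
      using C(1) u(2) q0 p0 by (intro mult_left_mono powr_mono2) auto
    then show ?thesis using C(2)[OF u(1)[of n]] by linarith
  qed
  then show "\<exists>L. \<forall>n. Lint q lborel (u n) \<le> L" by blast
  have "Lq q lborel w"
    by (rule Lq_Fatou(1)[OF q0 DspD(1)[OF u(1)] L lim]) (use w in simp)
  moreover have "Lq p lborel (G w)"
    by (rule Lq_Fatou(1)[OF p0 DspD(2)[OF u(1)] _ AE_G_tendsto[OF lim]])
       (use u w in \<open>auto simp: gagp_eq[symmetric]\<close>)
  ultimately show "Dsp s p w" by (simp add: Dsp_iff)
qed

lemma WF_limit:
  fixes u :: "nat \<Rightarrow> 'a \<Rightarrow> real"
  assumes u: "\<And>n. Dsp s p (u n)" "\<And>n. gagp s p (u n) \<le> K"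
    and lim: "AE x in lborel. (\<lambda>n. u n x) \<longlonglongrightarrow> w x" and w: "w \<in> borel_measurable borel"
    and \<phi>: "Dsp s p \<phi>"
  shows "(\<lambda>n. WF \<mu> (u n) \<phi>) \<longlonglongrightarrow> WF \<mu> w \<phi>"
proof -
  obtain L where L: "\<And>n. Lint q lborel (u n) \<le> L" using Dsp_limit(2)[OF u lim w] by blast
  have [measurable]: "w \<in> borel_measurable borel" by fact
  note JG = Lq_Jp[OF p1 DspD(2)[OF u(1)]] and JU = Lq_Jp[OF q1 DspD(1)[OF u(1)]]
  have "(\<lambda>n. \<integral>z. Jp p (G (u n) z) * G \<phi> z \<partial>lborel) \<longlonglongrightarrow> (\<integral>z. Jp p (G w z) * G \<phi> z \<partial>lborel)"
  proof (rule Lq_weak_limit(2)[OF conjugate_exponent(1)[OF p1] p1 conjugate_exponent(2)[OF p1] JG(1) _ _ _ DspD(2)[OF \<phi>]])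
    show "Lint (p / (p - 1)) lborel (\<lambda>z. Jp p (G (u n) z)) \<le> K" for n
      using u by (simp add: JG(2) gagp_eq[symmetric])
    show "AE z in lborel. (\<lambda>n. Jp p (G (u n) z)) \<longlonglongrightarrow> Jp p (G w z)"
      using AE_G_tendsto[OF lim] by eventually_elim (rule tendsto_Jp[OF p1])
  qed measurable
  moreover have "(\<lambda>n. \<integral>x. Jp q (u n x) * \<phi> x \<partial>lborel) \<longlonglongrightarrow> (\<integral>x. Jp q (w x) * \<phi> x \<partial>lborel)"
  proof (rule Lq_weak_limit(2)[OF conjugate_exponent(1)[OF q1] q1 conjugate_exponent(2)[OF q1] JU(1) _ _ _ DspD(1)[OF \<phi>]])
    show "Lint (q / (q - 1)) lborel (\<lambda>x. Jp q (u n x)) \<le> L" for n using L by (simp add: JU(2))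
    show "AE x in lborel. (\<lambda>n. Jp q (u n x)) \<longlonglongrightarrow> Jp q (w x)"
      using lim by eventually_elim (rule tendsto_Jp[OF q1])
  qed measurable
  ultimately show ?thesis unfolding WF_eq by (intro tendsto_diff tendsto_mult tendsto_const)
qed

lemma WF_limit_test:
  fixes \<phi> :: "nat \<Rightarrow> 'a \<Rightarrow> real"
  assumes \<phi>: "\<And>n. Dsp s p (\<phi> n)" "\<And>n. gagp s p (\<phi> n) \<le> K"
    and lim: "AE x in lborel. (\<lambda>n. \<phi> n x) \<longlonglongrightarrow> \<psi> x" and \<psi>: "\<psi> \<in> borel_measurable borel"
    and w: "Dsp s p w"
  shows "(\<lambda>n. WF \<mu> w (\<phi> n)) \<longlonglongrightarrow> WF \<mu> w \<psi>"
proof -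
  obtain L where L: "\<And>n. Lint q lborel (\<phi> n) \<le> L" using Dsp_limit(2)[OF \<phi> lim \<psi>] by blast
  have [measurable]: "\<psi> \<in> borel_measurable borel" by fact
  have "(\<lambda>n. \<integral>z. G (\<phi> n) z * Jp p (G w z) \<partial>lborel) \<longlonglongrightarrow> (\<integral>z. G \<psi> z * Jp p (G w z) \<partial>lborel)"
  proof (rule Lq_weak_limit(2)[OF p1 conjugate_exponent(1,3)[OF p1] DspD(2)[OF \<phi>(1)] _ AE_G_tendsto[OF lim] _ Lq_Jp(1)[OF p1 DspD(2)[OF w]]])
    show "Lint p lborel (G (\<phi> n)) \<le> K" for n using \<phi> by (simp add: gagp_eq[symmetric])
  qed measurable
  moreover have "(\<lambda>n. \<integral>x. \<phi> n x * Jp q (w x) \<partial>lborel) \<longlonglongrightarrow> (\<integral>x. \<psi> x * Jp q (w x) \<partial>lborel)"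
    by (rule Lq_weak_limit(2)[OF q1 conjugate_exponent(1,3)[OF q1] DspD(1)[OF \<phi>(1)] L lim _ Lq_Jp(1)[OF q1 DspD(1)[OF w]]]) measurable
  ultimately show ?thesis unfolding WF_eq mult.commute[of "Jp p (G w z)" for z] mult.commute[of "Jp q (w x)" for x]
    by (intro tendsto_diff tendsto_mult tendsto_const)
qed

end

section \<open>Blow-up of the domain at a boundary point\<close>

lemma linear_basis_expansion:
  fixes L :: "'a::euclidean_space \<Rightarrow> real"
  assumes "linear L" shows "L x = (\<Sum>b\<in>Basis. (x \<bullet> b) * L b)"
proof -
  have "L x = L (\<Sum>b\<in>Basis. (x \<bullet> b) *\<^sub>R b)" by (simp add: euclidean_representation)
  also have "\<dots> = (\<Sum>b\<in>Basis. (x \<bullet> b) * L b)"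
    by (simp only: linear_sum[OF assms] linear_scale[OF assms] real_scaleR_def)
  finally show ?thesis .
qed

text \<open>The mean value inequality for \<rho> - L on a ball where the derivative is close to L.
  Two free points are needed because the blow-up compares \<rho> at a rescaled point with its value
  at a nearby boundary point, and both move with n.\<close>

lemma strict_derivative_of_smooth:
  fixes \<rho> :: "'a::euclidean_space \<Rightarrow> real"
  assumes sm: "smooth_on (ball x0 r) \<rho>" and r: "0 < r" and D: "(\<rho> has_derivative L) (at x0)" and e: "0 < e"
  shows "\<exists>d>0. d \<le> r \<and> (\<forall>x\<in>ball x0 d. \<forall>y\<in>ball x0 d. \<bar>\<rho> x - \<rho> y - L (x - y)\<bar> \<le> e * norm (x - y))"
proof -
  have "Ck_on (Suc 0) (ball x0 r) \<rho>" using sm unfolding smooth_on_def by blast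
  then obtain f' where f': "\<And>x. x \<in> ball x0 r \<Longrightarrow> (\<rho> has_derivative f' x) (at x)"
    and ct: "\<And>v. continuous_on (ball x0 r) (\<lambda>x. f' x v)" by (auto simp del: mem_ball)
  have x0: "x0 \<in> ball x0 r" using r by simp
  have L: "L = f' x0" using D f'[OF x0] has_derivative_unique by blast
  \<comment> \<open>\<open>Ck_on\<close> gives continuity of \<open>f' x v\<close> for each fixed v
    only, so closeness of the derivatives is tested on the basis vectors and the errors are summed
    over the dimension.\<close>
  define e' where "e' = e / real DIM('a)"
  have e': "e' > 0" using e by (simp add: e'_def)
  have "eventually (\<lambda>x. \<forall>b\<in>Basis. \<bar>f' x b - f' x0 b\<bar> < e') (at x0)"
  proof (intro eventually_ball_finite ballI finite_Basis)
    fix b :: 'a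
    have "isCont (\<lambda>x. f' x b) x0" using ct[of b] x0 by (simp add: continuous_on_eq_continuous_at)
    then have *: "((\<lambda>x. f' x b) \<longlongrightarrow> f' x0 b) (at x0)" by (simp add: isCont_def)
    show "eventually (\<lambda>x. \<bar>f' x b - f' x0 b\<bar> < e') (at x0)"
      using tendstoD[OF * e'] by (simp add: dist_real_def)
  qed
  then obtain d0 where d0: "d0 > 0" "\<And>x b. x \<noteq> x0 \<Longrightarrow> dist x x0 < d0 \<Longrightarrow> b \<in> Basis \<Longrightarrow> \<bar>f' x b - f' x0 b\<bar> < e'"
    unfolding eventually_at by blast
  define d where "d = min d0 r"
  have d: "d > 0" "d \<le> r" using d0 r by (auto simp: d_def)
  have "\<bar>\<rho> x - \<rho> y - L (x - y)\<bar> \<le> e * norm (x - y)" if xy: "x \<in> ball x0 d" "y \<in> ball x0 d" for x y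
  proof -
    have lin: "linear L" using D has_derivative_linear by blast
    have "norm ((\<rho> x - L x) - (\<rho> y - L y)) \<le> e * norm (x - y)"
    proof (rule differentiable_bound[where S = "ball x0 d" and f' = "\<lambda>x v. f' x v - L v"])
      fix x assume x: "x \<in> ball x0 d"
      then have xr: "x \<in> ball x0 r" using d by auto
      have "(L has_derivative L) (at x within ball x0 d)"
        using D has_derivative_bounded_linear bounded_linear_imp_has_derivative by blast
      then show "((\<lambda>x. \<rho> x - L x) has_derivative (\<lambda>v. f' x v - L v)) (at x within ball x0 d)"
        by (intro has_derivative_diff has_derivative_at_withinI[OF f'[OF xr]])
      have lx: "linear (f' x)" using f'[OF xr] has_derivative_linear by blast
      show "onorm (\<lambda>v. f' x v - L v) \<le> e"
      proof (rule onorm_le)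
        fix v :: 'a
        have "f' x v - L v = (\<Sum>b\<in>Basis. (v \<bullet> b) * (f' x b - f' x0 b))"
        proof -
          have "f' x v = (\<Sum>b\<in>Basis. (v \<bullet> b) * f' x b)"
            by (rule linear_basis_expansion[OF lx])
          moreover have "L v = (\<Sum>b\<in>Basis. (v \<bullet> b) * L b)"
            by (rule linear_basis_expansion[OF lin])
          ultimately show ?thesis by (simp add: L right_diff_distrib sum_subtractf)
        qed
        also have "norm \<dots> \<le> (\<Sum>b\<in>(Basis::'a set). norm v * e')"
        proof (rule sum_norm_le)
          fix b :: 'a assume b: "b \<in> Basis"
          have *: "\<bar>f' x b - f' x0 b\<bar> \<le> e'"
            using d0(2)[of x b] b x e' by (cases "x = x0") (auto simp: d_def dist_commute less_imp_le)
          have "\<bar>v \<bullet> b\<bar> * \<bar>f' x b - f' x0 b\<bar> \<le> norm v * e'"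
            by (intro mult_mono Basis_le_norm[OF b] *) auto
          then show "norm ((v \<bullet> b) * (f' x b - f' x0 b)) \<le> norm v * e'" by (simp add: abs_mult)
        qed
        also have "\<dots> = e * norm v" by (simp add: e'_def)
        finally show "norm (f' x v - L v) \<le> e * norm v" .
      qed
    qed (use xy in auto)
    then show ?thesis by (simp add: linear_diff[OF lin] algebra_simps)
  qed
  then show ?thesis using d by blast
qed

lemma linear_functional_inner:
  fixes L :: "'a::euclidean_space \<Rightarrow> real"
  assumes "linear L"
  obtains g where "\<And>x. L x = x \<bullet> g"
proof
  fix x
  have "L x = (\<Sum>b\<in>Basis. (x \<bullet> b) * L b)" by (rule linear_basis_expansion[OF assms])
  also have "\<dots> = x \<bullet> (\<Sum>b\<in>Basis. L b *\<^sub>R b)" by (simp add: inner_sum_right mult.commute)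
  finally show "L x = x \<bullet> (\<Sum>b\<in>Basis. L b *\<^sub>R b)" .
qed

text \<open>A ball is connected, so if it met both \<Omega> and the complement it would contain a
  frontier point.\<close>

lemma ball_infdist_frontier_subset:
  fixes \<Omega> :: "'a::euclidean_space set"
  assumes "z \<in> \<Omega>" shows "ball z (infdist z (frontier \<Omega>)) \<subseteq> \<Omega>"
proof (rule ccontr)
  assume "\<not> ?thesis"
  then have ne: "ball z (infdist z (frontier \<Omega>)) - \<Omega> \<noteq> {}" by blast
  then obtain x where "x \<in> ball z (infdist z (frontier \<Omega>))" by blast
  then have "infdist z (frontier \<Omega>) > 0" using zero_le_dist[of z x] unfolding mem_ball by linarith
  then have "ball z (infdist z (frontier \<Omega>)) \<inter> \<Omega> \<noteq> {}"
    using assms centre_in_ball by blast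
  then have "ball z (infdist z (frontier \<Omega>)) \<inter> frontier \<Omega> \<noteq> {}"
    using ne by (intro connected_Int_frontier connected_ball)
  then obtain y where "y \<in> frontier \<Omega>" "dist z y < infdist z (frontier \<Omega>)" by auto
  then show False using infdist_le[of y "frontier \<Omega>" z] by simp
qed

text \<open>Seen from z n at scale l n, the nearest boundary point stays within distance C, so the
  boundary does not escape to infinity but flattens to a hyperplane. The exterior statement is
  pointwise, which suffices for a limit profile to vanish there; the interior one is uniform on
  bounded sets off the hyperplane, as needed to carry a whole test function into \<Omega>.\<close>

lemma blow_up_half_space:
  fixes \<Omega> :: "'a::euclidean_space set"
  assumes \<Omega>: "open \<Omega>" "bounded \<Omega>" "smooth_boundary \<Omega>" and ne: "frontier \<Omega> \<noteq> {}"
    and l: "\<And>n. 0 < l n" "l \<longlonglongrightarrow> 0" and C: "\<And>n. infdist (z n) (frontier \<Omega>) \<le> C * l n"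
  shows "\<exists>\<sigma> \<nu> t. strict_mono \<sigma> \<and> \<nu> \<noteq> 0
    \<and> (\<forall>x. x \<bullet> \<nu> < t \<longrightarrow> eventually (\<lambda>n. z (\<sigma> n) + l (\<sigma> n) *\<^sub>R x \<notin> \<Omega>) sequentially)
    \<and> (\<forall>B \<eta>. 0 < \<eta> \<longrightarrow> eventually (\<lambda>n. \<forall>x. norm x \<le> B \<and> t + \<eta> \<le> x \<bullet> \<nu> \<longrightarrow> z (\<sigma> n) + l (\<sigma> n) *\<^sub>R x \<in> \<Omega>) sequentially)"
proof -
  have cf: "compact (frontier \<Omega>)" using \<Omega>(2) by (rule compact_frontier_bounded)
  have "\<exists>y\<in>frontier \<Omega>. infdist (z n) (frontier \<Omega>) = dist (z n) y" for n
    using infdist_attains_inf[OF _ ne, of "z n"] by (metis frontier_closed)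
  then obtain y where y: "\<And>n. y n \<in> frontier \<Omega>" "\<And>n. infdist (z n) (frontier \<Omega>) = dist (z n) (y n)" by metis
  \<comment> \<open>The position of z n relative to its nearest boundary point, in units of l
    n.\<close>
  define \<zeta> where "\<zeta> n = (1 / l n) *\<^sub>R (z n - y n)" for n
  have \<zeta>: "\<zeta> n \<in> cball 0 C" for n
  proof -
    have "norm (z n - y n) \<le> C * l n" using C[of n] y(2)[of n] by (simp add: dist_norm)
    then show ?thesis using l(1)[of n] by (simp add: \<zeta>_def divide_le_eq)
  qed
  have "compact (frontier \<Omega> \<times> cball (0::'a) C)" by (intro compact_Times cf compact_cball)
  then obtain l0 \<sigma> where l0: "l0 \<in> frontier \<Omega> \<times> cball 0 C" and \<sigma>: "strict_mono \<sigma>"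
    and lim: "((\<lambda>n. (y n, \<zeta> n)) \<circ> \<sigma>) \<longlonglongrightarrow> l0"
    unfolding compact_def using y(1) \<zeta> by (metis (no_types, lifting) mem_Sigma_iff)
  define x0 where "x0 = fst l0"
  define \<xi> where "\<xi> = snd l0"
  have x0: "x0 \<in> frontier \<Omega>" using l0 by (auto simp: x0_def)
  have yl: "(\<lambda>n. y (\<sigma> n)) \<longlonglongrightarrow> x0" and \<zeta>l: "(\<lambda>n. \<zeta> (\<sigma> n)) \<longlonglongrightarrow> \<xi>"
    using tendsto_fst[OF lim] tendsto_snd[OF lim] by (auto simp: x0_def \<xi>_def o_def)
  have ls: "(\<lambda>n. l (\<sigma> n)) \<longlonglongrightarrow> 0" using LIMSEQ_subseq_LIMSEQ[OF l(2) \<sigma>] by (simp add: o_def)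
  obtain r \<rho> \<rho>' where r: "r > 0" "smooth_on (ball x0 r) \<rho>"
    and \<rho>': "\<And>x. x \<in> ball x0 r \<Longrightarrow> (\<rho> has_derivative \<rho>' x) (at x) \<and> \<rho>' x \<noteq> (\<lambda>v. 0)"
    and \<Omega>r: "\<Omega> \<inter> ball x0 r = {x\<in>ball x0 r. \<rho> x < 0}"
    using \<Omega>(3) x0 unfolding smooth_boundary_def by blast
  have x0r: "x0 \<in> ball x0 r" using r by simp
  define L where "L = \<rho>' x0"
  have L: "(\<rho> has_derivative L) (at x0)" "L \<noteq> (\<lambda>v. 0)" using \<rho>'[OF x0r] by (auto simp: L_def)
  have lin: "linear L" using L(1) has_derivative_linear by blast
  obtain g where g: "\<And>x. L x = x \<bullet> g" using linear_functional_inner[OF lin] by blast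
  have g0: "g \<noteq> 0" using L(2) g by auto
  \<comment> \<open>The definition of a smooth boundary says only that \<Omega> is {\<rho> < 0} near
    x0. On the frontier \<rho> \<ge> 0 because \<Omega> is open, and \<rho> > 0 would persist on a
    neighbourhood that misses \<Omega>.\<close>
  have \<rho>0: "\<rho> x = 0" if x: "x \<in> frontier \<Omega>" "x \<in> ball x0 r" for x
  proof (rule antisym)
    have "x \<notin> \<Omega>" using x(1) \<Omega>(1) by (simp add: frontier_def interior_open)
    show "0 \<le> \<rho> x"
    proof (rule ccontr)
      assume "\<not> 0 \<le> \<rho> x"
      then have "x \<in> \<Omega> \<inter> ball x0 r" unfolding \<Omega>r using x(2) by simp
      then show False using \<open>x \<notin> \<Omega>\<close> by simp
    qed
    have ct: "isCont \<rho> x" using \<rho>'[OF x(2)] has_derivative_continuous by blast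
    show "\<rho> x \<le> 0"
    proof (rule ccontr)
      assume "\<not> \<rho> x \<le> 0"
      then have "eventually (\<lambda>y. 0 < \<rho> y) (nhds x)"
        using ct by (intro order_tendstoD(1)[where F = "nhds x" and f = \<rho>]) (auto simp: isCont_def tendsto_at_iff_tendsto_nhds)
      moreover have "eventually (\<lambda>y. y \<in> ball x0 r) (nhds x)" using x(2) by (intro eventually_nhds_in_open) auto
      ultimately have "eventually (\<lambda>y. y \<in> ball x0 r \<and> 0 < \<rho> y) (nhds x)" by eventually_elim auto
      then obtain S where S: "open S" "x \<in> S" "\<And>y. y \<in> S \<Longrightarrow> y \<in> ball x0 r \<and> 0 < \<rho> y"
        unfolding eventually_nhds by blast
      have "x \<in> closure \<Omega>" using x(1) by (simp add: frontier_def)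
      then obtain y where "y \<in> \<Omega>" "y \<in> S" using S(1,2) by (meson closure_iff_nhds_not_empty disjoint_iff order_refl)
      moreover have "y \<in> ball x0 r" "0 < \<rho> y" using S(3)[OF \<open>y \<in> S\<close>] by auto
      ultimately have "y \<in> {x\<in>ball x0 r. \<rho> x < 0}" unfolding \<Omega>r[symmetric] by simp
      then show False using \<open>0 < \<rho> y\<close> by simp
    qed
  qed
  text \<open>The rescaled defining function tends to the linear function \<open>\<lambda>x. (\<xi> + x) \<bullet> g\<close>, locally uniformly.\<close>
  have main: "eventually (\<lambda>n. \<forall>x. norm x \<le> B \<longrightarrow> z (\<sigma> n) + l (\<sigma> n) *\<^sub>R x \<in> ball x0 r
      \<and> \<bar>\<rho> (z (\<sigma> n) + l (\<sigma> n) *\<^sub>R x) - l (\<sigma> n) * ((\<xi> + x) \<bullet> g)\<bar> \<le> l (\<sigma> n) * e) sequentially"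
    if e: "0 < e" for B e
  proof -
    \<comment> \<open>A bound for |\<zeta> + x| once \<zeta> is within 1 of \<xi>. Half of e then
      pays for the linearisation of \<rho>, the other half for replacing \<zeta> by \<xi>.\<close>
    define A where "A = \<bar>B\<bar> + norm \<xi> + 1"
    have A: "A > 0" by (simp add: A_def add_nonneg_pos)
    define e1 where "e1 = e / (2 * A)"
    have e1: "e1 > 0" using e A by (simp add: e1_def)
    obtain d where d: "d > 0" "d \<le> r"
      "\<And>x y. x \<in> ball x0 d \<Longrightarrow> y \<in> ball x0 d \<Longrightarrow> \<bar>\<rho> x - \<rho> y - L (x - y)\<bar> \<le> e1 * norm (x - y)"
      using strict_derivative_of_smooth[OF r(2,1) L(1) e1] by blast
    have cancel: "e / (2 * k) * k = e / 2" if "0 < k" for k :: real using that by (simp add: field_simps)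
    have ng: "norm g + 1 > 0" by (simp add: add_nonneg_pos)
    have ev1: "eventually (\<lambda>n. dist (y (\<sigma> n)) x0 < d / 2) sequentially"
      using d by (intro tendstoD[OF yl]) auto
    have ev2: "eventually (\<lambda>n. dist (\<zeta> (\<sigma> n)) \<xi> < min 1 (e / (2 * (norm g + 1)))) sequentially"
      using e ng by (intro tendstoD[OF \<zeta>l]) auto
    have ev3: "eventually (\<lambda>n. l (\<sigma> n) < d / (2 * A)) sequentially"
      using d A by (intro order_tendstoD(2)[OF ls]) auto
    show ?thesis using ev1 ev2 ev3
    proof eventually_elim
      case (elim n)
      let ?l = "l (\<sigma> n)" and ?y = "y (\<sigma> n)" and ?z = "z (\<sigma> n)"
      have l: "?l > 0" by (rule l(1))
      show ?case
      proof (intro allI impI)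
        fix x :: 'a assume x: "norm x \<le> B"
        let ?v = "\<zeta> (\<sigma> n) + x"
        have eq: "?z + ?l *\<^sub>R x = ?y + ?l *\<^sub>R ?v"
          using l by (simp add: \<zeta>_def scaleR_add_right)
        have "norm (\<zeta> (\<sigma> n)) \<le> norm \<xi> + 1"
          using elim(2) norm_triangle_ineq2[of "\<zeta> (\<sigma> n)" \<xi>] by (simp add: dist_norm)
        then have v: "norm ?v \<le> A"
          using norm_triangle_ineq[of "\<zeta> (\<sigma> n)" x] x by (simp add: A_def)
        have "norm (?l *\<^sub>R ?v) \<le> ?l * A" using v l by (simp add: mult_left_mono)
        also have "\<dots> < d / (2 * A) * A" using elim(3) A by (intro mult_strict_right_mono) auto
        also have "\<dots> = d / 2" using A by simp
        finally have lv: "norm (?l *\<^sub>R ?v) < d / 2" .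
        have yd: "?y \<in> ball x0 d" using elim(1) d by (simp add: dist_commute)
        have "dist x0 (?y + ?l *\<^sub>R ?v) \<le> dist x0 ?y + norm (?l *\<^sub>R ?v)"
          using dist_triangle[of x0 "?y + ?l *\<^sub>R ?v" ?y] by (simp add: dist_norm)
        then have zd: "?y + ?l *\<^sub>R ?v \<in> ball x0 d" using elim(1) lv by (simp add: dist_commute)
        have "\<rho> ?y = 0" by (rule \<rho>0) (use y(1) yd d in auto)
        then have "\<bar>\<rho> (?y + ?l *\<^sub>R ?v) - L (?l *\<^sub>R ?v)\<bar> \<le> e1 * norm (?l *\<^sub>R ?v)"
          using d(3)[OF zd yd] by simp
        also have "\<dots> = ?l * (e1 * norm ?v)" using l by simp
        also have "\<dots> \<le> ?l * (e1 * A)" using l e1 v by (intro mult_left_mono) auto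
        also have "e1 * A = e / 2" using A by (simp add: e1_def)
        finally have 1: "\<bar>\<rho> (?y + ?l *\<^sub>R ?v) - ?l * (?v \<bullet> g)\<bar> \<le> ?l * (e / 2)" by (simp add: g)
        have "\<bar>?v \<bullet> g - (\<xi> + x) \<bullet> g\<bar> = \<bar>(\<zeta> (\<sigma> n) - \<xi>) \<bullet> g\<bar>" by (simp add: inner_left_distrib inner_diff_left)
        also have "\<dots> \<le> norm (\<zeta> (\<sigma> n) - \<xi>) * norm g" by (rule Cauchy_Schwarz_ineq2)
        also have "\<dots> \<le> e / (2 * (norm g + 1)) * (norm g + 1)"
          using elim(2) e ng by (intro mult_mono) (auto simp: dist_norm)
        also have "\<dots> = e / 2" using cancel[OF ng] by simp
        finally have 2: "?l * \<bar>?v \<bullet> g - (\<xi> + x) \<bullet> g\<bar> \<le> ?l * (e / 2)" using l by (intro mult_left_mono) auto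
        have "\<bar>\<rho> (?y + ?l *\<^sub>R ?v) - ?l * ((\<xi> + x) \<bullet> g)\<bar> \<le> \<bar>\<rho> (?y + ?l *\<^sub>R ?v) - ?l * (?v \<bullet> g)\<bar> + ?l * \<bar>?v \<bullet> g - (\<xi> + x) \<bullet> g\<bar>"
        proof -
          have "\<rho> (?y + ?l *\<^sub>R ?v) - ?l * ((\<xi> + x) \<bullet> g) = (\<rho> (?y + ?l *\<^sub>R ?v) - ?l * (?v \<bullet> g)) + ?l * (?v \<bullet> g - (\<xi> + x) \<bullet> g)"
            by (simp add: algebra_simps)
          moreover have "\<bar>?l * (?v \<bullet> g - (\<xi> + x) \<bullet> g)\<bar> = ?l * \<bar>?v \<bullet> g - (\<xi> + x) \<bullet> g\<bar>" using l by (simp add: abs_mult)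
          ultimately show ?thesis using abs_triangle_ineq by metis
        qed
        also have "\<dots> \<le> ?l * e" using 1 2 by simp
        finally show "?z + ?l *\<^sub>R x \<in> ball x0 r \<and> \<bar>\<rho> (?z + ?l *\<^sub>R x) - ?l * ((\<xi> + x) \<bullet> g)\<bar> \<le> ?l * e"
          unfolding eq using zd d(2) by auto
      qed
    qed
  qed
  \<comment> \<open>The limit set, where (\<xi> + x) \<bullet> g < 0, is the half-space t < x
    \<bullet> \<nu> with \<nu> = - g.\<close>
  define t where "t = \<xi> \<bullet> g"
  have inn: "(\<xi> + x) \<bullet> g = t - x \<bullet> (- g)" for x by (simp add: t_def inner_left_distrib)
  show ?thesis
  proof (intro exI conjI allI impI)
    show "strict_mono \<sigma>" by fact
    show "- g \<noteq> 0" using g0 by simp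
  next
    fix x assume x: "x \<bullet> (- g) < t"
    define e where "e = (t - x \<bullet> (- g)) / 2"
    have e: "e > 0" "t - x \<bullet> (- g) = 2 * e" using x by (auto simp: e_def)
    show "eventually (\<lambda>n. z (\<sigma> n) + l (\<sigma> n) *\<^sub>R x \<notin> \<Omega>) sequentially"
      using main[OF e(1), of "norm x"]
    proof eventually_elim
      case (elim n)
      then have b: "z (\<sigma> n) + l (\<sigma> n) *\<^sub>R x \<in> ball x0 r"
        "\<bar>\<rho> (z (\<sigma> n) + l (\<sigma> n) *\<^sub>R x) - l (\<sigma> n) * (2 * e)\<bar> \<le> l (\<sigma> n) * e"
        unfolding e(2)[symmetric] inn[symmetric] by blast+
      moreover have "0 < l (\<sigma> n) * e" using l(1) e by simp
      ultimately have "0 < \<rho> (z (\<sigma> n) + l (\<sigma> n) *\<^sub>R x)" by (simp add: abs_le_iff algebra_simps)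
      moreover have "\<rho> (z (\<sigma> n) + l (\<sigma> n) *\<^sub>R x) < 0" if "z (\<sigma> n) + l (\<sigma> n) *\<^sub>R x \<in> \<Omega>"
        using that b(1) \<Omega>r by blast
      ultimately show ?case by (meson order_less_asym)
    qed
  next
    fix B \<eta> :: real assume \<eta>: "0 < \<eta>"
    then have e: "0 < \<eta> / 2" by simp
    show "eventually (\<lambda>n. \<forall>x. norm x \<le> B \<and> t + \<eta> \<le> x \<bullet> (- g) \<longrightarrow> z (\<sigma> n) + l (\<sigma> n) *\<^sub>R x \<in> \<Omega>) sequentially"
      using main[OF e, of B]
    proof (eventually_elim, intro allI impI, elim conjE)
      fix n and x :: 'a
      assume H: "\<forall>x. norm x \<le> B \<longrightarrow> z (\<sigma> n) + l (\<sigma> n) *\<^sub>R x \<in> ball x0 r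
        \<and> \<bar>\<rho> (z (\<sigma> n) + l (\<sigma> n) *\<^sub>R x) - l (\<sigma> n) * ((\<xi> + x) \<bullet> g)\<bar> \<le> l (\<sigma> n) * (\<eta> / 2)"
        and x: "norm x \<le> B" "t + \<eta> \<le> x \<bullet> (- g)"
      have b: "z (\<sigma> n) + l (\<sigma> n) *\<^sub>R x \<in> ball x0 r"
        "\<bar>\<rho> (z (\<sigma> n) + l (\<sigma> n) *\<^sub>R x) - l (\<sigma> n) * ((\<xi> + x) \<bullet> g)\<bar> \<le> l (\<sigma> n) * (\<eta> / 2)" using H x by auto
      have "l (\<sigma> n) * ((\<xi> + x) \<bullet> g) \<le> l (\<sigma> n) * (- \<eta>)"
        unfolding inn using x(2) l(1)[of "\<sigma> n"] by (intro mult_left_mono) auto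
      moreover have "0 < l (\<sigma> n) * (\<eta> / 2)" using l(1) \<eta> by simp
      moreover have "l (\<sigma> n) * (- \<eta>) = - 2 * (l (\<sigma> n) * (\<eta> / 2))" by simp
      ultimately have "\<rho> (z (\<sigma> n) + l (\<sigma> n) *\<^sub>R x) < 0" using b(2)[unfolded abs_le_iff] by linarith
      then show "z (\<sigma> n) + l (\<sigma> n) *\<^sub>R x \<in> \<Omega>" using b(1) \<Omega>r by blast
    qed
  qed
qed

section \<open>Cut-offs and test functions\<close>

context fractional
begin

text \<open>Integrated over x this is \<open>Dx (cutoff R) y\<close>, the p-th power of the nonlocal
  gradient of the cut-off at y.\<close>

definition ker :: "real \<Rightarrow> 'a \<Rightarrow> 'a \<Rightarrow> real" where
  "ker R y x = \<bar>cutoff R x - cutoff R y\<bar> powr p / norm (x - y) powr (N + s * p)"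

lemma ker_measurable [measurable]: "ker R y \<in> borel_measurable borel"
  unfolding ker_def[abs_def] by measurable

lemma ker_scale:
  assumes R: "0 < R"
  shows "(\<integral>\<^sup>+x. ennreal (ker R y x) \<partial>lborel) = ennreal (R powr (- (s * p))) * (\<integral>\<^sup>+x. ennreal (ker 1 ((1 / R) *\<^sub>R y) x) \<partial>lborel)"
proof -
  have e: "ker R y (0 + R *\<^sub>R x) = R powr (- (N + s * p)) * ker 1 ((1 / R) *\<^sub>R y) x" for x
  proof -
    have "R *\<^sub>R x - y = R *\<^sub>R (x - (1 / R) *\<^sub>R y)" using R by (simp add: scaleR_diff_right)
    then have "norm (R *\<^sub>R x - y) powr (N + s * p) = R powr (N + s * p) * norm (x - (1 / R) *\<^sub>R y) powr (N + s * p)"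
      using R by (simp add: powr_mult)
    moreover have "cutoff R (R *\<^sub>R x) = cutoff 1 x" "cutoff R y = cutoff 1 ((1 / R) *\<^sub>R y)" using R by (auto simp: cutoff_def)
    ultimately show ?thesis unfolding ker_def powr_minus_divide by simp
  qed
  have "(\<integral>\<^sup>+x. ennreal (ker R y x) \<partial>lborel)
      = ennreal (R powr real DIM('a)) * (\<integral>\<^sup>+x. ennreal (ker R y (0 + R *\<^sub>R x)) \<partial>lborel)"
    by (rule nn_integral_affine[OF _ R]) simp
  also have "\<dots> = ennreal (R powr N) * (\<integral>\<^sup>+x. ennreal (R powr (- (N + s * p))) * ennreal (ker 1 ((1 / R) *\<^sub>R y) x) \<partial>lborel)"
    by (simp only: e ennreal_mult'[OF powr_ge_zero] N_def[symmetric])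
  also have "\<dots> = ennreal (R powr N) * (ennreal (R powr (- (N + s * p))) * (\<integral>\<^sup>+x. ennreal (ker 1 ((1 / R) *\<^sub>R y) x) \<partial>lborel))"
    by (subst nn_integral_cmult) simp_all
  also have "\<dots> = ennreal (R powr N * R powr (- (N + s * p))) * (\<integral>\<^sup>+x. ennreal (ker 1 ((1 / R) *\<^sub>R y) x) \<partial>lborel)"
    by (simp only: ennreal_mult' powr_ge_zero mult.assoc)
  also have "R powr N * R powr (- (N + s * p)) = R powr (- (s * p))" by (simp flip: powr_add)
  finally show ?thesis .
qed

text \<open>For short differences h the Lipschitz bound gives |h|^(p - N - s p), integrable near 0
  since s < 1; for long ones the bound 1 gives |h|^(-N - s p), integrable at infinity.\<close>

lemma ker_bounded: "\<exists>K\<ge>0. \<forall>y. (\<integral>\<^sup>+x. ennreal (ker 1 y x) \<partial>lborel) \<le> ennreal K"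
proof -
  define f where "f h = ennreal (indicator {x. 1 \<le> norm x} h * norm h powr (- (N + s * p)))" for h :: 'a
  define g where "g h = ennreal (indicator {x. norm x < 1} h * norm h powr (- (N + s * p - p)))" for h :: 'a
  have [measurable]: "f \<in> borel_measurable borel" "g \<in> borel_measurable borel"
    unfolding f_def[abs_def] g_def[abs_def] by measurable
  have "(\<integral>\<^sup>+h. f h \<partial>lborel) < \<infinity>" unfolding f_def
    using sp0 by (intro nn_integral_powr_at_infinity) (simp add: N_def)
  moreover have "(\<integral>\<^sup>+h. g h \<partial>lborel) < \<infinity>" unfolding g_def
    using s1 p0 by (intro nn_integral_powr_at_zero) (simp add: N_def)
  ultimately have "(\<integral>\<^sup>+h. f h + g h \<partial>lborel) < \<infinity>" by (simp add: nn_integral_add)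
  then obtain K where K: "(\<integral>\<^sup>+h. f h + g h \<partial>lborel) = ennreal K" "0 \<le> K"
    by (cases "\<integral>\<^sup>+h. f h + g h \<partial>lborel") auto
  have le: "ennreal (ker 1 y (y + h)) \<le> f h + g h" for y h
  proof (cases "h = 0")
    case False
    have c: "\<bar>cutoff 1 (y + h) - cutoff 1 y\<bar> \<le> min 1 (norm h)" using cutoff_Lipschitz[of 1 "y + h" y] by simp
    show ?thesis
    proof (cases "1 \<le> norm h")
      case True
      have "\<bar>cutoff 1 (y + h) - cutoff 1 y\<bar> powr p \<le> 1 powr p" using c p0 by (intro powr_mono2) auto
      then have "ker 1 y (y + h) \<le> 1 / norm h powr (N + s * p)"
        by (simp add: ker_def divide_right_mono)
      also have "\<dots> = norm h powr (- (N + s * p))" by (simp only: powr_minus_divide)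
      finally have "ker 1 y (y + h) \<le> norm h powr (- (N + s * p))" .
      then show ?thesis using True by (simp add: f_def g_def ennreal_leI)
    next
      case F: False
      have "\<bar>cutoff 1 (y + h) - cutoff 1 y\<bar> powr p \<le> norm h powr p" using c p0 by (intro powr_mono2) auto
      then have "ker 1 y (y + h) \<le> norm h powr p / norm h powr (N + s * p)"
        by (simp add: ker_def divide_right_mono)
      also have "\<dots> = norm h powr (- (N + s * p - p))" by (simp flip: powr_diff)
      finally show ?thesis using F by (simp add: f_def g_def ennreal_leI)
    qed
  qed (use p0 in \<open>simp add: ker_def\<close>)
  have "(\<integral>\<^sup>+x. ennreal (ker 1 y x) \<partial>lborel) \<le> ennreal K" for y
  proof -
    have "(\<integral>\<^sup>+x. ennreal (ker 1 y x) \<partial>lborel) = (\<integral>\<^sup>+h. ennreal (ker 1 y (y + 1 *\<^sub>R h)) \<partial>lborel)"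
      by (subst nn_integral_affine[of _ 1 y]) simp_all
    also have "\<dots> \<le> (\<integral>\<^sup>+h. f h + g h \<partial>lborel)" using le by (intro nn_integral_mono) simp
    finally show ?thesis using K by simp
  qed
  then show ?thesis using K(2) by blast
qed

text \<open>For |y| \<ge> 4 the cut-off vanishes at y, so only x with |x| < 2 contribute, and for
  these |x - y| \<ge> |y| / 2.\<close>

lemma ker_decay: "\<exists>K\<ge>0. \<forall>y. 4 \<le> norm y \<longrightarrow> (\<integral>\<^sup>+x. ennreal (ker 1 y x) \<partial>lborel) \<le> ennreal (K * norm y powr (- (N + s * p)))"
proof (intro exI conjI allI impI)
  let ?K = "vol * 3 powr N * 2 powr (N + s * p)"
  show "0 \<le> ?K" using vol0 by simp
  fix y :: 'a assume y: "4 \<le> norm y"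
  have "ennreal (ker 1 y x) \<le> ennreal (2 powr (N + s * p) * norm y powr (- (N + s * p))) * indicator (ball 0 3) x" for x
  proof (cases "norm x < 2")
    case True
    have cy: "cutoff 1 y = 0" using y by (intro cutoff_eq_0) auto
    have n: "norm y / 2 \<le> norm (x - y)"
      using norm_triangle_ineq2[of y x] True y by (simp add: norm_minus_commute)
    have "ker 1 y x \<le> 1 / norm (x - y) powr (N + s * p)"
      unfolding ker_def cy using cutoff_bounds[of 1 x] p0 powr_mono2[of p "cutoff 1 x" 1] by (intro divide_right_mono) auto
    also have "\<dots> = norm (x - y) powr (- (N + s * p))" by (simp only: powr_minus_divide)
    also have "\<dots> \<le> (norm y / 2) powr (- (N + s * p))"
      using n y N0 sp0 by (intro powr_mono2') auto
    also have "\<dots> = 2 powr (N + s * p) * norm y powr (- (N + s * p))" by (simp only: powr_minus_divide powr_divide norm_ge_zero zero_le_numeral) simp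
    finally show ?thesis using True by (simp add: ennreal_leI)
  next
    case False
    then have "cutoff 1 y = 0" "cutoff 1 x = 0" using y by (auto intro!: cutoff_eq_0)
    then show ?thesis using p0 by (simp add: ker_def)
  qed
  then have "(\<integral>\<^sup>+x. ennreal (ker 1 y x) \<partial>lborel)
      \<le> (\<integral>\<^sup>+x. ennreal (2 powr (N + s * p) * norm y powr (- (N + s * p))) * indicator (ball (0::'a) 3) x \<partial>lborel)"
    by (rule nn_integral_mono)
  also have "\<dots> = ennreal (2 powr (N + s * p) * norm y powr (- (N + s * p))) * ennreal (vol * 3 powr N)"
    using emeasure_ball_N[of 3 "0::'a"] by (subst nn_integral_cmult_indicator) auto
  also have "\<dots> = ennreal (?K * norm y powr (- (N + s * p)))"
    using vol0 by (simp add: ennreal_mult'[symmetric] mult_ac)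
  finally show "(\<integral>\<^sup>+x. ennreal (ker 1 y x) \<partial>lborel) \<le> ennreal (?K * norm y powr (- (N + s * p)))" .
qed

text \<open>Bound, decay and scaling collected in one function b. Its integrability exponent N / (s
  p) is conjugate to q / p, the exponent in which |w|^p is integrable, and the rescaling with factor
  R^(-s p) on the right is an isometry of that space.\<close>

lemma ker_majorant:
  "\<exists>b K. Lq (N / (s * p)) lborel b \<and> (\<forall>y. 0 \<le> b y \<and> b y \<le> K) \<and>
    (\<forall>R>0. \<forall>y. (\<integral>\<^sup>+x. ennreal (ker R y x) \<partial>lborel) \<le> ennreal (R powr (- (s * p)) * b ((1 / R) *\<^sub>R y)))"
proof -
  obtain K1 where K1: "K1 \<ge> 0" "\<And>y. (\<integral>\<^sup>+x. ennreal (ker 1 y x) \<partial>lborel) \<le> ennreal K1"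
    using ker_bounded by auto
  obtain K2 where K2: "K2 \<ge> 0"
    "\<And>y. 4 \<le> norm y \<Longrightarrow> (\<integral>\<^sup>+x. ennreal (ker 1 y x) \<partial>lborel) \<le> ennreal (K2 * norm y powr (- (N + s * p)))"
    using ker_decay by auto
  define m where "m = N / (s * p)"
  have m: "1 < m" using sp sp0 by (simp add: m_def)
  define b where "b y = (if norm y < 4 then K1 else K2 * norm y powr (- (N + s * p)))" for y :: 'a
  have bm [measurable]: "b \<in> borel_measurable borel" unfolding b_def[abs_def] by measurable
  have b0: "0 \<le> b y" for y using K1 K2 by (simp add: b_def)
  have bK: "b y \<le> K1 + K2" for y
  proof (cases "norm y < 4")
    case False
    then have "norm y powr (- (N + s * p)) \<le> 1 powr (- (N + s * p))"
      using N0 sp0 by (intro powr_mono2') auto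
    then have "K2 * norm y powr (- (N + s * p)) \<le> K2 * 1" using K2 by (intro mult_left_mono) auto
    then show ?thesis using False K1 by (simp add: b_def)
  qed (use K2 in \<open>simp add: b_def\<close>)
  define \<beta> where "\<beta> = (N + s * p) * m"
  have \<beta>: "real DIM('a) < \<beta>"
  proof -
    have "N * 1 < (N + s * p) * m" using m N0 sp0 by (intro mult_strict_mono) auto
    then show ?thesis by (simp add: \<beta>_def N_def)
  qed
  define h where "h y = indicator {x. 1 \<le> norm x} y * norm y powr (- \<beta>)" for y :: 'a
  have [measurable]: "h \<in> borel_measurable borel" unfolding h_def[abs_def] by measurable
  have "integrable lborel h"
    unfolding integrable_iff_bounded using nn_integral_powr_at_infinity[OF \<beta>]
    by (simp add: h_def abs_mult)
  moreover have "integrable lborel (indicator (ball 0 4) :: 'a \<Rightarrow> real)"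
    by (rule integrable_real_indicator) (use emeasure_bounded_finite[OF bounded_ball, of "0::'a" 4] in auto)
  ultimately have int: "integrable lborel (\<lambda>y. K1 powr m * indicator (ball 0 4) y + K2 powr m * h y)" by simp
  have "\<bar>b y\<bar> powr m \<le> K1 powr m * indicator (ball 0 4) y + K2 powr m * h y" for y
  proof (cases "norm y < 4")
    case True
    then show ?thesis using K1 by (simp add: b_def h_def)
  next
    case False
    then have "\<bar>b y\<bar> powr m = (K2 * norm y powr (- (N + s * p))) powr m"
      using K2(1) by (simp add: b_def)
    also have "\<dots> = K2 powr m * norm y powr (- (N + s * p) * m)"
      by (simp only: powr_mult powr_powr K2(1) powr_ge_zero)
    also have "- (N + s * p) * m = - \<beta>" by (simp add: \<beta>_def algebra_simps)
    finally show ?thesis using False by (simp add: h_def)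
  qed
  then have bL: "Lq m lborel b" by (intro Lq_dominated(1)[OF int]) auto
  have k1: "(\<integral>\<^sup>+x. ennreal (ker 1 y x) \<partial>lborel) \<le> ennreal (b y)" for y
    using K1(2)[of y] K2(2)[of y] by (simp add: b_def)
  have "(\<integral>\<^sup>+x. ennreal (ker R y x) \<partial>lborel) \<le> ennreal (R powr (- (s * p)) * b ((1 / R) *\<^sub>R y))" if "0 < R" for R y
    unfolding ker_scale[OF that] using mult_left_mono[OF k1, of "ennreal (R powr (- (s * p)))"]
    by (simp add: ennreal_mult')
  then show ?thesis using bL b0 bK unfolding m_def by blast
qed

text \<open>The map \<pi> lets the same argument serve functions of one variable (\<pi> the
  identity) and functions of pairs (\<pi> = \<open>fst\<close>).\<close>

lemma Lint_cut_tendsto: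
  fixes f :: "'b \<Rightarrow> real" and \<pi> :: "'b \<Rightarrow> 'a"
  assumes r: "0 < r" and f: "Lq r M f" and \<pi> [measurable]: "\<pi> \<in> borel_measurable M"
    and \<rho>: "filterlim \<rho> at_top sequentially"
  shows "Lq r M (\<lambda>x. (1 - cutoff (\<rho> n) (\<pi> x)) * f x)"
    "(\<lambda>n. Lint r M (\<lambda>x. (1 - cutoff (\<rho> n) (\<pi> x)) * f x)) \<longlonglongrightarrow> 0"
proof -
  have [measurable]: "f \<in> borel_measurable M" using f by (rule Lq_measurable)
  have b: "\<bar>(1 - cutoff (\<rho> n) (\<pi> x)) * f x\<bar> \<le> \<bar>f x\<bar>" for n x
    unfolding abs_mult using cutoff_bounds(3)[of "\<rho> n" "\<pi> x"] by (simp add: mult_left_le_one_le)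
  show "Lq r M (\<lambda>x. (1 - cutoff (\<rho> n) (\<pi> x)) * f x)"
    by (rule Lq_bound(1)[OF r f]) (use b in auto)
  have lim: "(\<lambda>n. \<bar>(1 - cutoff (\<rho> n) (\<pi> x)) * f x\<bar> powr r) \<longlonglongrightarrow> 0" for x
  proof -
    have "(\<lambda>n. \<bar>(1 - cutoff (\<rho> n) (\<pi> x)) * f x\<bar> powr r) \<longlonglongrightarrow> \<bar>(1 - 1) * f x\<bar> powr r"
      using r by (intro tendsto_powr2 tendsto_rabs tendsto_mult tendsto_diff tendsto_const cutoff_tendsto_1 \<rho>) auto
    then show ?thesis using r by simp
  qed
  have "(\<lambda>n. \<integral>x. \<bar>(1 - cutoff (\<rho> n) (\<pi> x)) * f x\<bar> powr r \<partial>M) \<longlonglongrightarrow> (\<integral>x. 0 \<partial>M)"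
  proof (rule integral_dominated_convergence[OF _ _ Lq_integrable[OF f]])
    show "AE x in M. (\<lambda>n. \<bar>(1 - cutoff (\<rho> n) (\<pi> x)) * f x\<bar> powr r) \<longlonglongrightarrow> 0"
      by (intro AE_I2 lim)
    show "AE x in M. norm (\<bar>(1 - cutoff (\<rho> n) (\<pi> x)) * f x\<bar> powr r) \<le> \<bar>f x\<bar> powr r" for n
      unfolding real_norm_def abs_of_nonneg[OF powr_ge_zero] using r by (intro AE_I2 powr_mono2 b) auto
  qed auto
  then show "(\<lambda>n. Lint r M (\<lambda>x. (1 - cutoff (\<rho> n) (\<pi> x)) * f x)) \<longlonglongrightarrow> 0" by (simp add: Lint_def)
qed

text \<open>The term in which the difference falls on the cut-off. Functions in \<open>Dsp\<close>
  need not lie in L^p, so R^(-s p) times an L^p norm of w is no bound. Instead |w|^p, which lies in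
  L^(q / p), is paired with the rescaled majorants g n, which are bounded in the conjugate space and
  tend to 0 pointwise.\<close>

lemma cutoff_commutator:
  assumes w: "Dsp s p (w :: 'a \<Rightarrow> real)" and \<rho>0: "\<And>n. 0 < \<rho> n" and \<rho>: "filterlim \<rho> at_top sequentially"
  shows "Lq p lborel (\<lambda>z. w (snd z) * G (cutoff (\<rho> n)) z)"
    "(\<lambda>n. Lint p lborel (\<lambda>z. w (snd z) * G (cutoff (\<rho> n)) z)) \<longlonglongrightarrow> 0"
proof -
  have [measurable]: "w \<in> borel_measurable borel" using w by (rule Dsp_measurable)
  obtain b K where bb: "Lq (N / (s * p)) lborel b" "\<forall>y. 0 \<le> b y \<and> b y \<le> K"
    "\<forall>R>0. \<forall>y. (\<integral>\<^sup>+x. ennreal (ker R y x) \<partial>lborel) \<le> ennreal (R powr (- (s * p)) * b ((1 / R) *\<^sub>R y))"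
    using ker_majorant by blast
  have b: "0 \<le> b y" "b y \<le> K" for y using bb(2) by auto
  have kb: "(\<integral>\<^sup>+x. ennreal (ker R y x) \<partial>lborel) \<le> ennreal (R powr (- (s * p)) * b ((1 / R) *\<^sub>R y))"
    if "0 < R" for R y using bb(3) that by blast
  define m where "m = N / (s * p)"
  have m: "1 < m" "0 < m" using sp sp0 by (auto simp: m_def)
  have bL: "Lq m lborel b" using bb(1) by (simp add: m_def)
  have [measurable]: "b \<in> borel_measurable borel" using bL by (simp add: Lq_def)
  define g where "g n = rsc m 0 (1 / \<rho> n) b" for n
  have gL: "Lq m lborel (g n)" "Lint m lborel (g n) = Lint m lborel b" for n
    unfolding g_def using Lq_rsc[OF m(2) _ bL] \<rho>0 by auto
  have g_eq: "g n y = \<rho> n powr (- (s * p)) * b ((1 / \<rho> n) *\<^sub>R y)" for n y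
    using \<rho>0[of n] sp0 N0 by (simp add: g_def rsc_def m_def powr_divide powr_minus_divide flip: N_def)
  have g0: "(\<lambda>n. g n y) \<longlonglongrightarrow> 0" for y
  proof (rule Lim_null_comparison)
    have "(\<lambda>n. \<rho> n powr (- (s * p))) \<longlonglongrightarrow> 0" using sp0 \<rho> by (intro tendsto_neg_powr) auto
    then show "(\<lambda>n. \<rho> n powr (- (s * p)) * K) \<longlonglongrightarrow> 0" by (rule tendsto_mult_left_zero)
    show "eventually (\<lambda>n. norm (g n y) \<le> \<rho> n powr (- (s * p)) * K) sequentially"
      unfolding g_eq using b by (intro always_eventually allI) (simp add: abs_mult mult_left_mono)
  qed
  define f where "f y = \<bar>w y\<bar> powr p" for y
  have fL: "Lq (q / p) lborel f"
    using DspD(1)[OF w] p0 unfolding Lq_def f_def by (auto simp: powr_powr)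
  have conj: "1 / m + 1 / (q / p) = 1" using sp0 N0 Nsp p0 by (simp add: m_def q_def pstar_def field_simps)
  have qp: "1 < q / p" using p_less_q p0 by simp
  have "(\<lambda>n. \<integral>y. g n y * f y \<partial>lborel) \<longlonglongrightarrow> (\<integral>y. 0 * f y \<partial>lborel)"
    by (rule Lq_weak_limit(2)[OF m(1) qp conj gL(1) eq_refl[OF gL(2)] _ _ fL]) (use g0 in auto)
  then have lim: "(\<lambda>n. \<integral>y. g n y * f y \<partial>lborel) \<longlonglongrightarrow> 0" by simp
  have int: "integrable lborel (\<lambda>y. g n y * f y)" for n by (rule Holder(1)[OF m(1) qp conj gL(1) fL])
  have gf0: "0 \<le> g n y * f y" for n y using b(1) by (simp add: g_eq f_def)
  define S where "S n z = w (snd z) * G (cutoff (\<rho> n)) z" for n z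
  have Sm [measurable]: "S n \<in> borel_measurable borel" for n
  proof -
    have "S n \<in> borel_measurable (borel \<Otimes>\<^sub>M borel)" unfolding S_def[abs_def] G_def by measurable
    then show ?thesis by (simp add: borel_prod)
  qed
  have Sk: "ennreal (\<bar>S n (x, y)\<bar> powr p) = ennreal (f y) * ennreal (ker (\<rho> n) y x)" for n x y
    using p0 by (simp add: S_def f_def ker_def abs_mult powr_mult abs_G_powr ennreal_mult'[symmetric])
  have "(\<integral>\<^sup>+z. ennreal (\<bar>S n z\<bar> powr p) \<partial>lborel) \<le> ennreal (\<integral>y. g n y * f y \<partial>lborel)" for n
  proof -
    have "(\<lambda>z. ennreal (\<bar>S n z\<bar> powr p)) \<in> borel_measurable (lborel \<Otimes>\<^sub>M lborel)"
      unfolding lborel_prod by simp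
    then have "(\<lambda>(x, y). ennreal (\<bar>S n (x, y)\<bar> powr p)) \<in> borel_measurable (lborel \<Otimes>\<^sub>M lborel)" by simp
    from lborel_pair.nn_integral_snd[OF this]
    have "(\<integral>\<^sup>+z. ennreal (\<bar>S n z\<bar> powr p) \<partial>lborel) = (\<integral>\<^sup>+y. (\<integral>\<^sup>+x. ennreal (\<bar>S n (x, y)\<bar> powr p) \<partial>lborel) \<partial>lborel)"
      unfolding lborel_prod by (simp add: case_prod_beta')
    also have "\<dots> = (\<integral>\<^sup>+y. ennreal (f y) * (\<integral>\<^sup>+x. ennreal (ker (\<rho> n) y x) \<partial>lborel) \<partial>lborel)"
      unfolding Sk by (simp add: nn_integral_cmult)
    also have "\<dots> \<le> (\<integral>\<^sup>+y. ennreal (f y) * ennreal (g n y) \<partial>lborel)"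
      unfolding g_eq by (intro nn_integral_mono mult_left_mono kb \<rho>0) auto
    also have "\<dots> = (\<integral>\<^sup>+y. ennreal (g n y * f y) \<partial>lborel)"
      by (subst mult.commute) (simp add: f_def ennreal_mult''[symmetric])
    also have "\<dots> = ennreal (\<integral>y. g n y * f y \<partial>lborel)"
      by (rule nn_integral_eq_integral[OF int]) (simp add: gf0)
    finally show ?thesis .
  qed
  then have SL: "Lq p lborel (S n)" "Lint p lborel (S n) \<le> (\<integral>y. g n y * f y \<partial>lborel)" for n
    using Lq_of_nn_le[of "S n" lborel p "\<integral>y. g n y * f y \<partial>lborel"] gf0 by auto
  show "Lq p lborel (\<lambda>z. w (snd z) * G (cutoff (\<rho> n)) z)" using SL(1) by (simp add: S_def[abs_def])
  have "(\<lambda>n. Lint p lborel (S n)) \<longlonglongrightarrow> 0"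
    by (rule Lim_null_comparison[OF _ lim]) (use SL(2) in auto)
  then show "(\<lambda>n. Lint p lborel (\<lambda>z. w (snd z) * G (cutoff (\<rho> n)) z)) \<longlonglongrightarrow> 0" by (simp add: S_def[abs_def])
qed

lemma cutoff_strong:
  assumes w: "Dsp s p (w :: 'a \<Rightarrow> real)" and \<rho>0: "\<And>n. 0 < \<rho> n" and \<rho>: "filterlim \<rho> at_top sequentially"
  shows "Dsp s p (\<lambda>x. cutoff (\<rho> n) x * w x)"
    "(\<lambda>n. gagp s p (\<lambda>x. w x - cutoff (\<rho> n) x * w x)) \<longlonglongrightarrow> 0"
    "(\<lambda>n. Lint q lborel (\<lambda>x. w x - cutoff (\<rho> n) x * w x)) \<longlonglongrightarrow> 0"
proof -
  define e where "e n x = w x - cutoff (\<rho> n) x * w x" for n x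
  have e_eq: "e n = (\<lambda>x. (1 - cutoff (\<rho> n) x) * w x)" for n by (simp add: e_def fun_eq_iff left_diff_distrib)
  \<comment> \<open>Product rule for differences: the cut-off is frozen at the first variable and w
    at the second.\<close>
  have Ge: "G (e n) = (\<lambda>z. (1 - cutoff (\<rho> n) (fst z)) * G w z - w (snd z) * G (cutoff (\<rho> n)) z)" for n
    by (simp add: e_def G_def fun_eq_iff add_divide_distrib diff_divide_distrib algebra_simps)
  have fm: "fst \<in> borel_measurable (lborel :: ('a \<times> 'a) measure)"
  proof -
    have "(fst :: 'a \<times> 'a \<Rightarrow> 'a) \<in> borel_measurable (borel \<Otimes>\<^sub>M borel)" by measurable
    then show ?thesis by (simp add: borel_prod)
  qed
  note A = Lint_cut_tendsto[OF p0 DspD(2)[OF w] fm \<rho>]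
  note B = cutoff_commutator[OF w \<rho>0 \<rho>]
  have id: "(\<lambda>x::'a. x) \<in> borel_measurable lborel" by simp
  note C = Lint_cut_tendsto[OF q0 DspD(1)[OF w] id \<rho>]
  have eD: "Dsp s p (e n)" for n
    unfolding Dsp_iff Ge using C(1) by (auto simp: e_eq intro: Lq_diff(1) p0 A(1) B(1))
  have "Dsp s p (\<lambda>x. w x - e n x)" by (rule Dsp_diff(1)[OF w eD])
  then show "Dsp s p (\<lambda>x. cutoff (\<rho> n) x * w x)" by (simp add: e_def)
  show "(\<lambda>n. Lint q lborel (\<lambda>x. w x - cutoff (\<rho> n) x * w x)) \<longlonglongrightarrow> 0"
    using C(2) by (simp add: left_diff_distrib)
  have "(\<lambda>n. gagp s p (e n)) \<longlonglongrightarrow> 0"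
  proof (rule Lim_null_comparison)
    have "(\<lambda>n. 2 powr p * (Lint p lborel (\<lambda>z. (1 - cutoff (\<rho> n) (fst z)) * G w z)
        + Lint p lborel (\<lambda>z. w (snd z) * G (cutoff (\<rho> n)) z))) \<longlonglongrightarrow> 2 powr p * (0 + 0)"
      by (intro tendsto_mult tendsto_add tendsto_const A(2) B(2))
    then show "(\<lambda>n. 2 powr p * (Lint p lborel (\<lambda>z. (1 - cutoff (\<rho> n) (fst z)) * G w z)
        + Lint p lborel (\<lambda>z. w (snd z) * G (cutoff (\<rho> n)) z))) \<longlonglongrightarrow> 0" by simp
    show "eventually (\<lambda>n. norm (gagp s p (e n)) \<le> 2 powr p * (Lint p lborel (\<lambda>z. (1 - cutoff (\<rho> n) (fst z)) * G w z)
        + Lint p lborel (\<lambda>z. w (snd z) * G (cutoff (\<rho> n)) z))) sequentially"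
      unfolding gagp_eq[OF eD] Ge real_norm_def abs_of_nonneg[OF Lint_nonneg]
      by (intro always_eventually allI Lq_diff(2) p0 A(1) B(1))
  qed
  then show "(\<lambda>n. gagp s p (\<lambda>x. w x - cutoff (\<rho> n) x * w x)) \<longlonglongrightarrow> 0" by (simp add: e_def[abs_def])
qed

text \<open>With \<open>\<nu> = 0\<close> and \<open>t < 0\<close> the half-space is the whole space.\<close>

lemma WF_eq_0_of_compact_tests:
  assumes w: "Dsp s p (w :: 'a \<Rightarrow> real)" and \<nu>: "\<nu> \<noteq> 0 \<or> t < 0"
    and tests: "\<And>\<phi> B \<eta>. 0 < \<eta> \<Longrightarrow> Dsp s p \<phi> \<Longrightarrow> (AE x in lborel. \<phi> x \<noteq> 0 \<longrightarrow> norm x \<le> B \<and> t + \<eta> \<le> x \<bullet> \<nu>) \<Longrightarrow> WF \<mu> w \<phi> = 0"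
    and \<phi>: "Dsp0 s p {x. t < x \<bullet> \<nu>} \<phi>"
  shows "WF \<mu> w \<phi> = 0"
proof -
  \<comment> \<open>First reduction: a test function whose support keeps the margin \<eta> is the
    limit of its cut-offs, so the bound B on the support can be removed.\<close>
  have 1: "WF \<mu> w \<psi> = 0" if \<eta>: "0 < \<eta>" and \<psi>: "Dsp s p \<psi>" and supp: "AE x in lborel. \<psi> x \<noteq> 0 \<longrightarrow> t + \<eta> \<le> x \<bullet> \<nu>" for \<psi> \<eta>
  proof -
    define \<rho> where "\<rho> n = real (Suc n)" for n
    have \<rho>0: "0 < \<rho> n" for n by (simp add: \<rho>_def)
    have \<rho>: "filterlim \<rho> at_top sequentially"
      unfolding \<rho>_def by (rule filterlim_compose[OF filterlim_real_sequentially filterlim_Suc])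
    note C = cutoff_strong[OF \<psi> \<rho>0 \<rho>]
    have z: "WF \<mu> w (\<lambda>x. cutoff (\<rho> n) x * \<psi> x) = 0" for n
    proof (rule tests[OF \<eta> C(1)])
      show "AE x in lborel. cutoff (\<rho> n) x * \<psi> x \<noteq> 0 \<longrightarrow> norm x \<le> 2 * \<rho> n \<and> t + \<eta> \<le> x \<bullet> \<nu>"
        using supp
      proof eventually_elim
        case (elim x)
        then show ?case using cutoff_eq_0[OF \<rho>0, of n x] by (cases "norm x \<le> 2 * \<rho> n") auto
      qed
    qed
    obtain K where K: "\<And>n. gagp s p (\<lambda>x. \<psi> x - cutoff (\<rho> n) x * \<psi> x) \<le> K"
    proof -
      have "Bseq (\<lambda>n. gagp s p (\<lambda>x. \<psi> x - cutoff (\<rho> n) x * \<psi> x))"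
        using C(2) by (intro convergent_imp_Bseq convergentI)
      then obtain K where K: "\<forall>n. norm (gagp s p (\<lambda>x. \<psi> x - cutoff (\<rho> n) x * \<psi> x)) \<le> K" by (rule BseqE) blast
      show ?thesis by (rule that[of K]) (use K in auto)
    qed
    have bd: "gagp s p (\<lambda>x. cutoff (\<rho> n) x * \<psi> x) \<le> 2 powr p * (gagp s p \<psi> + K)" for n
    proof -
      have "gagp s p (\<lambda>x. \<psi> x - (\<psi> x - cutoff (\<rho> n) x * \<psi> x)) \<le> 2 powr p * (gagp s p \<psi> + gagp s p (\<lambda>x. \<psi> x - cutoff (\<rho> n) x * \<psi> x))"
        by (intro Dsp_diff(2) Dsp_diff(1) \<psi> C(1))
      also have "\<dots> \<le> 2 powr p * (gagp s p \<psi> + K)" using K by (intro mult_left_mono add_left_mono) auto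
      finally show ?thesis by simp
    qed
    have "(\<lambda>n. WF \<mu> w (\<lambda>x. cutoff (\<rho> n) x * \<psi> x)) \<longlonglongrightarrow> WF \<mu> w \<psi>"
    proof (rule WF_limit_test[OF C(1) bd _ _ w])
      have "(\<lambda>n. cutoff (\<rho> n) x * \<psi> x) \<longlonglongrightarrow> 1 * \<psi> x" for x
        by (intro tendsto_mult tendsto_const cutoff_tendsto_1 \<rho>)
      then show "AE x in lborel. (\<lambda>n. cutoff (\<rho> n) x * \<psi> x) \<longlonglongrightarrow> \<psi> x" by simp
      show "\<psi> \<in> borel_measurable borel" using \<psi> by (rule Dsp_measurable)
    qed
    then show ?thesis unfolding z using LIMSEQ_unique tendsto_const by blast
  qed
  have \<phi>D: "Dsp s p \<phi>" and supp: "AE x in lborel. \<phi> x \<noteq> 0 \<longrightarrow> t < x \<bullet> \<nu>"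
    using \<phi> by (auto simp: Dsp0_def)
  have m [measurable]: "\<phi> \<in> borel_measurable borel" using \<phi>D by (rule Dsp_measurable)
  show ?thesis
  proof (cases "\<nu> = 0")
    case True
    then have "t < 0" using \<nu> by simp
    then show ?thesis using True by (intro 1[of "- t" \<phi>] \<phi>D) auto
  next
    case False
    \<comment> \<open>Second reduction: composing with x + h n moves the support inwards by \<nu> /
      (n + 1), which creates a positive margin. The translates keep their energy and tend to \<phi>
      almost everywhere along a subsequence.\<close>
    define h where "h n = (- (1 / real (Suc n))) *\<^sub>R \<nu>" for n
    have h: "h \<longlonglongrightarrow> 0" "\<And>n. h n \<noteq> 0"
    proof -
      have "(\<lambda>n. (- (1 / real (Suc n))) *\<^sub>R \<nu>) \<longlonglongrightarrow> (- 0) *\<^sub>R \<nu>"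
        using LIMSEQ_inverse_real_of_nat by (intro tendsto_scaleR tendsto_minus tendsto_const) (simp add: inverse_eq_divide)
      then show "h \<longlonglongrightarrow> 0" by (simp add: h_def[abs_def])
      show "h n \<noteq> 0" for n using False by (simp add: h_def)
    qed
    obtain r where r: "strict_mono r" "AE x in lborel. (\<lambda>n. \<phi> (x + h (r n))) \<longlonglongrightarrow> \<phi> x"
      using translation_AE_subseq[OF \<phi>D h] by blast
    have sh: "(\<lambda>x. \<phi> (x + h n)) = rsc q (h n) 1 \<phi>" for n by (simp add: rsc_def fun_eq_iff add.commute)
    have D: "Dsp s p (\<lambda>x. \<phi> (x + h n))" "gagp s p (\<lambda>x. \<phi> (x + h n)) = gagp s p \<phi>" for n
      unfolding sh by (rule Dsp_rsc[OF \<phi>D], simp)+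
    have z: "WF \<mu> w (\<lambda>x. \<phi> (x + h n)) = 0" for n
    proof (rule 1[OF _ D(1)])
      show "0 < (\<nu> \<bullet> \<nu>) / real (Suc n)" using False by simp
      have "AE x in lborel. \<phi> (h n + 1 *\<^sub>R x) \<noteq> 0 \<longrightarrow> t < (h n + 1 *\<^sub>R x) \<bullet> \<nu>"
        by (rule AE_affine[OF _ _ supp]) auto
      then show "AE x in lborel. \<phi> (x + h n) \<noteq> 0 \<longrightarrow> t + (\<nu> \<bullet> \<nu>) / real (Suc n) \<le> x \<bullet> \<nu>"
      proof eventually_elim
        case (elim x)
        have e: "h n + 1 *\<^sub>R x = x + h n" by (simp add: add.commute)
        have hn: "h n \<bullet> \<nu> = - ((\<nu> \<bullet> \<nu>) / real (Suc n))" by (simp add: h_def)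
        show ?case
        proof
          assume "\<phi> (x + h n) \<noteq> 0"
          then have "t < (x + h n) \<bullet> \<nu>" using elim unfolding e by blast
          then show "t + (\<nu> \<bullet> \<nu>) / real (Suc n) \<le> x \<bullet> \<nu>" unfolding inner_add_left hn by linarith
        qed
      qed
    qed
    have "(\<lambda>n. WF \<mu> w (\<lambda>x. \<phi> (x + h (r n)))) \<longlonglongrightarrow> WF \<mu> w \<phi>"
      by (rule WF_limit_test[OF D(1) eq_refl[OF D(2)] r(2) m w])
    then show ?thesis unfolding z using LIMSEQ_unique tendsto_const by blast
  qed
qed

end

section \<open>Profiles and bubbles\<close>

context fractional
begin

lemma al_less_N: "al < N"
proof -
  have "al * p = N - s * p" using p0 by (simp add: al_def)
  also have "\<dots> < N * 1" using sp0 by simp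
  also have "\<dots> \<le> N * p" using N0 p1 by (intro mult_left_mono) auto
  finally show ?thesis using p0 by simp
qed

text \<open>Testing with R n itself shows that \<open>Lint q lborel (R n)\<close> tends to lev /
  \<mu> > 0, whereas \<open>refined_Sobolev\<close> would make it small if all ball integrals were
  small in the critical normalisation r^(N - al).\<close>

lemma concentration:
  fixes R :: "nat \<Rightarrow> 'a \<Rightarrow> real"
  assumes \<mu>: "0 < \<mu>" and R: "\<And>n. Dsp s p (R n)" and gl: "(\<lambda>n. gagp s p (R n)) \<longlonglongrightarrow> lev" "0 < lev"
    and W: "(\<lambda>n. WF \<mu> (R n) (R n)) \<longlonglongrightarrow> 0"
  shows "\<exists>\<delta>>0. eventually (\<lambda>n. \<exists>z r. 0 < r \<and> \<delta> * r powr (N - al) < \<bar>\<integral>y. indicator (ball z r) y * R n y \<partial>lborel\<bar>) sequentially"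
proof -
  define A where "A = lev / (2 * \<mu>)"
  have A: "A > 0" using gl \<mu> by (simp add: A_def)
  define B where "B = Csob * (lev + 1)"
  have B: "B > 0" using Csob_pos gl by (simp add: B_def)
  \<comment> \<open>Makes the bound Csob \<delta>^(q - p) (lev + 1) equal to A, half of the limit
    lev / \<mu>.\<close>
  define \<delta> where "\<delta> = (A / B) powr (1 / (q - p))"
  have \<delta>: "\<delta> > 0" "\<delta> powr (q - p) = A / B" using A B p_less_q by (auto simp: \<delta>_def powr_powr)
  have "(\<lambda>n. (gagp s p (R n) - WF \<mu> (R n) (R n)) / \<mu>) \<longlonglongrightarrow> (lev - 0) / \<mu>"
    using \<mu> by (intro tendsto_divide tendsto_diff gl W tendsto_const) auto
  then have "(\<lambda>n. Lint q lborel (R n)) \<longlonglongrightarrow> lev / \<mu>" using \<mu> by (simp add: WF_self[OF R])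
  moreover have "A < lev / \<mu>" using gl(2) \<mu> by (simp add: A_def field_simps)
  ultimately have "eventually (\<lambda>n. A < Lint q lborel (R n)) sequentially" by (rule order_tendstoD(1))
  moreover have "eventually (\<lambda>n. gagp s p (R n) < lev + 1) sequentially"
    by (rule order_tendstoD(2)[OF gl(1)]) simp
  ultimately have "eventually (\<lambda>n. \<exists>z r. 0 < r \<and> \<delta> * r powr (N - al) < \<bar>\<integral>y. indicator (ball z r) y * R n y \<partial>lborel\<bar>) sequentially"
  proof eventually_elim
    case (elim n)
    show ?case
    proof (rule ccontr)
      assume "\<not> ?thesis"
      then have "\<And>z r. 0 < r \<Longrightarrow> \<bar>\<integral>y. indicator (ball z r) y * R n y \<partial>lborel\<bar> \<le> \<delta> * r powr (N - al)"
        by (meson not_le)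
      from refined_Sobolev[OF R \<delta>(1) this]
      have "Lint q lborel (R n) \<le> Csob * \<delta> powr (q - p) * gagp s p (R n)" .
      also have "\<dots> \<le> Csob * \<delta> powr (q - p) * (lev + 1)"
        using elim(2) Csob_pos by (intro mult_left_mono) auto
      also have "\<dots> = B * (A / B)" unfolding \<delta>(2) by (simp add: B_def)
      also have "\<dots> = A" using B by simp
      finally show False using elim(1) by simp
    qed
  qed
  then show ?thesis using \<delta>(1) by blast
qed

lemma ball_integral_rsc:
  assumes [measurable]: "(u :: 'a \<Rightarrow> real) \<in> borel_measurable borel" and r: "0 < r"
  shows "(\<integral>y. indicator (ball z r) y * u y \<partial>lborel) = r powr (N - al) * (\<integral>x. indicator (ball 0 1) x * rsc q z r u x \<partial>lborel)"
proof -
  have i: "indicator (ball z r) (z + r *\<^sub>R x) = (indicator (ball 0 1) x :: real)" for x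
    using r by (simp add: indicator_def dist_norm)
  have [measurable]: "ball z r \<in> sets borel" by simp
  have "(\<integral>y. indicator (ball z r) y * u y \<partial>lborel)
      = r powr real DIM('a) * (\<integral>x. indicator (ball z r) (z + r *\<^sub>R x) * u (z + r *\<^sub>R x) \<partial>lborel)"
    by (rule integral_affine[OF _ r]) measurable
  also have "\<dots> = r powr N * (\<integral>x. indicator (ball 0 1) x * u (z + r *\<^sub>R x) \<partial>lborel)"
    by (simp only: i N_def)
  also have "(\<integral>x. indicator (ball 0 1) x * rsc q z r u x \<partial>lborel)
      = r powr al * (\<integral>x. indicator (ball 0 1) x * u (z + r *\<^sub>R x) \<partial>lborel)"
    unfolding rsc_q by (subst integral_mult_right_zero[symmetric]) (simp add: mult_ac)
  then have "r powr N * (\<integral>x. indicator (ball 0 1) x * u (z + r *\<^sub>R x) \<partial>lborel)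
      = r powr (N - al) * (\<integral>x. indicator (ball 0 1) x * rsc q z r u x \<partial>lborel)"
    using r by (simp add: powr_diff)
  finally show ?thesis .
qed

text \<open>A test function with bounded support inside the limit domain, transplanted back by the
  inverse zoom, is supported in \<Omega> for large n and keeps its energy; so the Palais-Smale
  estimate applies to it and passes to the limit.\<close>

lemma limit_weak_sol:
  fixes R :: "nat \<Rightarrow> 'a \<Rightarrow> real"
  assumes R: "\<And>n. Dsp0 s p \<Omega> (R n)" "\<And>n. gagp s p (R n) \<le> K" and \<Omega>: "open \<Omega>" and l: "\<And>n. 0 < l n"
    and lim: "AE x in lborel. (\<lambda>n. rsc q (z n) (l n) (R n) x) \<longlonglongrightarrow> w x" and w: "w \<in> borel_measurable borel"
    and PS: "\<And>e. 0 < e \<Longrightarrow> eventually (\<lambda>n. \<forall>\<phi>. Dsp0 s p \<Omega> \<phi> \<longrightarrow> \<bar>WF \<mu> (R n) \<phi>\<bar> \<le> e * gag s p \<phi>) sequentially"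
    and \<nu>: "\<nu> \<noteq> 0 \<or> t < 0"
    and out: "\<And>x. x \<bullet> \<nu> < t \<Longrightarrow> eventually (\<lambda>n. z n + l n *\<^sub>R x \<notin> \<Omega>) sequentially"
    and ins: "\<And>B \<eta>. 0 < \<eta> \<Longrightarrow> eventually (\<lambda>n. \<forall>x. norm x \<le> B \<and> t + \<eta> \<le> x \<bullet> \<nu> \<longrightarrow> z n + l n *\<^sub>R x \<in> \<Omega>) sequentially"
  shows "weak_sol s p (\<lambda>_. 0) \<mu> {x. t < x \<bullet> \<nu>} w"
proof -
  have RD: "Dsp s p (R n)" for n using R(1) by (simp add: Dsp0_def)
  have [measurable]: "R n \<in> borel_measurable borel" for n using RD by (rule Dsp_measurable)
  have [measurable]: "\<Omega> \<in> sets borel" using \<Omega> by simp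
  define v where "v n = rsc q (z n) (l n) (R n)" for n
  have v: "Dsp s p (v n)" "gagp s p (v n) \<le> K" for n
    using Dsp_rsc[OF RD l] R(2) by (auto simp: v_def)
  have vlim: "AE x in lborel. (\<lambda>n. v n x) \<longlonglongrightarrow> w x" using lim by (simp add: v_def)
  have wD: "Dsp s p w" by (rule Dsp_limit(1)[OF v vlim w])
  have "AE x in lborel. \<forall>n. z n + l n *\<^sub>R x \<notin> \<Omega> \<longrightarrow> v n x = 0"
  proof (subst AE_all_countable, intro allI)
    fix n
    have "AE y in lborel. y \<notin> \<Omega> \<longrightarrow> R n y = 0" using R(1) by (simp add: Dsp0_def)
    then have "AE x in lborel. z n + l n *\<^sub>R x \<notin> \<Omega> \<longrightarrow> R n (z n + l n *\<^sub>R x) = 0"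
      by (rule AE_affine[OF _ l, rotated]) measurable
    then show "AE x in lborel. z n + l n *\<^sub>R x \<notin> \<Omega> \<longrightarrow> v n x = 0"
      by eventually_elim (simp add: v_def rsc_q)
  qed
  \<comment> \<open>Assumption \<open>out\<close> is silent on the hyperplane itself, which is a
    null set.\<close>
  moreover have "AE x in lborel. x \<bullet> \<nu> \<noteq> t"
  proof (cases "\<nu> = 0")
    case False
    then have "negligible {x. \<nu> \<bullet> x = t}" by (rule negligible_hyperplane[OF disjI1])
    moreover have "{x. \<nu> \<bullet> x = t} \<in> sets lborel" by (simp add: borel_closed closed_hyperplane)
    ultimately have "{x. \<nu> \<bullet> x = t} \<in> null_sets lborel"
      by (simp add: negligible_iff_null_sets null_sets_completion_iff)
    from AE_not_in[OF this] show ?thesis by eventually_elim (simp add: inner_commute)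
  qed (use \<nu> in auto)
  ultimately have supp: "AE x in lborel. x \<notin> {x. t < x \<bullet> \<nu>} \<longrightarrow> w x = 0"
    using vlim
  proof eventually_elim
    case (elim x)
    show ?case
    proof
      assume "x \<notin> {x. t < x \<bullet> \<nu>}"
      then have "x \<bullet> \<nu> < t" using elim by auto
      from out[OF this] have "eventually (\<lambda>n. v n x = 0) sequentially"
        by eventually_elim (use elim in blast)
      then have "(\<lambda>n. v n x) \<longlonglongrightarrow> 0" by (rule tendsto_eventually)
      then show "w x = 0" using elim LIMSEQ_unique by blast
    qed
  qed
  have tests: "WF \<mu> w \<phi> = 0" if \<eta>: "0 < \<eta>" and \<phi>: "Dsp s p \<phi>"
    and sup: "AE x in lborel. \<phi> x \<noteq> 0 \<longrightarrow> norm x \<le> B \<and> t + \<eta> \<le> x \<bullet> \<nu>" for \<phi> B \<eta>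
  proof -
    have [measurable]: "\<phi> \<in> borel_measurable borel" using \<phi> by (rule Dsp_measurable)
    define \<psi> where "\<psi> n = rsc q (- ((1 / l n) *\<^sub>R z n)) (1 / l n) \<phi>" for n
    have il: "0 < 1 / l n" for n using l by simp
    have \<psi>D: "Dsp s p (\<psi> n)" "gagp s p (\<psi> n) = gagp s p \<phi>" for n
      unfolding \<psi>_def using Dsp_rsc[OF \<phi> il] by auto
    have r\<psi>: "rsc q (z n) (l n) (\<psi> n) = \<phi>" for n unfolding \<psi>_def by (rule rsc_inverse(2)[OF l])
    have [measurable]: "\<psi> n \<in> borel_measurable borel" for n using \<psi>D(1) by (rule Dsp_measurable)
    have eq: "WF \<mu> (R n) (\<psi> n) = WF \<mu> (v n) \<phi>" for n
      using WF_rsc[OF l, of "R n" "\<psi> n" \<mu> "z n" n] unfolding r\<psi> v_def by simp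
    have small: "\<bar>WF \<mu> w \<phi>\<bar> \<le> e * gag s p \<phi>" if e: "0 < e" for e
    proof (rule LIMSEQ_le_const2[OF tendsto_rabs[OF WF_limit[OF v vlim w \<phi>]]])
      have "eventually (\<lambda>n. \<bar>WF \<mu> (v n) \<phi>\<bar> \<le> e * gag s p \<phi>) sequentially"
        using PS[OF e] ins[OF \<eta>, of B]
      proof eventually_elim
        case (elim n)
        have "AE x in lborel. \<phi> x \<noteq> 0 \<longrightarrow> z n + l n *\<^sub>R x \<in> \<Omega>"
          using sup by eventually_elim (use elim(2) in blast)
        then have "AE y in lborel. \<phi> (- ((1 / l n) *\<^sub>R z n) + (1 / l n) *\<^sub>R y) \<noteq> 0
            \<longrightarrow> z n + l n *\<^sub>R (- ((1 / l n) *\<^sub>R z n) + (1 / l n) *\<^sub>R y) \<in> \<Omega>"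
          by (rule AE_affine[OF _ il, rotated]) measurable
        then have "AE y in lborel. y \<notin> \<Omega> \<longrightarrow> \<psi> n y = 0"
        proof eventually_elim
          case (elim y)
          have c: "z n + l n *\<^sub>R (- ((1 / l n) *\<^sub>R z n) + (1 / l n) *\<^sub>R y) = y"
            using l[of n] by (simp only: scaleR_add_right scaleR_minus_right scaleR_scaleR) simp
          then show ?case using elim unfolding c \<psi>_def rsc_q by auto
        qed
        then have "Dsp0 s p \<Omega> (\<psi> n)" using \<psi>D by (simp add: Dsp0_def)
        then have "\<bar>WF \<mu> (R n) (\<psi> n)\<bar> \<le> e * gag s p (\<psi> n)" using elim(1) by blast
        then show ?case by (simp add: eq gag_eq \<psi>D(2))
      qed
      then show "\<exists>n0. \<forall>n\<ge>n0. \<bar>WF \<mu> (v n) \<phi>\<bar> \<le> e * gag s p \<phi>" by (simp add: eventually_sequentially)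
    qed
    have "\<bar>WF \<mu> w \<phi>\<bar> \<le> 0"
    proof (rule field_le_epsilon)
      fix e :: real assume e: "0 < e"
      have g: "0 \<le> gag s p \<phi>" by (simp add: gag_eq)
      have "\<bar>WF \<mu> w \<phi>\<bar> \<le> e / (gag s p \<phi> + 1) * gag s p \<phi>" using e g by (intro small) auto
      also have "\<dots> \<le> 0 + e" using e g by (simp add: field_simps)
      finally show "\<bar>WF \<mu> w \<phi>\<bar> \<le> 0 + e" .
    qed
    then show ?thesis by simp
  qed
  have "WF \<mu> w \<phi> = 0" if "Dsp0 s p {x. t < x \<bullet> \<nu>} \<phi>" for \<phi>
    by (rule WF_eq_0_of_compact_tests[OF wD \<nu> _ that]) (rule tests, assumption+)
  then show ?thesis unfolding weak_sol_def Dsp0_def[of s p _ w] using wD supp by simp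
qed

text \<open>Kept in the literal form of the final decomposition; by \<open>bub_eq\<close> and
  \<open>rsc_inverse\<close> it undoes the zoom \<open>rsc q z l\<close>.\<close>

definition bub :: "real \<Rightarrow> 'a \<Rightarrow> ('a \<Rightarrow> real) \<Rightarrow> 'a \<Rightarrow> real" where
  "bub l z w x = l powr ((s * p - N) / p) * w ((1 / l) *\<^sub>R (x - z))"

lemma bub_eq:
  assumes l: "0 < l" shows "bub l z w = rsc q (- ((1 / l) *\<^sub>R z)) (1 / l) w"
proof
  fix x
  have "(s * p - N) / p = - al" by (simp add: al_def minus_divide_left)
  then have "l powr ((s * p - N) / p) = (1 / l) powr al"
    using l by (simp add: powr_divide powr_minus_divide)
  moreover have "(1 / l) *\<^sub>R (x - z) = - ((1 / l) *\<^sub>R z) + (1 / l) *\<^sub>R x" by (simp add: algebra_simps)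
  ultimately show "bub l z w x = rsc q (- ((1 / l) *\<^sub>R z)) (1 / l) w x" by (simp only: bub_def rsc_q)
qed

text \<open>Rescaled to the unit scale, this is a duality product of \<open>w\<close> with functions that are bounded in
  the dual Lebesgue space and tend to \<open>0\<close> pointwise.\<close>

lemma L1_norm_bubble_tendsto_0:
  fixes w :: "'a \<Rightarrow> real"
  assumes w: "Lq q lborel w" and l: "\<And>n. 0 < l n" "l \<longlonglongrightarrow> 0" and \<rho>: "\<And>n. 0 < \<rho> n" "\<And>n. l n * \<rho> n \<le> D"
  shows "(\<lambda>n. l n powr (N - al) * (\<integral>x. \<bar>indicator (ball 0 (\<rho> n)) x * w x\<bar> \<partial>lborel)) \<longlonglongrightarrow> 0"
proof -
  define g where "g n x = l n powr (N - al) * indicator (ball (0::'a) (\<rho> n)) x" for n x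
  let ?q = "q / (q - 1)"
  have q': "1 < ?q" "1 / ?q + 1 / q = 1" using conjugate_exponent[OF q1] by auto
  have D0: "0 \<le> D" using \<rho>(1,2)[of 0] l(1)[of 0] by (smt (verit) mult_pos_pos)
  \<comment> \<open>N - al is N divided by the exponent conjugate to q: with this weight, indicators
    of balls of radius \<rho> n stay bounded in that exponent as long as l n \<rho> n does.\<close>
  have exp: "(N - al) * ?q = N"
  proof -
    have "N - al = N * ((q - 1) / q)" using q0 by (simp add: N_div_q[symmetric] field_simps)
    then show ?thesis using q1 by simp
  qed
  have B: "ball (0::'a) (\<rho> n) \<in> sets lborel" for n by simp
  note I = Lq_indicator[OF B emeasure_ball_N[OF \<rho>(1)]]
  have gL: "Lq ?q lborel (g n)" "Lint ?q lborel (g n) \<le> vol * D powr N" for n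
  proof -
    have v: "0 \<le> vol * \<rho> n powr N" using vol0 by simp
    show "Lq ?q lborel (g n)" unfolding g_def[abs_def] by (rule Lq_cmult(1)[OF I(1)[OF v]])
    have "Lint ?q lborel (g n) = (l n powr (N - al)) powr ?q * (vol * \<rho> n powr N)"
      unfolding g_def[abs_def] Lq_cmult(2)[OF I(1)[OF v]] I(2)[OF v] by simp
    also have "\<dots> = vol * (l n * \<rho> n) powr N"
      using l(1)[of n] \<rho>(1)[of n] by (simp only: powr_powr exp powr_mult less_imp_le) simp
    also have "\<dots> \<le> vol * D powr N"
      using \<rho>[of n] l(1)[of n] N0 vol0 by (intro mult_left_mono powr_mono2) auto
    finally show "Lint ?q lborel (g n) \<le> vol * D powr N" .
  qed
  have lN: "(\<lambda>n. l n powr (N - al)) \<longlonglongrightarrow> 0"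
  proof -
    have "(\<lambda>n. l n powr (N - al)) \<longlonglongrightarrow> 0 powr (N - al)"
      using al_less_N l by (intro tendsto_powr2 tendsto_const) (auto intro!: always_eventually less_imp_le)
    then show ?thesis by simp
  qed
  have g0: "(\<lambda>n. g n x) \<longlonglongrightarrow> 0" for x
    by (rule Lim_null_comparison[OF _ lN]) (auto simp: g_def indicator_def)
  have "(\<lambda>n. \<integral>x. \<bar>(g n x - 0) * w x\<bar> \<partial>lborel) \<longlonglongrightarrow> 0"
    by (rule Lq_weak_limit(1)[OF q'(1) q1 q'(2) gL(1) gL(2) _ _ w]) (use g0 in auto)
  moreover have "(\<integral>x. \<bar>(g n x - 0) * w x\<bar> \<partial>lborel) = l n powr (N - al) * (\<integral>x. \<bar>indicator (ball 0 (\<rho> n)) x * w x\<bar> \<partial>lborel)" for n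
    by (subst integral_mult_right_zero[symmetric]) (simp add: g_def abs_mult mult_ac)
  ultimately show ?thesis by simp
qed

lemma L1_norm_rsc:
  fixes w :: "'a \<Rightarrow> real"
  assumes [measurable]: "w \<in> borel_measurable borel" and l: "0 < l"
  shows "(\<integral>y. \<bar>rsc q (- ((1 / l) *\<^sub>R z)) (1 / l) w y\<bar> \<partial>lborel) = l powr (N - al) * (\<integral>x. \<bar>w x\<bar> \<partial>lborel)"
proof -
  have [measurable]: "(\<lambda>y. \<bar>rsc q (- ((1 / l) *\<^sub>R z)) (1 / l) w y\<bar>) \<in> borel_measurable borel"
    by measurable
  have "rsc q z l (rsc q (- ((1 / l) *\<^sub>R z)) (1 / l) w) x = w x" for x using fun_cong[OF rsc_inverse(2)[OF l, of q z w], of x] by simp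
  then have e: "rsc q (- ((1 / l) *\<^sub>R z)) (1 / l) w (z + l *\<^sub>R x) = l powr (- al) * w x" for x
    using l by (simp add: rsc_q[of z l] powr_minus field_simps)
  have "(\<integral>y. \<bar>rsc q (- ((1 / l) *\<^sub>R z)) (1 / l) w y\<bar> \<partial>lborel)
     = l powr real DIM('a) * (\<integral>x. \<bar>rsc q (- ((1 / l) *\<^sub>R z)) (1 / l) w (z + l *\<^sub>R x)\<bar> \<partial>lborel)"
    by (rule integral_affine[OF _ l]) measurable
  also have "\<dots> = l powr N * (\<integral>x. l powr (- al) * \<bar>w x\<bar> \<partial>lborel)"
    unfolding e by (simp add: abs_mult N_def)
  also have "\<dots> = l powr (N - al) * (\<integral>x. \<bar>w x\<bar> \<partial>lborel)"
    by (simp add: powr_diff powr_minus field_simps)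
  finally show ?thesis .
qed

text \<open>Testing the equation with w gives [w]^p = \<mu> times the critical integral, which is at
  most a constant times [w]^q; since q > p, a nonzero energy cannot be small. This constant bounds
  the number of extractions.\<close>

lemma weak_sol_energy_bound:
  "\<exists>c0>0. \<forall>w::'a \<Rightarrow> real. weak_sol s p (\<lambda>_. 0) \<mu> UNIV w \<longrightarrow> \<not> (AE x in lborel. w x = 0) \<longrightarrow> c0 \<le> gagp s p w"
proof -
  obtain C where C: "C > 0" "\<And>v::'a \<Rightarrow> real. Dsp s p v \<Longrightarrow> Lint q lborel v \<le> C * gagp s p v powr (q / p)"
    using Sobolev by auto
  \<comment> \<open>|\<mu>| + 1 keeps M positive whatever the value of \<mu>.\<close>
  define M where "M = (\<bar>\<mu>\<bar> + 1) * C"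
  have M: "M > 0" using C by (simp add: M_def add_nonneg_pos)
  define c0 where "c0 = (1 / M) powr (1 / (q / p - 1))"
  have e: "q / p - 1 > 0" using p_less_q p0 by simp
  have "c0 \<le> gagp s p w" if w: "weak_sol s p (\<lambda>_. 0) \<mu> UNIV w" and nz: "\<not> (AE x in lborel. w x = 0)" for w :: "'a \<Rightarrow> real"
  proof -
    have wD: "Dsp s p w" "Dsp0 s p UNIV w" using w by (auto simp: weak_sol_def Dsp0_def)
    have "WF \<mu> w w = 0" using w wD by (simp add: weak_sol_def)
    then have g: "gagp s p w = \<mu> * Lint q lborel w" by (simp add: WF_self[OF wD(1)])
    have L: "0 < Lint q lborel w" using Lint_eq_0[OF DspD(1)[OF wD(1)]] nz Lint_nonneg[of q lborel w] by linarith
    have gp: "0 < gagp s p w"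
    proof (rule ccontr)
      assume "\<not> ?thesis"
      then have "gagp s p w = 0" using gagp_nonneg[of w] by linarith
      then show False using C(2)[OF wD(1)] L q0 p0 by simp
    qed
    have "gagp s p w \<le> (\<bar>\<mu>\<bar> + 1) * (C * gagp s p w powr (q / p))"
      unfolding g[symmetric] using g C(2)[OF wD(1)] L mult_mono[of \<mu> "\<bar>\<mu>\<bar> + 1" "Lint q lborel w" "C * gagp s p w powr (q / p)"] by auto
    also have "\<dots> = M * (gagp s p w powr (q / p - 1) * gagp s p w)"
      using gp powr_diff[of "gagp s p w" "q / p" 1] by (simp add: M_def)
    finally have "1 \<le> M * gagp s p w powr (q / p - 1)" using gp by simp
    then have "1 / M \<le> gagp s p w powr (q / p - 1)" using M by (simp add: field_simps)
    then have "c0 \<le> (gagp s p w powr (q / p - 1)) powr (1 / (q / p - 1))"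
      unfolding c0_def using M e by (intro powr_mono2) auto
    moreover have "(X powr E) powr (1 / E) = X" if "0 < E" "0 < X" for X E :: real
      using that by (simp add: powr_powr)
    ultimately show ?thesis using e gp by metis
  qed
  moreover have "c0 > 0" using M by (simp add: c0_def)
  ultimately show ?thesis by blast
qed

end

section \<open>Palais-Smale sequences without potential and their profiles\<close>

locale bubbling = fractional s p N q al T
  for s p N q al :: real and T :: "'a::euclidean_space itself" +
  fixes \<mu> :: real and \<Omega> :: "'a set"
  assumes mu0: "0 < \<mu>" and Omega: "open \<Omega>" "bounded \<Omega>" "smooth_boundary \<Omega>"
    and NA: "NA s p \<mu> TYPE('a)"
begin

text \<open>Bounded Palais-Smale sequences in \<Omega> for the functional without potential. No
  level is recorded: limits of energies and critical norms are tracked separately. The L^1 condition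
  says that nothing is left at unit scale, in a form that is easily checked after each
  subtraction.\<close>

definition PSinf :: "(nat \<Rightarrow> 'a \<Rightarrow> real) \<Rightarrow> bool" where
  "PSinf R \<longleftrightarrow> (\<forall>n. Dsp0 s p \<Omega> (R n)) \<and> (\<exists>K. \<forall>n. gagp s p (R n) \<le> K)
    \<and> (\<forall>e>0. eventually (\<lambda>n. \<forall>\<phi>. Dsp0 s p \<Omega> \<phi> \<longrightarrow> \<bar>WF \<mu> (R n) \<phi>\<bar> \<le> e * gag s p \<phi>) sequentially)
    \<and> (\<lambda>n. \<integral>x. \<bar>R n x\<bar> \<partial>lborel) \<longlonglongrightarrow> 0"

lemma PSinfD:
  assumes "PSinf R"
  shows "Dsp0 s p \<Omega> (R n)" "Dsp s p (R n)" "\<exists>K. \<forall>n. gagp s p (R n) \<le> K"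
    "0 < e \<Longrightarrow> eventually (\<lambda>n. \<forall>\<phi>. Dsp0 s p \<Omega> \<phi> \<longrightarrow> \<bar>WF \<mu> (R n) \<phi>\<bar> \<le> e * gag s p \<phi>) sequentially"
    "(\<lambda>n. \<integral>x. \<bar>R n x\<bar> \<partial>lborel) \<longlonglongrightarrow> 0"
  using assms by (auto simp: PSinf_def Dsp0_def)

lemma PSinf_subseq:
  assumes R: "PSinf R" and \<sigma>: "strict_mono \<sigma>"
  shows "PSinf (\<lambda>n. R (\<sigma> n))"
  unfolding PSinf_def
proof (intro conjI allI impI)
  show "Dsp0 s p \<Omega> (R (\<sigma> n))" for n by (rule PSinfD[OF R])
  show "\<exists>K. \<forall>n. gagp s p (R (\<sigma> n)) \<le> K" using PSinfD(3)[OF R] by blast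
  show "eventually (\<lambda>n. \<forall>\<phi>. Dsp0 s p \<Omega> \<phi> \<longrightarrow> \<bar>WF \<mu> (R (\<sigma> n)) \<phi>\<bar> \<le> e * gag s p \<phi>) sequentially" if "0 < e" for e
    by (rule eventually_subseq[OF \<sigma> PSinfD(4)[OF R that]])
  show "(\<lambda>n. \<integral>x. \<bar>R (\<sigma> n) x\<bar> \<partial>lborel) \<longlonglongrightarrow> 0"
    using LIMSEQ_subseq_LIMSEQ[OF PSinfD(5)[OF R] \<sigma>] by (simp add: o_def)
qed

lemma PSinf_self:
  assumes R: "PSinf R" shows "(\<lambda>n. WF \<mu> (R n) (R n)) \<longlonglongrightarrow> 0"
proof -
  obtain K where K: "\<And>n. gagp s p (R n) \<le> K" using PSinfD(3)[OF R] by blast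
  have g: "gag s p (R n) \<le> K powr (1 / p)" for n
    unfolding gag_eq using K p0 by (intro powr_mono2) auto
  have "(\<lambda>n. \<bar>WF \<mu> (R n) (R n)\<bar>) \<longlonglongrightarrow> 0"
  proof (rule tendsto_0_of_eventually_le[where K = "K powr (1 / p)"])
    fix e :: real assume e: "0 < e"
    show "eventually (\<lambda>n. \<bar>WF \<mu> (R n) (R n)\<bar> \<le> e * K powr (1 / p)) sequentially"
      using PSinfD(4)[OF R e]
    proof eventually_elim
      case (elim n)
      then have "\<bar>WF \<mu> (R n) (R n)\<bar> \<le> e * gag s p (R n)" using PSinfD(1)[OF R] by blast
      also have "\<dots> \<le> e * K powr (1 / p)" using g e by (intro mult_left_mono) auto
      finally show ?case .
    qed
  qed simp
  then show ?thesis by (rule tendsto_rabs_zero_cancel)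
qed

lemma Dsp0_integrable:
  assumes u: "Dsp0 s p \<Omega> u" shows "integrable lborel u"
proof -
  have D: "Dsp s p u" using u by (simp add: Dsp0_def)
  have [measurable]: "u \<in> borel_measurable borel" using D by (rule Dsp_measurable)
  have fin: "emeasure lborel \<Omega> < \<infinity>" by (rule emeasure_bounded_finite[OF Omega(2)])
  have "integrable lborel (\<lambda>y. indicator \<Omega> y * u y)"
    by (rule Lq_integrable_on(1)[OF q1 DspD(1)[OF D], where m = "measure lborel \<Omega>"])
       (use Omega fin in \<open>auto simp: emeasure_eq_ennreal_measure less_top\<close>)
  moreover have "AE y in lborel. indicator \<Omega> y * u y = u y"
    using u by (auto simp: Dsp0_def indicator_def)
  ultimately show ?thesis
    using Omega(1) by (subst (asm) integrable_cong_AE) auto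
qed

text \<open>The ball integrals bounded below by \<open>concentration\<close> become, after zooming,
  integrals over the unit ball larger than \<delta>; these pass to the limit, so w is not 0.
  Unscaled, they show that \<delta> l^(N - al) is at most the L^1 norm, which forces l to 0.\<close>

lemma profile_exists:
  assumes R: "PSinf R" and gl: "(\<lambda>n. gagp s p (R n)) \<longlonglongrightarrow> lev" "0 < lev"
  shows "\<exists>\<sigma> z l w. strict_mono \<sigma> \<and> (\<forall>n. 0 < l n) \<and> l \<longlonglongrightarrow> 0 \<and> w \<in> borel_measurable borel
    \<and> \<not> (AE x in lborel. w x = 0) \<and> (AE x in lborel. (\<lambda>n. rsc q (z n) (l n) (R (\<sigma> n)) x) \<longlonglongrightarrow> w x)
    \<and> (\<forall>n. z n \<in> \<Omega> \<or> infdist (z n) (frontier \<Omega>) \<le> l n) \<and> \<Omega> \<noteq> {}"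
proof -
  note D = PSinfD[OF R]
  obtain K where K: "\<And>n. gagp s p (R n) \<le> K" using D(3) by blast
  have [measurable]: "R n \<in> borel_measurable borel" for n using D(2) by (rule Dsp_measurable)
  obtain \<delta> n0 where \<delta>: "\<delta> > 0" and "\<And>n. n \<ge> n0 \<Longrightarrow> \<exists>z r. 0 < r \<and> \<delta> * r powr (N - al) < \<bar>\<integral>y. indicator (ball z r) y * R n y \<partial>lborel\<bar>"
    using concentration[OF mu0 D(2) gl PSinf_self[OF R]] unfolding eventually_sequentially by blast
  then have "\<exists>z r. 0 < r \<and> \<delta> * r powr (N - al) < \<bar>\<integral>y. indicator (ball z r) y * R (n + n0) y \<partial>lborel\<bar>" for n by simp
  then obtain z l where l: "\<And>n. 0 < l n"
    and big: "\<And>n. \<delta> * l n powr (N - al) < \<bar>\<integral>y. indicator (ball (z n) (l n)) y * R (n + n0) y \<partial>lborel\<bar>" by metis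
  define Q where "Q n = R (n + n0)" for n
  have Q: "PSinf Q" unfolding Q_def using PSinf_subseq[OF R, of "\<lambda>n. n + n0"] by (simp add: strict_mono_def)
  note DQ = PSinfD[OF Q]
  have [measurable]: "Q n \<in> borel_measurable borel" for n using DQ(2) by (rule Dsp_measurable)
  have zero_off: "AE y in lborel. y \<notin> \<Omega> \<longrightarrow> Q n y = 0" for n using DQ(1) by (simp add: Dsp0_def)
  have Qint: "integrable lborel (Q n)" for n by (rule Dsp0_integrable[OF DQ(1)])
  have small: "\<delta> * l n powr (N - al) \<le> (\<integral>x. \<bar>Q n x\<bar> \<partial>lborel)" for n
  proof -
    have "\<bar>\<integral>y. indicator (ball (z n) (l n)) y * Q n y \<partial>lborel\<bar> \<le> (\<integral>y. \<bar>indicator (ball (z n) (l n)) y * Q n y\<bar> \<partial>lborel)"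
      by (rule integral_abs_bound)
    also have "\<dots> \<le> (\<integral>x. \<bar>Q n x\<bar> \<partial>lborel)"
      by (rule integral_mono_AE') (use Qint in \<open>auto simp: indicator_def\<close>)
    finally show ?thesis using big[of n] by (simp add: Q_def)
  qed
  have "(\<lambda>n. l n powr (N - al)) \<longlonglongrightarrow> 0"
  proof (rule Lim_null_comparison)
    have "(\<lambda>n. (\<integral>x. \<bar>Q n x\<bar> \<partial>lborel) / \<delta>) \<longlonglongrightarrow> 0 / \<delta>" using \<delta> by (intro tendsto_divide DQ(5) tendsto_const) auto
    then show "(\<lambda>n. (\<integral>x. \<bar>Q n x\<bar> \<partial>lborel) / \<delta>) \<longlonglongrightarrow> 0" by simp
    show "eventually (\<lambda>n. norm (l n powr (N - al)) \<le> (\<integral>x. \<bar>Q n x\<bar> \<partial>lborel) / \<delta>) sequentially"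
      using small \<delta> by (intro always_eventually) (simp add: field_simps)
  qed
  then have "(\<lambda>n. (l n powr (N - al)) powr (1 / (N - al))) \<longlonglongrightarrow> 0 powr (1 / (N - al))"
    using al_less_N by (intro tendsto_powr2 tendsto_const) auto
  moreover have "(l n powr (N - al)) powr (1 / (N - al)) = l n" for n
    using l[of n] al_less_N by (simp add: powr_powr)
  ultimately have l0: "l \<longlonglongrightarrow> 0" by simp
  have meet: "ball (z n) (l n) \<inter> \<Omega> \<noteq> {}" for n
  proof
    assume e: "ball (z n) (l n) \<inter> \<Omega> = {}"
    have [measurable]: "ball (z n) (l n) \<in> sets borel" by simp
    have m: "(\<lambda>y. indicator (ball (z n) (l n)) y * Q n y) \<in> borel_measurable lborel" by measurable
    have "(\<integral>y. indicator (ball (z n) (l n)) y * Q n y \<partial>lborel) = (\<integral>y. 0 \<partial>(lborel::'a measure))"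
    proof (rule integral_cong_AE[OF m])
      show "AE y in lborel. indicator (ball (z n) (l n)) y * Q n y = 0"
        using zero_off[of n] by eventually_elim (use e in \<open>auto simp: indicator_def\<close>)
    qed auto
    then show False using big[of n] \<delta> by (simp add: Q_def mult_less_0_iff)
  qed
  \<comment> \<open>The ball meets \<Omega>, so a centre outside \<Omega> has a frontier point
    within l n; such centres will belong to the near-boundary case.\<close>
  have pos: "z n \<in> \<Omega> \<or> infdist (z n) (frontier \<Omega>) \<le> l n" for n
  proof (cases "z n \<in> \<Omega>")
    case False
    then have "ball (z n) (l n) - \<Omega> \<noteq> {}" using l[of n] by (metis Diff_iff centre_in_ball empty_iff)
    then have "ball (z n) (l n) \<inter> frontier \<Omega> \<noteq> {}"
      using meet by (intro connected_Int_frontier connected_ball) auto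
    then obtain y where "y \<in> frontier \<Omega>" "dist (z n) y < l n" by auto
    then show ?thesis using infdist_le[of y "frontier \<Omega>" "z n"] by simp
  qed simp
  define v where "v n = rsc q (z n) (l n) (Q n)" for n
  have v: "Dsp s p (v n)" "gagp s p (v n) \<le> K" for n
    using Dsp_rsc[OF DQ(2) l] K by (auto simp: v_def Q_def)
  obtain r w where r: "strict_mono r" "w \<in> borel_measurable borel" "AE x in lborel. (\<lambda>n. v (r n) x) \<longlonglongrightarrow> w x"
    using Rellich[of v, OF v] by (elim exE conjE) (rule that, assumption+)
  have [measurable]: "w \<in> borel_measurable borel" by fact
  have vb: "\<delta> < \<bar>\<integral>x. v n x * indicator (ball 0 1) x \<partial>lborel\<bar>" for n
  proof -
    have "\<delta> * l n powr (N - al) < l n powr (N - al) * \<bar>\<integral>x. indicator (ball 0 1) x * v n x \<partial>lborel\<bar>"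
      using big[of n] unfolding Q_def[symmetric] ball_integral_rsc[OF \<open>Q n \<in> borel_measurable borel\<close> l] v_def
      by (simp add: abs_mult)
    then show ?thesis using l[of n] by (simp add: mult.commute)
  qed
  obtain L where L: "\<And>n. Lint q lborel (v (r n)) \<le> L" using Dsp_limit(2)[OF v(1) v(2) r(3,2)] by blast
  have "ball (0::'a) 1 \<in> sets lborel" by simp
  from Lq_indicator(1)[OF this emeasure_ball_N[of 1]]
  have IL: "Lq (q / (q - 1)) lborel (indicator (ball (0::'a) 1))" using vol0 by simp
  have "(\<lambda>n. \<integral>x. v (r n) x * indicator (ball 0 1) x \<partial>lborel) \<longlonglongrightarrow> (\<integral>x. w x * indicator (ball 0 1) x \<partial>lborel)"
    by (rule Lq_weak_limit(2)[OF q1 conjugate_exponent(1,3)[OF q1] DspD(1)[OF v(1)] L r(3) _ IL]) simp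
  then have "(\<lambda>n. \<bar>\<integral>x. v (r n) x * indicator (ball 0 1) x \<partial>lborel\<bar>) \<longlonglongrightarrow> \<bar>\<integral>x. w x * indicator (ball 0 1) x \<partial>lborel\<bar>"
    by (rule tendsto_rabs)
  then have wb: "\<delta> \<le> \<bar>\<integral>x. w x * indicator (ball 0 1) x \<partial>lborel\<bar>"
    by (rule LIMSEQ_le_const) (use vb less_imp_le in blast)
  have nz: "\<not> (AE x in lborel. w x = 0)"
  proof
    assume "AE x in lborel. w x = 0"
    moreover have "(\<lambda>x. w x * indicator (ball 0 1) x) \<in> borel_measurable lborel"
      using \<open>ball (0::'a) 1 \<in> sets lborel\<close> by measurable
    ultimately have "(\<integral>x. w x * indicator (ball 0 1) x \<partial>lborel) = (\<integral>x. 0 \<partial>(lborel::'a measure))"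
      by (intro integral_cong_AE) auto
    then show False using wb \<delta> by simp
  qed
  have "strict_mono (\<lambda>n. r n + n0)" using r(1) by (simp add: strict_mono_def)
  moreover have "(\<lambda>n. l (r n)) \<longlonglongrightarrow> 0" using LIMSEQ_subseq_LIMSEQ[OF l0 r(1)] by (simp add: o_def)
  moreover have "\<Omega> \<noteq> {}" using meet by auto
  ultimately show ?thesis
    using l pos nz r by (intro exI[of _ "\<lambda>n. r n + n0"] exI[of _ "\<lambda>n. z (r n)"] exI[of _ "\<lambda>n. l (r n)"] exI[of _ w])
      (auto simp: v_def Q_def)
qed

text \<open>Divergence of distance over scale also puts the centres inside \<Omega>, because a
  centre outside lies within l n of the frontier. The factor 4, obtained by dropping finitely many
  terms, leaves room for the cut-off in \<open>extraction\<close>.\<close>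

lemma profile_interior:
  assumes R: "PSinf R" and gl: "(\<lambda>n. gagp s p (R n)) \<longlonglongrightarrow> lev" "0 < lev"
  shows "\<exists>\<sigma> z l w. strict_mono \<sigma> \<and> (\<forall>n. 0 < l n) \<and> l \<longlonglongrightarrow> 0
    \<and> weak_sol s p (\<lambda>_. 0) \<mu> UNIV w
    \<and> \<not> (AE x in lborel. w x = 0) \<and> (AE x in lborel. (\<lambda>n. rsc q (z n) (l n) (R (\<sigma> n)) x) \<longlonglongrightarrow> w x)
    \<and> (\<forall>n. z n \<in> \<Omega> \<and> 4 * l n \<le> infdist (z n) (frontier \<Omega>))
    \<and> filterlim (\<lambda>n. infdist (z n) (frontier \<Omega>) / l n) at_top sequentially"
proof -
  obtain \<sigma> z l w where \<sigma>: "strict_mono \<sigma>" and l: "\<And>n. 0 < l n" "l \<longlonglongrightarrow> 0"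
    and w: "w \<in> borel_measurable borel" and nz: "\<not> (AE x in lborel. w x = 0)"
    and lim: "AE x in lborel. (\<lambda>n. rsc q (z n) (l n) (R (\<sigma> n)) x) \<longlonglongrightarrow> w x"
    and pos: "\<And>n. z n \<in> \<Omega> \<or> infdist (z n) (frontier \<Omega>) \<le> l n" and ne: "\<Omega> \<noteq> {}"
    using profile_exists[OF R gl] by blast
  define Q where "Q n = R (\<sigma> n)" for n
  have Q: "PSinf Q" unfolding Q_def by (rule PSinf_subseq[OF R \<sigma>])
  obtain K where K: "\<And>n. gagp s p (Q n) \<le> K" using PSinfD(3)[OF Q] by blast
  have fne: "frontier \<Omega> \<noteq> {}" using ne Omega(2) not_bounded_UNIV by (metis frontier_eq_empty)
  define d where "d n = infdist (z n) (frontier \<Omega>) / l n" for n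
  have d: "infdist (z n) (frontier \<Omega>) = d n * l n" for n using l(1)[of n] by (simp add: d_def)
  have dlim: "filterlim d at_top sequentially"
  proof (rule ccontr)
    assume "\<not> ?thesis"
    then obtain C where C: "\<not> eventually (\<lambda>n. C \<le> d n) sequentially" unfolding filterlim_at_top by blast
    obtain \<tau> :: "nat \<Rightarrow> nat" where \<tau>: "strict_mono \<tau>" "\<And>n. \<not> C \<le> d (\<tau> n)"
      using not_eventually_sequentiallyD[OF C] by blast
    have near: "infdist (z (\<tau> n)) (frontier \<Omega>) \<le> C * l (\<tau> n)" for n
      unfolding d using \<tau>(2)[of n] l(1)[of "\<tau> n"] by (intro mult_right_mono) auto
    have l\<tau>: "(\<lambda>n. l (\<tau> n)) \<longlonglongrightarrow> 0" using LIMSEQ_subseq_LIMSEQ[OF l(2) \<tau>(1)] by (simp add: o_def)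
    obtain \<upsilon> \<nu> t where \<upsilon>: "strict_mono \<upsilon>" and \<nu>: "\<nu> \<noteq> 0"
      and out': "\<forall>x. x \<bullet> \<nu> < t \<longrightarrow> eventually (\<lambda>n. z (\<tau> (\<upsilon> n)) + l (\<tau> (\<upsilon> n)) *\<^sub>R x \<notin> \<Omega>) sequentially"
      and ins': "\<forall>B \<eta>. 0 < \<eta> \<longrightarrow> eventually (\<lambda>n. \<forall>x. norm x \<le> B \<and> t + \<eta> \<le> x \<bullet> \<nu> \<longrightarrow> z (\<tau> (\<upsilon> n)) + l (\<tau> (\<upsilon> n)) *\<^sub>R x \<in> \<Omega>) sequentially"
      using blow_up_half_space[where z = "\<lambda>n. z (\<tau> n)" and l = "\<lambda>n. l (\<tau> n)", OF Omega fne l(1) l\<tau> near]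
      by (elim exE conjE) (rule that, assumption+)
    define \<kappa> where "\<kappa> n = \<tau> (\<upsilon> n)" for n
    have \<kappa>: "strict_mono \<kappa>" using strict_mono_o[OF \<tau>(1) \<upsilon>] by (simp add: \<kappa>_def[abs_def] o_def)
    have Q\<kappa>: "PSinf (\<lambda>n. Q (\<kappa> n))" by (rule PSinf_subseq[OF Q \<kappa>])
    have lim\<kappa>: "AE x in lborel. (\<lambda>n. rsc q (z (\<kappa> n)) (l (\<kappa> n)) (Q (\<kappa> n)) x) \<longlonglongrightarrow> w x"
      using lim by eventually_elim (use LIMSEQ_subseq_LIMSEQ[OF _ \<kappa>] in \<open>auto simp: o_def Q_def\<close>)
    have "weak_sol s p (\<lambda>_. 0) \<mu> {x. t < x \<bullet> \<nu>} w"
      by (rule limit_weak_sol[OF PSinfD(1)[OF Q\<kappa>] K Omega(1) l(1) lim\<kappa> w PSinfD(4)[OF Q\<kappa>] disjI1[OF \<nu>]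
            out'[rule_format, folded \<kappa>_def] ins'[rule_format, folded \<kappa>_def]])
    then show False using NA \<nu> nz unfolding NA_def by blast
  qed
  have "eventually (\<lambda>n. 4 \<le> d n) sequentially" using dlim unfolding filterlim_at_top by blast
  then obtain n0 where n0: "\<And>n. n \<ge> n0 \<Longrightarrow> 4 \<le> d n" unfolding eventually_sequentially by blast
  define \<kappa> where "\<kappa> n = n + n0" for n
  have \<kappa>: "strict_mono \<kappa>" by (simp add: \<kappa>_def strict_mono_def)
  have Q\<kappa>: "PSinf (\<lambda>n. Q (\<kappa> n))" by (rule PSinf_subseq[OF Q \<kappa>])
  have lim\<kappa>: "AE x in lborel. (\<lambda>n. rsc q (z (\<kappa> n)) (l (\<kappa> n)) (Q (\<kappa> n)) x) \<longlonglongrightarrow> w x"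
    using lim by eventually_elim (use LIMSEQ_subseq_LIMSEQ[OF _ \<kappa>] in \<open>auto simp: o_def Q_def\<close>)
  have d4: "4 \<le> d (\<kappa> n)" for n using n0 by (simp add: \<kappa>_def)
  have dk: "filterlim (\<lambda>n. d (\<kappa> n)) at_top sequentially"
    by (rule filterlim_compose[OF dlim filterlim_subseq[OF \<kappa>]])
  have far: "4 * l (\<kappa> n) \<le> infdist (z (\<kappa> n)) (frontier \<Omega>)" for n
    unfolding d using d4[of n] l(1)[of "\<kappa> n"] by (intro mult_right_mono) auto
  have zin: "z (\<kappa> n) \<in> \<Omega>" for n using pos[of "\<kappa> n"] far[of n] l(1)[of "\<kappa> n"] by linarith
  have "weak_sol s p (\<lambda>_. 0) \<mu> {x. -1 < x \<bullet> (0::'a)} w"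
  proof (rule limit_weak_sol[OF PSinfD(1)[OF Q\<kappa>] K Omega(1) l(1) lim\<kappa> w PSinfD(4)[OF Q\<kappa>]])
    fix B \<eta> :: real
    have "eventually (\<lambda>n. \<bar>B\<bar> + 1 \<le> d (\<kappa> n)) sequentially" using dk unfolding filterlim_at_top by blast
    then show "eventually (\<lambda>n. \<forall>x::'a. norm x \<le> B \<and> - 1 + \<eta> \<le> x \<bullet> 0 \<longrightarrow> z (\<kappa> n) + l (\<kappa> n) *\<^sub>R x \<in> \<Omega>) sequentially"
    proof (eventually_elim, intro allI impI)
      fix n and x :: 'a assume b: "\<bar>B\<bar> + 1 \<le> d (\<kappa> n)" and x: "norm x \<le> B \<and> - 1 + \<eta> \<le> x \<bullet> 0"
      have "l (\<kappa> n) * norm x < l (\<kappa> n) * d (\<kappa> n)" using b x l(1)[of "\<kappa> n"] by (intro mult_strict_left_mono) auto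
      then have "z (\<kappa> n) + l (\<kappa> n) *\<^sub>R x \<in> ball (z (\<kappa> n)) (infdist (z (\<kappa> n)) (frontier \<Omega>))"
        unfolding d using l(1)[of "\<kappa> n"] by (simp add: dist_norm mult.commute)
      then show "z (\<kappa> n) + l (\<kappa> n) *\<^sub>R x \<in> \<Omega>" using ball_infdist_frontier_subset[OF zin] by blast
    qed
  qed auto
  then have ws: "weak_sol s p (\<lambda>_. 0) \<mu> UNIV w" by simp
  have "strict_mono (\<lambda>n. \<sigma> (\<kappa> n))" using strict_mono_o[OF \<sigma> \<kappa>] by (simp add: o_def)
  moreover have "(\<lambda>n. l (\<kappa> n)) \<longlonglongrightarrow> 0" using LIMSEQ_subseq_LIMSEQ[OF l(2) \<kappa>] by (simp add: o_def)
  ultimately show ?thesis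
    using l(1) ws nz lim\<kappa> zin far dk unfolding d_def Q_def
    by (intro exI[of _ "\<lambda>n. \<sigma> (\<kappa> n)"] exI[of _ "\<lambda>n. z (\<kappa> n)"] exI[of _ "\<lambda>n. l (\<kappa> n)"] exI[of _ w]) auto
qed

end

context bubbling
begin

lemma gagp_diff_commute:
  assumes "Dsp s p (u :: 'a \<Rightarrow> real)" "Dsp s p v"
  shows "gagp s p (\<lambda>x. u x - v x) = gagp s p (\<lambda>x. v x - u x)"
  using Dsp_cmult(2)[OF Dsp_diff(1)[OF assms], of "-1"] by simp

text \<open>The splitting is done at unit scale, where the profile is fixed and Brezis-Lieb applies,
  and carried back by invariance of energy, critical norm and weak form. As w solves the equation on
  the whole space, its term vanishes for every rescaled test function, and R' inherits the
  Palais-Smale property.\<close>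

lemma extraction:
  assumes R: "PSinf R" and gl: "(\<lambda>n. gagp s p (R n)) \<longlonglongrightarrow> lev" "0 < lev"
  shows "\<exists>\<sigma> R' w lam z. strict_mono \<sigma> \<and> Dsp s p w \<and> \<not> (AE x in lborel. w x = 0)
    \<and> weak_sol s p (\<lambda>_. 0) \<mu> UNIV w \<and> (\<forall>n. 0 < lam n) \<and> lam \<longlonglongrightarrow> 0
    \<and> (\<forall>n. z n \<in> \<Omega> \<and> lam n \<le> infdist (z n) (frontier \<Omega>)) \<and> PSinf R'
    \<and> (\<lambda>n. gagp s p (\<lambda>x. R (\<sigma> n) x - R' n x - bub (lam n) (z n) w x)) \<longlonglongrightarrow> 0
    \<and> (\<lambda>n. gagp s p (R (\<sigma> n)) - gagp s p (R' n)) \<longlonglongrightarrow> gagp s p w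
    \<and> (\<lambda>n. Lint q lborel (R (\<sigma> n)) - Lint q lborel (R' n)) \<longlonglongrightarrow> Lint q lborel w"
proof -
  obtain \<sigma> z l w where \<sigma>: "strict_mono \<sigma>" and l: "\<And>n. 0 < l n" "l \<longlonglongrightarrow> 0"
    and ws: "weak_sol s p (\<lambda>_. 0) \<mu> UNIV w" and nz: "\<not> (AE x in lborel. w x = 0)"
    and lim: "AE x in lborel. (\<lambda>n. rsc q (z n) (l n) (R (\<sigma> n)) x) \<longlonglongrightarrow> w x"
    and pos: "\<And>n. z n \<in> \<Omega>" "\<And>n. 4 * l n \<le> infdist (z n) (frontier \<Omega>)"
    and dlim: "filterlim (\<lambda>n. infdist (z n) (frontier \<Omega>) / l n) at_top sequentially"
    using profile_interior[OF R gl] by blast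
  define Q where "Q n = R (\<sigma> n)" for n
  have Q: "PSinf Q" unfolding Q_def by (rule PSinf_subseq[OF R \<sigma>])
  note DQ = PSinfD[OF Q]
  obtain K where K: "\<And>n. gagp s p (Q n) \<le> K" using DQ(3) by blast
  have wD: "Dsp s p w" using ws by (simp add: weak_sol_def Dsp0_def)
  have [measurable]: "w \<in> borel_measurable borel" using wD by (rule Dsp_measurable)
  define v where "v n = rsc q (z n) (l n) (Q n)" for n
  have v: "Dsp s p (v n)" "gagp s p (v n) = gagp s p (Q n)" "Lint q lborel (v n) = Lint q lborel (Q n)" for n
    unfolding v_def by (rule Dsp_rsc[OF DQ(2) l(1)])+
  have vK: "gagp s p (v n) \<le> K" for n using K by (simp add: v(2))
  have vlim: "AE x in lborel. (\<lambda>n. v n x) \<longlonglongrightarrow> w x" using lim by (simp add: v_def Q_def)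
  obtain L where L: "\<And>n. Lint q lborel (v n) \<le> L"
    using Dsp_limit(2)[OF v(1) vK vlim] by auto
  \<comment> \<open>The cut-off vanishes outside radius 2 \<rho> n, which in original coordinates is
    half the distance of z n to the frontier: the subtracted function stays supported in \<Omega>,
    and \<rho> n still tends to infinity.\<close>
  define \<rho> where "\<rho> n = infdist (z n) (frontier \<Omega>) / l n / 4" for n
  have \<rho>0: "0 < \<rho> n" for n
  proof -
    have "0 < infdist (z n) (frontier \<Omega>)" using pos(2)[of n] l(1)[of n] by linarith
    then show ?thesis using l(1)[of n] by (simp add: \<rho>_def)
  qed
  have \<rho>lim: "filterlim \<rho> at_top sequentially"
    unfolding filterlim_at_top
  proof
    fix Z :: real
    have "eventually (\<lambda>n. 4 * Z \<le> infdist (z n) (frontier \<Omega>) / l n) sequentially"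
      using dlim unfolding filterlim_at_top by blast
    then show "eventually (\<lambda>n. Z \<le> \<rho> n) sequentially" by eventually_elim (simp add: \<rho>_def)
  qed
  define h where "h n x = cutoff (\<rho> n) x * w x" for n x
  have h: "Dsp s p (h n)" "(\<lambda>n. gagp s p (\<lambda>x. w x - h n x)) \<longlonglongrightarrow> 0" "(\<lambda>n. Lint q lborel (\<lambda>x. w x - h n x)) \<longlonglongrightarrow> 0" for n
    unfolding h_def[abs_def] by (rule cutoff_strong[OF wD \<rho>0 \<rho>lim])+
  have il: "0 < 1 / l n" for n using l(1) by simp
  define W where "W n = rsc q (- ((1 / l n) *\<^sub>R z n)) (1 / l n) (h n)" for n
  have W: "Dsp s p (W n)" for n unfolding W_def by (rule Dsp_rsc(1)[OF h(1) il])
  have Wsupp: "y \<in> \<Omega>" if "W n y \<noteq> 0" for n y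
  proof -
    have "cutoff (\<rho> n) (- ((1 / l n) *\<^sub>R z n) + (1 / l n) *\<^sub>R y) \<noteq> 0"
      using that by (auto simp: W_def rsc_q h_def)
    then have "norm (- ((1 / l n) *\<^sub>R z n) + (1 / l n) *\<^sub>R y) < 2 * \<rho> n"
      using cutoff_eq_0[OF \<rho>0] not_le by blast
    moreover have "- ((1 / l n) *\<^sub>R z n) + (1 / l n) *\<^sub>R y = (1 / l n) *\<^sub>R (y - z n)" by (simp add: algebra_simps)
    ultimately have "norm (y - z n) / l n < 2 * \<rho> n" using l(1)[of n] by simp
    then have "norm (y - z n) < infdist (z n) (frontier \<Omega>) / 2"
      using l(1)[of n] by (simp add: \<rho>_def field_simps)
    moreover have "0 \<le> infdist (z n) (frontier \<Omega>)" by (rule infdist_nonneg)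
    ultimately have "y \<in> ball (z n) (infdist (z n) (frontier \<Omega>))" by (simp add: dist_norm norm_minus_commute)
    then show ?thesis using ball_infdist_frontier_subset[OF pos(1)] by blast
  qed
  have W0: "Dsp0 s p \<Omega> (W n)" for n unfolding Dsp0_def using W Wsupp by auto
  define R' where "R' n x = Q n x - W n x" for n x
  have R'D: "Dsp s p (R' n)" for n unfolding R'_def[abs_def] by (rule Dsp_diff(1)[OF DQ(2) W])
  have R'0: "Dsp0 s p \<Omega> (R' n)" for n
  proof -
    have "AE x in lborel. x \<notin> \<Omega> \<longrightarrow> Q n x = 0" "AE x in lborel. x \<notin> \<Omega> \<longrightarrow> W n x = 0"
      using DQ(1) W0 by (auto simp: Dsp0_def)
    then have "AE x in lborel. x \<notin> \<Omega> \<longrightarrow> R' n x = 0" by eventually_elim (simp add: R'_def)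
    then show ?thesis using R'D by (simp add: Dsp0_def)
  qed
  have rR': "rsc q (z n) (l n) (R' n) = (\<lambda>x. v n x - h n x)" for n
    unfolding R'_def[abs_def] rsc_diff v_def W_def rsc_inverse(2)[OF l(1)] ..
  have vh: "Dsp s p (\<lambda>x. v n x - h n x)" for n by (rule Dsp_diff(1)[OF v(1) h(1)])
  have R'g: "gagp s p (R' n) = gagp s p (\<lambda>x. v n x - h n x)" "Lint q lborel (R' n) = Lint q lborel (\<lambda>x. v n x - h n x)" for n
    unfolding rR'[symmetric] using Dsp_rsc(2,3)[OF R'D l(1)] by auto
  have wh: "Dsp s p (\<lambda>x. w x - h n x)" for n by (rule Dsp_diff(1)[OF wD h(1)])
  have GL: "(\<lambda>n. Lint p lborel (\<lambda>z. G w z - G (h n) z)) \<longlonglongrightarrow> 0"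
    using h(2) unfolding gagp_eq[OF wh] G_diff .
  have GvK: "Lint p lborel (G (v n)) \<le> K" for n using vK by (simp add: gagp_eq[OF v(1)])
  have Gm: "G w \<in> borel_measurable lborel" by simp
  note BG = Brezis_Lieb_strong[OF p1 DspD(2)[OF v(1)] GvK AE_G_tendsto[OF vlim] Gm DspD(2)[OF h(1)] GL]
  have wm: "w \<in> borel_measurable lborel" by simp
  note BQ = Brezis_Lieb_strong[OF q1 DspD(1)[OF v(1)] L vlim wm DspD(1)[OF h(1)] h(3)]
  have split_g: "(\<lambda>n. gagp s p (Q n) - gagp s p (R' n)) \<longlonglongrightarrow> gagp s p w"
    using BG(1) unfolding R'g(1) gagp_eq[OF vh] G_diff v(2)[symmetric] gagp_eq[OF v(1)] gagp_eq[OF wD] .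
  have split_q: "(\<lambda>n. Lint q lborel (Q n) - Lint q lborel (R' n)) \<longlonglongrightarrow> Lint q lborel w"
    using BQ(1) unfolding R'g(2) v(3)[symmetric] .
  have small: "eventually (\<lambda>n. \<forall>\<phi>. Dsp s p \<phi> \<longrightarrow> \<bar>WF \<mu> (v n) \<phi> - WF \<mu> (\<lambda>x. v n x - h n x) \<phi> - WF \<mu> w \<phi>\<bar> \<le> e * gag s p \<phi>) sequentially"
    if e: "0 < e" for e
    by (rule WF_split[OF v(1) vh wD _ BQ(2) e]) (use BG(2) in \<open>simp add: G_diff\<close>)
  have "PSinf R'"
    unfolding PSinf_def
  proof (intro conjI allI impI)
    show "Dsp0 s p \<Omega> (R' n)" for n by (rule R'0)
    have "Bseq (\<lambda>n. gagp s p (Q n) - gagp s p (R' n))" using split_g by (intro convergent_imp_Bseq convergentI)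
    then obtain B where B: "\<forall>n. norm (gagp s p (Q n) - gagp s p (R' n)) \<le> B" by (rule BseqE) blast
    have "gagp s p (R' n) \<le> K + B" for n
      using B[THEN spec, of n] K[of n] unfolding real_norm_def by linarith
    then show "\<exists>K. \<forall>n. gagp s p (R' n) \<le> K" by blast
  next
    fix e :: real assume e: "0 < e"
    then have e2: "0 < e / 2" by simp
    show "eventually (\<lambda>n. \<forall>\<phi>. Dsp0 s p \<Omega> \<phi> \<longrightarrow> \<bar>WF \<mu> (R' n) \<phi>\<bar> \<le> e * gag s p \<phi>) sequentially"
      using small[OF e2] DQ(4)[OF e2]
    proof (eventually_elim, intro allI impI)
      fix n and \<phi> :: "'a \<Rightarrow> real"
      assume 1: "\<forall>\<phi>. Dsp s p \<phi> \<longrightarrow> \<bar>WF \<mu> (v n) \<phi> - WF \<mu> (\<lambda>x. v n x - h n x) \<phi> - WF \<mu> w \<phi>\<bar> \<le> e / 2 * gag s p \<phi>"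
        and 2: "\<forall>\<phi>. Dsp0 s p \<Omega> \<phi> \<longrightarrow> \<bar>WF \<mu> (Q n) \<phi>\<bar> \<le> e / 2 * gag s p \<phi>" and \<phi>: "Dsp0 s p \<Omega> \<phi>"
      have \<phi>D: "Dsp s p \<phi>" using \<phi> by (simp add: Dsp0_def)
      define \<psi> where "\<psi> = rsc q (z n) (l n) \<phi>"
      have \<psi>: "Dsp s p \<psi>" "gagp s p \<psi> = gagp s p \<phi>" unfolding \<psi>_def by (rule Dsp_rsc[OF \<phi>D l(1)])+
      have "Dsp0 s p UNIV \<psi>" using \<psi> by (simp add: Dsp0_def)
      then have w0: "WF \<mu> w \<psi> = 0" using ws by (simp add: weak_sol_def)
      have e1: "WF \<mu> (v n) \<psi> = WF \<mu> (Q n) \<phi>"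
        unfolding v_def \<psi>_def by (rule WF_rsc[OF l(1) Dsp_measurable[OF DQ(2)] Dsp_measurable[OF \<phi>D]])
      have e2: "WF \<mu> (\<lambda>x. v n x - h n x) \<psi> = WF \<mu> (R' n) \<phi>"
        unfolding rR'[symmetric] \<psi>_def by (rule WF_rsc[OF l(1) Dsp_measurable[OF R'D] Dsp_measurable[OF \<phi>D]])
      have "\<bar>WF \<mu> (Q n) \<phi> - WF \<mu> (R' n) \<phi>\<bar> \<le> e / 2 * gag s p \<phi>"
        using 1 \<psi> w0 e1 e2 by (auto simp: gag_eq)
      moreover have "\<bar>WF \<mu> (Q n) \<phi>\<bar> \<le> e / 2 * gag s p \<phi>" using 2 \<phi> by blast
      moreover have "e * gag s p \<phi> = e / 2 * gag s p \<phi> + e / 2 * gag s p \<phi>" by simp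
      ultimately show "\<bar>WF \<mu> (R' n) \<phi>\<bar> \<le> e * gag s p \<phi>" by linarith
    qed
  next
    have "frontier \<Omega> \<noteq> {}" using pos(2)[of 0] l(1)[of 0] by (auto simp: infdist_def)
    then obtain y0 where y0: "y0 \<in> frontier \<Omega>" by blast
    obtain B where B: "\<And>x. x \<in> \<Omega> \<Longrightarrow> norm x \<le> B" using Omega(2) unfolding bounded_iff by blast
    \<comment> \<open>The radius of the support in original coordinates is bounded because \<Omega>
      is; this is what \<open>L1_norm_bubble_tendsto_0\<close> requires.\<close>
    have D: "l n * (2 * \<rho> n) \<le> B + norm y0" for n
    proof -
      have "infdist (z n) (frontier \<Omega>) \<le> dist (z n) y0" by (rule infdist_le[OF y0])
      also have "\<dots> \<le> norm (z n) + norm y0" unfolding dist_norm by (rule norm_triangle_ineq4)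
      also have "\<dots> \<le> B + norm y0" using B[OF pos(1)] by simp
      finally show ?thesis using l(1)[of n] infdist_nonneg[of "z n" "frontier \<Omega>"] by (simp add: \<rho>_def)
    qed
    have \<rho>2: "0 < 2 * \<rho> n" for n using \<rho>0 by simp
    note lim1 = L1_norm_bubble_tendsto_0[OF DspD(1)[OF wD] l \<rho>2 D]
    have b: "(\<integral>x. \<bar>W n x\<bar> \<partial>lborel) \<le> l n powr (N - al) * (\<integral>x. \<bar>indicator (ball 0 (2 * \<rho> n)) x * w x\<bar> \<partial>lborel)" for n
    proof -
      have "integrable lborel (\<lambda>x. indicator (ball 0 (2 * \<rho> n)) x * w x)"
        by (rule integrable_on_ball(1)[OF DspD(1)[OF wD] \<rho>2])
      moreover have "\<bar>h n x\<bar> \<le> \<bar>indicator (ball 0 (2 * \<rho> n)) x * w x\<bar>" for x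
        using cutoff_eq_0[OF \<rho>0, of n x] cutoff_bounds(4)[of "\<rho> n" x]
        by (auto simp: h_def indicator_def abs_mult mult_left_le_one_le)
      ultimately have "(\<integral>x. \<bar>h n x\<bar> \<partial>lborel) \<le> (\<integral>x. \<bar>indicator (ball 0 (2 * \<rho> n)) x * w x\<bar> \<partial>lborel)"
        by (intro integral_mono_AE') auto
      then show ?thesis
        unfolding W_def L1_norm_rsc[OF Dsp_measurable[OF h(1)] l(1)] by (intro mult_left_mono) auto
    qed
    have "(\<lambda>n. (\<integral>x. \<bar>Q n x\<bar> \<partial>lborel) + l n powr (N - al) * (\<integral>x. \<bar>indicator (ball 0 (2 * \<rho> n)) x * w x\<bar> \<partial>lborel)) \<longlonglongrightarrow> 0 + 0"
      by (intro tendsto_add DQ(5) lim1)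
    then have lim2: "(\<lambda>n. (\<integral>x. \<bar>Q n x\<bar> \<partial>lborel) + l n powr (N - al) * (\<integral>x. \<bar>indicator (ball 0 (2 * \<rho> n)) x * w x\<bar> \<partial>lborel)) \<longlonglongrightarrow> 0" by simp
    show "(\<lambda>n. \<integral>x. \<bar>R' n x\<bar> \<partial>lborel) \<longlonglongrightarrow> 0"
    proof (rule Lim_null_comparison[OF _ lim2], intro always_eventually allI)
      fix n
      have iQ: "integrable lborel (Q n)" and iW: "integrable lborel (W n)"
        by (rule Dsp0_integrable[OF DQ(1)], rule Dsp0_integrable[OF W0])
      have "norm (\<integral>x. \<bar>R' n x\<bar> \<partial>lborel) = (\<integral>x. \<bar>R' n x\<bar> \<partial>lborel)" by simp
      also have "\<dots> \<le> (\<integral>x. \<bar>Q n x\<bar> + \<bar>W n x\<bar> \<partial>lborel)"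
        by (rule integral_mono_AE') (use iQ iW in \<open>auto simp: R'_def\<close>)
      also have "\<dots> = (\<integral>x. \<bar>Q n x\<bar> \<partial>lborel) + (\<integral>x. \<bar>W n x\<bar> \<partial>lborel)" using iQ iW by simp
      also have "\<dots> \<le> (\<integral>x. \<bar>Q n x\<bar> \<partial>lborel) + l n powr (N - al) * (\<integral>x. \<bar>indicator (ball 0 (2 * \<rho> n)) x * w x\<bar> \<partial>lborel)"
        using b by simp
      finally show "norm (\<integral>x. \<bar>R' n x\<bar> \<partial>lborel)
        \<le> (\<integral>x. \<bar>Q n x\<bar> \<partial>lborel) + l n powr (N - al) * (\<integral>x. \<bar>indicator (ball 0 (2 * \<rho> n)) x * w x\<bar> \<partial>lborel)" .
    qed
  qed
  moreover have "(\<lambda>n. gagp s p (\<lambda>x. R (\<sigma> n) x - R' n x - bub (l n) (z n) w x)) \<longlonglongrightarrow> 0"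
  proof -
    \<comment> \<open>What was subtracted differs from the full bubble by a rescaling of w - h n,
      whose energy tends to 0.\<close>
    have e: "(\<lambda>x. R (\<sigma> n) x - R' n x - bub (l n) (z n) w x) = rsc q (- ((1 / l n) *\<^sub>R z n)) (1 / l n) (\<lambda>x. h n x - w x)" for n
      unfolding rsc_diff bub_eq[OF l(1)] by (simp add: R'_def Q_def W_def)
    have "gagp s p (\<lambda>x. R (\<sigma> n) x - R' n x - bub (l n) (z n) w x) = gagp s p (\<lambda>x. w x - h n x)" for n
      unfolding e using Dsp_rsc(2)[OF Dsp_diff(1)[OF h(1) wD] il] gagp_diff_commute[OF h(1) wD] by simp
    then show ?thesis using h(2) by simp
  qed
  moreover have "l n \<le> infdist (z n) (frontier \<Omega>)" for n using pos(2)[of n] l(1)[of n] by linarith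
  ultimately show ?thesis
    using \<sigma> wD nz ws l pos(1) split_g split_q unfolding Q_def
    by (intro exI[of _ \<sigma>] exI[of _ R'] exI[of _ w] exI[of _ l] exI[of _ z]) auto
qed

text \<open>The claim of the theorem for a remainder. Indices start at 1 because 0 is reserved for
  the weak limit. Critical norms are tracked along with energies since the identity for the level
  needs both.\<close>

definition bubble_tree :: "(nat \<Rightarrow> 'a \<Rightarrow> real) \<Rightarrow> (nat \<Rightarrow> 'a \<Rightarrow> real) \<Rightarrow> nat \<Rightarrow> (nat \<Rightarrow> nat \<Rightarrow> real)
    \<Rightarrow> (nat \<Rightarrow> nat \<Rightarrow> 'a) \<Rightarrow> (nat \<Rightarrow> nat) \<Rightarrow> bool" where
  "bubble_tree R v k lam z r \<longleftrightarrow> strict_mono r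
    \<and> (\<forall>i\<in>{1..k}. Dsp s p (v i) \<and> \<not> (AE x in lborel. v i x = 0) \<and> weak_sol s p (\<lambda>_. 0) \<mu> UNIV (v i))
    \<and> (\<forall>i\<in>{1..k}. (\<forall>n. 0 < lam i n) \<and> lam i \<longlonglongrightarrow> 0 \<and> (\<forall>n. z i n \<in> \<Omega> \<and> lam i n \<le> infdist (z i n) (frontier \<Omega>)))
    \<and> (\<lambda>n. gagp s p (\<lambda>x. R (r n) x - (\<Sum>i\<in>{1..k}. bub (lam i n) (z i n) (v i) x))) \<longlonglongrightarrow> 0
    \<and> (\<lambda>n. gagp s p (R (r n))) \<longlonglongrightarrow> (\<Sum>i\<in>{1..k}. gagp s p (v i))
    \<and> (\<lambda>n. Lint q lborel (R (r n))) \<longlonglongrightarrow> (\<Sum>i\<in>{1..k}. Lint q lborel (v i))"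

lemma Dsp_bub: "Dsp s p w \<Longrightarrow> 0 < l \<Longrightarrow> Dsp s p (bub l z w)"
  unfolding bub_eq by (intro Dsp_rsc(1)) auto

text \<open>By Sobolev's inequality the critical norm vanishes with the energy. The data v, lam and
  z are arbitrary because the index range is empty.\<close>

lemma bubble_tree_empty:
  assumes R: "PSinf R" and gl: "(\<lambda>n. gagp s p (R n)) \<longlonglongrightarrow> 0"
  shows "bubble_tree R v 0 lam z id"
proof -
  obtain C where C: "C > 0" "\<And>v::'a \<Rightarrow> real. Dsp s p v \<Longrightarrow> Lint q lborel v \<le> C * gagp s p v powr (q / p)"
    using Sobolev by auto
  have "(\<lambda>n. C * gagp s p (R n) powr (q / p)) \<longlonglongrightarrow> C * 0 powr (q / p)"
    using q0 p0 by (intro tendsto_mult tendsto_powr2 tendsto_const gl) auto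
  then have "(\<lambda>n. C * gagp s p (R n) powr (q / p)) \<longlonglongrightarrow> 0" by simp
  then have "(\<lambda>n. Lint q lborel (R n)) \<longlonglongrightarrow> 0"
    by (rule Lim_null_comparison[rotated]) (use C(2)[OF PSinfD(2)[OF R]] in auto)
  then show ?thesis using gl by (simp add: bubble_tree_def strict_mono_def)
qed

text \<open>The tree of R' lives along r, so the scales and centres of the new bubble are thinned
  out by r. The error of the longer sum is the error of the extraction plus that of the old
  tree.\<close>

lemma bubble_tree_Suc:
  assumes \<sigma>: "strict_mono \<sigma>" and R: "PSinf R" and R': "PSinf R'"
    and w: "Dsp s p w" "\<not> (AE x in lborel. w x = 0)" "weak_sol s p (\<lambda>_. 0) \<mu> UNIV w"
    and la: "\<And>n. 0 < la n" "la \<longlonglongrightarrow> 0" "\<And>n. za n \<in> \<Omega> \<and> la n \<le> infdist (za n) (frontier \<Omega>)"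
    and g0: "(\<lambda>n. gagp s p (\<lambda>x. R (\<sigma> n) x - R' n x - bub (la n) (za n) w x)) \<longlonglongrightarrow> 0"
    and sg: "(\<lambda>n. gagp s p (R (\<sigma> n)) - gagp s p (R' n)) \<longlonglongrightarrow> gagp s p w"
    and sq: "(\<lambda>n. Lint q lborel (R (\<sigma> n)) - Lint q lborel (R' n)) \<longlonglongrightarrow> Lint q lborel w"
    and B: "bubble_tree R' v k lam z r"
  shows "bubble_tree R (v(Suc k := w)) (Suc k) (lam(Suc k := la \<circ> r)) (z(Suc k := za \<circ> r)) (\<sigma> \<circ> r)"
proof -
  have r: "strict_mono r" and
    v: "\<And>i. i \<in> {1..k} \<Longrightarrow> Dsp s p (v i) \<and> \<not> (AE x in lborel. v i x = 0) \<and> weak_sol s p (\<lambda>_. 0) \<mu> UNIV (v i)" and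
    lam: "\<And>i. i \<in> {1..k} \<Longrightarrow> (\<forall>n. 0 < lam i n) \<and> lam i \<longlonglongrightarrow> 0 \<and> (\<forall>n. z i n \<in> \<Omega> \<and> lam i n \<le> infdist (z i n) (frontier \<Omega>))" and
    G: "(\<lambda>n. gagp s p (\<lambda>x. R' (r n) x - (\<Sum>i\<in>{1..k}. bub (lam i n) (z i n) (v i) x))) \<longlonglongrightarrow> 0" and
    Sg: "(\<lambda>n. gagp s p (R' (r n))) \<longlonglongrightarrow> (\<Sum>i\<in>{1..k}. gagp s p (v i))" and
    Sq: "(\<lambda>n. Lint q lborel (R' (r n))) \<longlonglongrightarrow> (\<Sum>i\<in>{1..k}. Lint q lborel (v i))"
    using B unfolding bubble_tree_def by auto
  have cases_Suc: "(\<forall>i\<in>{1..Suc k}. P i) \<longleftrightarrow> (\<forall>i\<in>{1..k}. P i) \<and> P (Suc k)" for P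
    by (auto simp: atLeastAtMostSuc_conv)
  have sum_Suc: "(\<Sum>i\<in>{1..Suc k}. f i) = (\<Sum>i\<in>{1..k}. f i) + f (Suc k)" for f :: "nat \<Rightarrow> real"
    by (simp add: atLeastAtMostSuc_conv add.commute)
  note sub = LIMSEQ_subseq_LIMSEQ[OF _ r, unfolded o_def]
  define X where "X n x = R (\<sigma> (r n)) x - R' (r n) x - bub (la (r n)) (za (r n)) w x" for n x
  define Y where "Y n x = R' (r n) x - (\<Sum>i\<in>{1..k}. bub (lam i n) (z i n) (v i) x)" for n x
  have XD: "Dsp s p (X n)" for n
    unfolding X_def[abs_def] by (intro Dsp_diff(1) Dsp_bub PSinfD(2)[OF R] PSinfD(2)[OF R'] w la)
  have YD: "Dsp s p (Y n)" for n
    unfolding Y_def[abs_def] using v lam by (intro Dsp_diff(1) Dsp_sum Dsp_bub PSinfD(2)[OF R']) auto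
  have "(\<lambda>n. 2 powr p * (gagp s p (X n) + gagp s p (Y n))) \<longlonglongrightarrow> 2 powr p * (0 + 0)"
    using sub[OF g0] G unfolding X_def Y_def by (intro tendsto_mult tendsto_add tendsto_const)
  then have "(\<lambda>n. 2 powr p * (gagp s p (X n) + gagp s p (Y n))) \<longlonglongrightarrow> 0" by simp
  then have XY: "(\<lambda>n. gagp s p (\<lambda>x. X n x + Y n x)) \<longlonglongrightarrow> 0"
    by (rule Lim_null_comparison[rotated]) (use Dsp_add(2)[OF XD YD] in auto)
  have eq: "(\<lambda>x. X n x + Y n x) = (\<lambda>x. R ((\<sigma> \<circ> r) n) x - (\<Sum>i\<in>{1..Suc k}.
      bub ((lam(Suc k := la \<circ> r)) i n) ((z(Suc k := za \<circ> r)) i n) ((v(Suc k := w)) i) x))" for n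
    unfolding sum_Suc by (simp add: X_def Y_def fun_eq_iff)
  have "(\<lambda>n. (gagp s p (R (\<sigma> (r n))) - gagp s p (R' (r n))) + gagp s p (R' (r n))) \<longlonglongrightarrow> gagp s p w + (\<Sum>i\<in>{1..k}. gagp s p (v i))"
    by (intro tendsto_add sub[OF sg] Sg)
  then have g: "(\<lambda>n. gagp s p (R ((\<sigma> \<circ> r) n))) \<longlonglongrightarrow> (\<Sum>i\<in>{1..Suc k}. gagp s p ((v(Suc k := w)) i))"
    unfolding sum_Suc by (simp add: add.commute)
  have "(\<lambda>n. (Lint q lborel (R (\<sigma> (r n))) - Lint q lborel (R' (r n))) + Lint q lborel (R' (r n))) \<longlonglongrightarrow> Lint q lborel w + (\<Sum>i\<in>{1..k}. Lint q lborel (v i))"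
    by (intro tendsto_add sub[OF sq] Sq)
  then have gq: "(\<lambda>n. Lint q lborel (R ((\<sigma> \<circ> r) n))) \<longlonglongrightarrow> (\<Sum>i\<in>{1..Suc k}. Lint q lborel ((v(Suc k := w)) i))"
    unfolding sum_Suc by (simp add: add.commute)
  show ?thesis
    unfolding bubble_tree_def cases_Suc eq[symmetric]
  proof (intro conjI ballI g gq XY strict_mono_o \<sigma> r)
    show "(lam(Suc k := la \<circ> r)) (Suc k) \<longlonglongrightarrow> 0" using sub[OF la(2)] by (simp add: o_def)
  qed (use v lam w la in auto)
qed

lemma bubble_tree_exists:
  assumes "PSinf R" "(\<lambda>n. gagp s p (R n)) \<longlonglongrightarrow> lev"
  shows "\<exists>v k lam z r. bubble_tree R v k lam z r"
proof -
  obtain c0 where c0: "c0 > 0" "\<And>w::'a \<Rightarrow> real. weak_sol s p (\<lambda>_. 0) \<mu> UNIV w \<Longrightarrow> \<not> (AE x in lborel. w x = 0) \<Longrightarrow> c0 \<le> gagp s p w"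
    using weak_sol_energy_bound by blast
  \<comment> \<open>m bounds the level in units of c0. Each extraction lowers the level by at least
    c0, and m = 0 is impossible because energies are nonnegative.\<close>
  have main: "\<exists>v k lam z r. bubble_tree R v k lam z r"
    if "PSinf R" "(\<lambda>n. gagp s p (R n)) \<longlonglongrightarrow> lev" "lev < real m * c0" for m R lev
    using that
  proof (induction m arbitrary: R lev)
    case 0
    then have "0 \<le> lev" by (intro LIMSEQ_le_const[OF 0(2)]) auto
    then show ?case using 0 by simp
  next
    case (Suc m)
    have nn: "0 \<le> lev" by (intro LIMSEQ_le_const[OF Suc.prems(2)]) auto
    show ?case
    proof (cases "lev = 0")
      case True
      then show ?thesis using bubble_tree_empty Suc.prems by blast
    next
      case False
      then have pos: "0 < lev" using nn by simp
      obtain \<sigma> R' w la za where \<sigma>: "strict_mono \<sigma>" and R': "PSinf R'"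
        and w: "Dsp s p w" "\<not> (AE x in lborel. w x = 0)" "weak_sol s p (\<lambda>_. 0) \<mu> UNIV w"
        and la: "\<And>n. 0 < la n" "la \<longlonglongrightarrow> 0" "\<And>n. za n \<in> \<Omega> \<and> la n \<le> infdist (za n) (frontier \<Omega>)"
        and g0: "(\<lambda>n. gagp s p (\<lambda>x. R (\<sigma> n) x - R' n x - bub (la n) (za n) w x)) \<longlonglongrightarrow> 0"
        and sg: "(\<lambda>n. gagp s p (R (\<sigma> n)) - gagp s p (R' n)) \<longlonglongrightarrow> gagp s p w"
        and sq: "(\<lambda>n. Lint q lborel (R (\<sigma> n)) - Lint q lborel (R' n)) \<longlonglongrightarrow> Lint q lborel w"
        using extraction[OF Suc.prems(1,2) pos] by blast
      have "(\<lambda>n. gagp s p (R (\<sigma> n)) - (gagp s p (R (\<sigma> n)) - gagp s p (R' n))) \<longlonglongrightarrow> lev - gagp s p w"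
        using LIMSEQ_subseq_LIMSEQ[OF Suc.prems(2) \<sigma>] by (intro tendsto_diff sg) (simp add: o_def)
      then have gR': "(\<lambda>n. gagp s p (R' n)) \<longlonglongrightarrow> lev - gagp s p w" by simp
      have "lev - gagp s p w < real m * c0"
        using c0(2)[OF w(3,2)] Suc.prems(3) by (simp add: algebra_simps)
      from Suc.IH[OF R' gR' this] obtain v k lam z r where "bubble_tree R' v k lam z r" by blast
      from bubble_tree_Suc[OF \<sigma> Suc.prems(1) R' w la g0 sg sq this] show ?thesis by blast
    qed
  qed
  obtain m :: nat where "lev < real m * c0" using reals_Archimedean3[OF c0(1)] by blast
  then show ?thesis using main assms by blast
qed

end

section \<open>The lower-order term and the decomposition\<close>

lemma Lq_powr:
  assumes "0 < r" "Lq m M f"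
  shows "Lq (m / r) M (\<lambda>x. \<bar>f x\<bar> powr r)" "Lint (m / r) M (\<lambda>x. \<bar>f x\<bar> powr r) = Lint m M f"
  using assms unfolding Lq_def Lint_def by (auto simp: powr_powr)

lemma generalized_Holder:
  assumes r: "0 < r" "r < m" "r < k" "1 / m + 1 / k = 1 / r" and A: "Lq m M A" and f: "Lq k M f"
  shows "Lq r M (\<lambda>x. A x * f x)"
proof -
  have e: "1 < m / r" "1 < k / r" "1 / (m / r) + 1 / (k / r) = 1"
  proof -
    have "1 / (m / r) + 1 / (k / r) = r * (1 / m + 1 / k)" by (simp add: algebra_simps)
    then show "1 / (m / r) + 1 / (k / r) = 1" using r by simp
  qed (use r in auto)
  have "integrable M (\<lambda>x. \<bar>A x\<bar> powr r * \<bar>f x\<bar> powr r)"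
    by (rule Holder(1)[OF e Lq_powr(1)[OF r(1) A] Lq_powr(1)[OF r(1) f]])
  then show ?thesis using A f unfolding Lq_def by (auto simp: abs_mult powr_mult)
qed

text \<open>The fixed factor provides the compactness: the r-th powers of f n are bounded and tend
  to 0 almost everywhere, hence weakly, and they are tested against the fixed function
  |A|^r.\<close>

lemma Lq_product_tendsto_0:
  assumes r: "0 < r" "r < m" "r < k" "1 / m + 1 / k = 1 / r" and A: "Lq m M A"
    and f: "\<And>n. Lq k M (f n)" "\<And>n. Lint k M (f n) \<le> K" and lim: "AE x in M. (\<lambda>n. f n x) \<longlonglongrightarrow> 0"
  shows "(\<lambda>n. Lint r M (\<lambda>x. A x * f n x)) \<longlonglongrightarrow> 0"
proof -
  have e: "1 < m / r" "1 < k / r" "1 / (k / r) + 1 / (m / r) = 1"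
  proof -
    have "1 / (k / r) + 1 / (m / r) = r * (1 / m + 1 / k)" by (simp add: algebra_simps)
    then show "1 / (k / r) + 1 / (m / r) = 1" using r by simp
  qed (use r in auto)
  have "(\<lambda>n. \<integral>x. \<bar>f n x\<bar> powr r * \<bar>A x\<bar> powr r \<partial>M) \<longlonglongrightarrow> (\<integral>x. 0 * \<bar>A x\<bar> powr r \<partial>M)"
  proof (rule Lq_weak_limit(2)[OF e(2,1,3) Lq_powr(1)[OF r(1) f(1)] _ _ _ Lq_powr(1)[OF r(1) A]])
    show "Lint (k / r) M (\<lambda>x. \<bar>f n x\<bar> powr r) \<le> K" for n using f(2) by (simp add: Lq_powr(2)[OF r(1) f(1)])
    show "AE x in M. (\<lambda>n. \<bar>f n x\<bar> powr r) \<longlonglongrightarrow> 0"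
      using lim
    proof eventually_elim
      case (elim x)
      have "(\<lambda>n. \<bar>f n x\<bar> powr r) \<longlonglongrightarrow> \<bar>0\<bar> powr r"
        using r(1) by (intro tendsto_powr2 tendsto_rabs elim tendsto_const) auto
      then show ?case by simp
    qed
  qed simp
  then show ?thesis by (simp add: Lint_def abs_mult powr_mult mult.commute)
qed

text \<open>For X > 1 the constant C is at most C X^(1/p), so X^(1 - 1/p) \<le> C + D.\<close>

lemma sublinear_bound:
  fixes X p C D :: real
  assumes p: "1 < p" and X: "0 \<le> X" "0 \<le> C" "0 \<le> D" and le: "X \<le> C + D * X powr (1 / p)"
  shows "X \<le> 1 + (C + D) powr (p / (p - 1))"
proof (cases "X \<le> 1")
  case False
  then have g: "1 \<le> X powr (1 / p)" using p by (intro ge_one_powr_ge_zero) auto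
  then have "C \<le> C * X powr (1 / p)" using X by (simp add: mult_le_cancel_left1)
  then have "X \<le> (C + D) * X powr (1 / p)" using le by (simp add: distrib_right)
  then have "X / X powr (1 / p) \<le> C + D" using False by (simp add: divide_le_eq)
  also have "X / X powr (1 / p) = X powr (1 - 1 / p)" using False powr_diff[of X 1 "1 / p"] by simp
  finally have "(X powr (1 - 1 / p)) powr (p / (p - 1)) \<le> (C + D) powr (p / (p - 1))"
    using p by (intro powr_mono2) auto
  moreover have "(1 - 1 / p) * (p / (p - 1)) = 1" using p by (simp add: field_simps)
  ultimately show ?thesis using False by (simp only: powr_powr) simp
qed (simp add: add_increasing2)

section \<open>The term with the coefficient a\<close>

context bubbling
begin

text \<open>The coefficient is controlled on \<Omega> only, whereas \<open>weak_form\<close>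
  integrates it over the whole space; as u vanishes outside \<Omega>, the truncation leaves the
  integral unchanged (\<open>weak_form_pot\<close>).\<close>

definition pot :: "('a \<Rightarrow> real) \<Rightarrow> 'a \<Rightarrow> real" where
  "pot a x = indicator \<Omega> x * a x"

lemma Lq_pot:
  assumes a: "a \<in> borel_measurable lborel" "set_integrable lborel \<Omega> (\<lambda>x. \<bar>a x\<bar> powr (N / (s * p)))"
  shows "Lq (N / (s * p)) lborel (pot a)"
proof -
  have [measurable]: "\<Omega> \<in> sets borel" "a \<in> borel_measurable borel" using Omega a by auto
  have "\<bar>pot a x\<bar> powr (N / (s * p)) = indicator \<Omega> x *\<^sub>R (\<bar>a x\<bar> powr (N / (s * p)))" for x
    by (simp add: pot_def indicator_def)
  then show ?thesis using a unfolding Lq_def set_integrable_def pot_def[abs_def] by simp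
qed

text \<open>The first identity makes the product of the potential with |u|^p integrable; the second
  places its product with |u|^(p - 1) in the exponent conjugate to q.\<close>

lemma exponents:
  "1 / (N / (s * p)) + 1 / (q / p) = 1" "1 / (N / (s * p)) + 1 / (q / (p - 1)) = 1 / (q / (q - 1))"
proof -
  have i: "p / q = (N - s * p) / N" using p0 Nsp by (simp add: q_def pstar_def)
  have "1 / (N / (s * p)) = 1 - p / q" unfolding i using N0 by (simp add: diff_divide_distrib)
  then show "1 / (N / (s * p)) + 1 / (q / p) = 1" "1 / (N / (s * p)) + 1 / (q / (p - 1)) = 1 / (q / (q - 1))"
    using q0 by (simp_all add: diff_divide_distrib)
qed

context
  fixes a :: "'a \<Rightarrow> real"
  assumes am: "a \<in> borel_measurable lborel"
    and ai: "set_integrable lborel \<Omega> (\<lambda>x. \<bar>a x\<bar> powr (N / (s * p)))"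
begin

lemma pot_measurable [measurable]: "pot a \<in> borel_measurable borel"
  using Lq_pot[OF am ai] by (simp add: Lq_def)

lemma conj_less: "q / (q - 1) < N / (s * p)" "q / (q - 1) < q / (p - 1)" "0 < q / (q - 1)"
  using p_less_q p1 q1 sp sp0 Nsp N0
proof -
  show 0: "0 < q / (q - 1)" using q1 by simp
  have "0 < 1 / (q / (p - 1))" "0 < 1 / (N / (s * p))" using p1 q0 sp0 N0 by auto
  then have "1 / (N / (s * p)) < 1 / (q / (q - 1))" "1 / (q / (p - 1)) < 1 / (q / (q - 1))"
    using exponents(2) by linarith+
  moreover have "0 < N / (s * p)" "0 < q / (p - 1)" using p1 q0 sp0 N0 by auto
  ultimately show "q / (q - 1) < N / (s * p)" "q / (q - 1) < q / (p - 1)"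
    using 0 by (metis frac_less2 inverse_eq_divide inverse_less_iff_less)+
qed

lemma Lq_Jp_p:
  assumes "Dsp s p (u :: 'a \<Rightarrow> real)"
  shows "Lq (q / (p - 1)) lborel (\<lambda>x. Jp p (u x))" "Lint (q / (p - 1)) lborel (\<lambda>x. Jp p (u x)) = Lint q lborel u"
  using DspD(1)[OF assms] p1 unfolding Lq_def Lint_def by (auto simp: abs_Jp powr_powr)

lemma Lq_pot_Jp:
  assumes "Dsp s p (u :: 'a \<Rightarrow> real)"
  shows "Lq (q / (q - 1)) lborel (\<lambda>x. pot a x * Jp p (u x))"
  by (rule generalized_Holder[OF conj_less(3,1,2) exponents(2) Lq_pot[OF am ai] Lq_Jp_p(1)[OF assms]])

lemma weak_form_pot:
  assumes u: "Dsp0 s p \<Omega> u" and \<phi>: "Dsp s p \<phi>"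
  shows "weak_form s p a \<mu> u \<phi> = WF \<mu> u \<phi> + (\<integral>x. (pot a x * Jp p (u x)) * \<phi> x \<partial>lborel)"
proof -
  have [measurable]: "u \<in> borel_measurable borel" "\<phi> \<in> borel_measurable borel" "a \<in> borel_measurable borel"
    using u \<phi> Dsp_measurable am by (auto simp: Dsp0_def)
  have m: "(\<lambda>x. a x * (Jp p (u x) * \<phi> x)) \<in> borel_measurable lborel"
    "(\<lambda>x. (pot a x * Jp p (u x)) * \<phi> x) \<in> borel_measurable lborel" by measurable
  have "AE x in lborel. x \<notin> \<Omega> \<longrightarrow> u x = 0" using u by (simp add: Dsp0_def)
  then have "AE x in lborel. a x * (Jp p (u x) * \<phi> x) = (pot a x * Jp p (u x)) * \<phi> x"
    by eventually_elim (auto simp: pot_def indicator_def Jp_def)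
  then have "(\<integral>x. a x * (Jp p (u x) * \<phi> x) \<partial>lborel) = (\<integral>x. (pot a x * Jp p (u x)) * \<phi> x \<partial>lborel)"
    by (rule integral_cong_AE[OF m])
  then show ?thesis by (simp add: weak_form_eq)
qed

definition potI :: "('a \<Rightarrow> real) \<Rightarrow> real" where
  "potI u = (\<integral>x. pot a x * \<bar>u x\<bar> powr p \<partial>lborel)"

lemma Ifun_pot: "Ifun s p \<Omega> a \<mu> u = gagp s p u / p + potI u / p - \<mu> / q * Lint q lborel u"
  by (simp add: Ifun_def set_lebesgue_integral_def potI_def pot_def Lint_def q_def N_def mult.assoc)

lemma weak_form_pot_self:
  assumes u: "Dsp0 s p \<Omega> u"
  shows "weak_form s p a \<mu> u u = gagp s p u + potI u - \<mu> * Lint q lborel u"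
proof -
  have D: "Dsp s p u" using u by (simp add: Dsp0_def)
  have "(\<integral>x. (pot a x * Jp p (u x)) * u x \<partial>lborel) = potI u"
    unfolding potI_def by (simp add: mult.assoc Jp_mult_self)
  then show ?thesis using weak_form_pot[OF u D] WF_self[OF D] by simp
qed

text \<open>A crude bound by Young's inequality, chosen to be linear in
  \<open>Lint q lborel u\<close>, the quantity that \<open>PS_bounded\<close> controls
  first.\<close>

lemma potI_bound:
  assumes u: "Dsp s p u"
  shows "\<bar>potI u\<bar> \<le> Lint (N / (s * p)) lborel (pot a) + Lint q lborel u"
proof -
  let ?m = "N / (s * p)"
  have m: "1 < ?m" "1 < q / p" using sp sp0 p_less_q p0 by auto
  have young: "\<bar>pot a x * \<bar>u x\<bar> powr p\<bar> \<le> \<bar>pot a x\<bar> powr ?m + \<bar>u x\<bar> powr q" for x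
  proof -
    have "\<bar>pot a x\<bar> * \<bar>u x\<bar> powr p \<le> \<bar>pot a x\<bar> powr ?m / ?m + (\<bar>u x\<bar> powr p) powr (q / p) / (q / p)"
      using m exponents(1) by (intro Youngs_inequality) auto
    also have "\<dots> \<le> \<bar>pot a x\<bar> powr ?m + (\<bar>u x\<bar> powr p) powr (q / p)"
    proof (intro add_mono)
      show "\<bar>pot a x\<bar> powr ?m / ?m \<le> \<bar>pot a x\<bar> powr ?m"
        using m(1) mult_left_mono[of 1 ?m "\<bar>pot a x\<bar> powr ?m"] by (subst pos_divide_le_eq) auto
      show "(\<bar>u x\<bar> powr p) powr (q / p) / (q / p) \<le> (\<bar>u x\<bar> powr p) powr (q / p)"
        using m(2) mult_left_mono[of 1 "q / p" "(\<bar>u x\<bar> powr p) powr (q / p)"] by (subst pos_divide_le_eq) auto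
    qed
    finally show ?thesis using p0 by (simp add: abs_mult powr_powr)
  qed
  have i: "integrable lborel (\<lambda>x. \<bar>pot a x\<bar> powr ?m)" "integrable lborel (\<lambda>x. \<bar>u x\<bar> powr q)"
    using Lq_pot[OF am ai] DspD(1)[OF u] by (auto simp: Lq_def)
  have "\<bar>potI u\<bar> \<le> (\<integral>x. \<bar>pot a x * \<bar>u x\<bar> powr p\<bar> \<partial>lborel)" unfolding potI_def by (rule integral_abs_bound)
  also have "\<dots> \<le> (\<integral>x. \<bar>pot a x\<bar> powr ?m + \<bar>u x\<bar> powr q \<partial>lborel)"
    by (rule integral_mono_AE') (use i young in auto)
  also have "\<dots> = Lint ?m lborel (pot a) + Lint q lborel u" using i by (simp add: Lint_def)
  finally show ?thesis .
qed

text \<open>The lower-order term is compact: its coefficient is one fixed function in L^(N / (s p)),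
  so by \<open>Lq_product_tendsto_0\<close> the products with \<open>Jp p (u n)\<close> converge
  strongly in the exponent conjugate to q, hence uniformly over test functions.\<close>

lemma pot_limits:
  fixes u :: "nat \<Rightarrow> 'a \<Rightarrow> real"
  assumes u: "\<And>n. Dsp s p (u n)" "\<And>n. gagp s p (u n) \<le> K"
    and lim: "AE x in lborel. (\<lambda>n. u n x) \<longlonglongrightarrow> w x" and w: "w \<in> borel_measurable borel"
  shows "(\<lambda>n. potI (u n)) \<longlonglongrightarrow> potI w"
    "\<And>e. 0 < e \<Longrightarrow> eventually (\<lambda>n. \<forall>\<phi>. Dsp s p \<phi> \<longrightarrow>
      \<bar>(\<integral>x. (pot a x * Jp p (u n x)) * \<phi> x \<partial>lborel) - (\<integral>x. (pot a x * Jp p (w x)) * \<phi> x \<partial>lborel)\<bar> \<le> e * gag s p \<phi>) sequentially"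
proof -
  obtain L where L: "\<And>n. Lint q lborel (u n) \<le> L" using Dsp_limit(2)[OF u lim w] by blast
  have wD: "Dsp s p w" by (rule Dsp_limit(1)[OF u lim w])
  have [measurable]: "w \<in> borel_measurable borel" by fact
  have m: "1 < N / (s * p)" "1 < q / p" using sp sp0 p_less_q p0 by auto
  have ex: "1 / (q / p) + 1 / (N / (s * p)) = 1" using exponents(1) by linarith
  have "(\<lambda>n. \<integral>x. \<bar>u n x\<bar> powr p * pot a x \<partial>lborel) \<longlonglongrightarrow> (\<integral>x. \<bar>w x\<bar> powr p * pot a x \<partial>lborel)"
  proof (rule Lq_weak_limit(2)[OF m(2,1) ex Lq_powr(1)[OF p0 DspD(1)[OF u(1)]] _ _ _ Lq_pot[OF am ai]])
    show "Lint (q / p) lborel (\<lambda>x. \<bar>u n x\<bar> powr p) \<le> L" for n using L by (simp add: Lq_powr(2)[OF p0 DspD(1)[OF u(1)]])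
    show "AE x in lborel. (\<lambda>n. \<bar>u n x\<bar> powr p) \<longlonglongrightarrow> \<bar>w x\<bar> powr p"
      using lim by eventually_elim (use p0 in \<open>auto intro!: tendsto_powr2 tendsto_rabs\<close>)
  qed measurable
  then show "(\<lambda>n. potI (u n)) \<longlonglongrightarrow> potI w" by (simp add: potI_def mult.commute)
  fix e :: real assume e: "0 < e"
  let ?k = "q / (p - 1)" and ?r = "q / (q - 1)"
  have k0: "0 < ?k" using q0 p1 by simp
  define f where "f n x = Jp p (u n x) - Jp p (w x)" for n x
  have fL: "Lq ?k lborel (f n)" "Lint ?k lborel (f n) \<le> 2 powr ?k * (L + Lint q lborel w)" for n
  proof -
    show "Lq ?k lborel (f n)" unfolding f_def[abs_def] by (rule Lq_diff(1)[OF k0 Lq_Jp_p(1)[OF u(1)] Lq_Jp_p(1)[OF wD]])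
    have "Lint ?k lborel (f n) \<le> 2 powr ?k * (Lint q lborel (u n) + Lint q lborel w)"
      using Lq_diff(2)[OF k0 Lq_Jp_p(1)[OF u(1)] Lq_Jp_p(1)[OF wD]] unfolding f_def[abs_def] Lq_Jp_p(2)[OF u(1)] Lq_Jp_p(2)[OF wD] .
    also have "\<dots> \<le> 2 powr ?k * (L + Lint q lborel w)" using L by (intro mult_left_mono add_right_mono) auto
    finally show "Lint ?k lborel (f n) \<le> 2 powr ?k * (L + Lint q lborel w)" .
  qed
  have "AE x in lborel. (\<lambda>n. f n x) \<longlonglongrightarrow> 0"
    using lim
  proof eventually_elim
    case (elim x)
    have "(\<lambda>n. f n x) \<longlonglongrightarrow> Jp p (w x) - Jp p (w x)"
      unfolding f_def by (intro tendsto_diff tendsto_Jp p1 elim tendsto_const)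
    then show ?case by simp
  qed
  from Lq_product_tendsto_0[OF conj_less(3,1,2) exponents(2) Lq_pot[OF am ai] fL this]
  have f0: "(\<lambda>n. Lint ?r lborel (\<lambda>x. pot a x * f n x)) \<longlonglongrightarrow> 0" .
  obtain C where C: "C > 0" "\<And>F \<phi>::'a \<Rightarrow> real. Lq ?r lborel F \<Longrightarrow> Dsp s p \<phi> \<Longrightarrow>
     \<bar>\<integral>x. F x * \<phi> x \<partial>lborel\<bar> \<le> C * Lint ?r lborel F powr (1 - 1 / q) * gag s p \<phi>"
    using critical_bound by auto
  have "(\<lambda>n. C * Lint ?r lborel (\<lambda>x. pot a x * f n x) powr (1 - 1 / q)) \<longlonglongrightarrow> C * 0 powr (1 - 1 / q)"
    using q1 by (intro tendsto_mult tendsto_powr2 tendsto_const f0) auto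
  then have "(\<lambda>n. C * Lint ?r lborel (\<lambda>x. pot a x * f n x) powr (1 - 1 / q)) \<longlonglongrightarrow> 0" by simp
  then have "eventually (\<lambda>n. C * Lint ?r lborel (\<lambda>x. pot a x * f n x) powr (1 - 1 / q) < e) sequentially"
    by (rule order_tendstoD(2)) (rule e)
  then show "eventually (\<lambda>n. \<forall>\<phi>. Dsp s p \<phi> \<longrightarrow>
      \<bar>(\<integral>x. (pot a x * Jp p (u n x)) * \<phi> x \<partial>lborel) - (\<integral>x. (pot a x * Jp p (w x)) * \<phi> x \<partial>lborel)\<bar> \<le> e * gag s p \<phi>) sequentially"
  proof (rule eventually_mono, intro allI impI)
    fix n and \<phi> :: "'a \<Rightarrow> real"
    assume small: "C * Lint ?r lborel (\<lambda>x. pot a x * f n x) powr (1 - 1 / q) < e" and \<phi>: "Dsp s p \<phi>"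
    have F: "Lq ?r lborel (\<lambda>x. pot a x * f n x)"
      by (rule generalized_Holder[OF conj_less(3,1,2) exponents(2) Lq_pot[OF am ai] fL(1)])
    have "(\<integral>x. (pot a x * Jp p (u n x)) * \<phi> x \<partial>lborel) - (\<integral>x. (pot a x * Jp p (w x)) * \<phi> x \<partial>lborel)
       = (\<integral>x. (pot a x * f n x) * \<phi> x \<partial>lborel)"
      using critical_integrable[OF Lq_pot_Jp[OF u(1)] \<phi>, of n] critical_integrable[OF Lq_pot_Jp[OF wD] \<phi>]
      by (simp add: f_def right_diff_distrib left_diff_distrib)
    also have "\<bar>\<dots>\<bar> \<le> C * Lint ?r lborel (\<lambda>x. pot a x * f n x) powr (1 - 1 / q) * gag s p \<phi>" by (rule C(2)[OF F \<phi>])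
    also have "\<dots> \<le> e * gag s p \<phi>" using small by (intro mult_right_mono) (auto simp: gag_eq)
    finally show "\<bar>(\<integral>x. (pot a x * Jp p (u n x)) * \<phi> x \<partial>lborel) - (\<integral>x. (pot a x * Jp p (w x)) * \<phi> x \<partial>lborel)\<bar> \<le> e * gag s p \<phi>" .
  qed
qed

text \<open>In I(u) - I'(u) u / p everything homogeneous of degree p cancels, the potential
  included, and b times the critical integral remains. So that integral is at most C + C [u];
  inserted into I(u) this gives X \<le> C + D X^(1/p) for X = [u]^p, which
  \<open>sublinear_bound\<close> resolves.\<close>

lemma PS_bounded:
  assumes PS: "PS_seq s p \<Omega> a \<mu> c u"
  shows "\<exists>K n0. \<forall>n\<ge>n0. gagp s p (u n) \<le> K"
proof -
  have D0: "Dsp0 s p \<Omega> (u n)" and D: "Dsp s p (u n)" for n using PS by (auto simp: PS_seq_def Dsp0_def)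
  have "Bseq (\<lambda>n. Ifun s p \<Omega> a \<mu> (u n))" using PS unfolding PS_seq_def by (intro convergent_imp_Bseq convergentI) auto
  then obtain C0 where C0: "\<forall>n. norm (Ifun s p \<Omega> a \<mu> (u n)) \<le> C0" by (rule BseqE) blast
  have C00: "0 \<le> C0" using C0[THEN spec, of 0] norm_ge_zero[of "Ifun s p \<Omega> a \<mu> (u 0)"] by linarith
  define b where "b = \<mu> * (1 / p - 1 / q)"
  have b: "b > 0" using mu0 p_less_q p0 by (simp add: b_def divide_strict_left_mono)
  define S where "S = Lint (N / (s * p)) lborel (pot a)"
  have S: "0 \<le> S" by (simp add: S_def)
  define M where "M = 1 + p * \<mu> / q"
  have M: "0 \<le> M" using p0 q0 mu0 by (simp add: M_def)
  have "\<forall>e>0. eventually (\<lambda>n. \<forall>\<phi>. Dsp0 s p \<Omega> \<phi> \<longrightarrow> \<bar>weak_form s p a \<mu> (u n) \<phi>\<bar> \<le> e * gag s p \<phi>) sequentially"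
    using PS unfolding PS_seq_def by blast
  from this[rule_format, OF zero_less_one] have "eventually (\<lambda>n. gagp s p (u n) \<le> 1 + ((p * C0 + S + M * (C0 / b)) + M / (p * b)) powr (p / (p - 1))) sequentially"
  proof eventually_elim
    case (elim n)
    let ?X = "gagp s p (u n)" and ?I = "Ifun s p \<Omega> a \<mu> (u n)" and ?L = "Lint q lborel (u n)"
    have w: "\<bar>weak_form s p a \<mu> (u n) (u n)\<bar> \<le> ?X powr (1 / p)" using elim D0[of n] by (auto simp: gag_eq)
    have I: "\<bar>?I\<bar> \<le> C0" using C0 by simp
    have e1: "?I - weak_form s p a \<mu> (u n) (u n) / p = b * ?L"
      unfolding Ifun_pot weak_form_pot_self[OF D0] b_def
      by (simp add: diff_divide_distrib add_divide_distrib left_diff_distrib right_diff_distrib)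
    have wp: "\<bar>weak_form s p a \<mu> (u n) (u n) / p\<bar> \<le> ?X powr (1 / p) / p"
      using w p0 by (simp add: abs_divide divide_right_mono)
    have "b * ?L \<le> C0 + ?X powr (1 / p) / p" unfolding e1[symmetric] using I wp by linarith
    then have "?L \<le> (C0 + ?X powr (1 / p) / p) / b" using b by (simp add: le_divide_eq mult.commute)
    then have L: "?L \<le> C0 / b + 1 / (p * b) * ?X powr (1 / p)" by (simp add: add_divide_distrib)
    have "?X = p * ?I - potI (u n) + p * \<mu> / q * ?L"
      unfolding Ifun_pot using p0 by (simp add: distrib_left right_diff_distrib)
    also have "\<dots> \<le> p * C0 + (S + ?L) + p * \<mu> / q * ?L"
    proof -
      have "p * ?I \<le> p * C0" using I p0 by (intro mult_left_mono) auto
      moreover have "- potI (u n) \<le> S + ?L" using potI_bound[OF D[of n]] unfolding S_def by linarith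
      ultimately show ?thesis by linarith
    qed
    also have "\<dots> = p * C0 + S + M * ?L" by (simp add: M_def distrib_right)
    also have "\<dots> \<le> p * C0 + S + M * (C0 / b + 1 / (p * b) * ?X powr (1 / p))"
      using L M by (intro add_left_mono mult_left_mono)
    also have "\<dots> = (p * C0 + S + M * (C0 / b)) + M / (p * b) * ?X powr (1 / p)" by (simp add: distrib_left)
    finally have le: "?X \<le> (p * C0 + S + M * (C0 / b)) + M / (p * b) * ?X powr (1 / p)" .
    show ?case
      by (rule sublinear_bound[OF p1 _ _ _ le]) (use p0 b C00 S M in auto)
  qed
  then show ?thesis unfolding eventually_sequentially by blast
qed

text \<open>The potential leaves the problem with v 0: its contribution converges strongly, so the
  remainder U n - v 0 is a Palais-Smale sequence for the equation without it, and the bubbles see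
  only the limit equation.\<close>

lemma decomposition:
  assumes PS: "PS_seq s p \<Omega> a \<mu> c u"
  shows "\<exists>(v :: nat \<Rightarrow> 'a \<Rightarrow> real) (k :: nat) (lam :: nat \<Rightarrow> nat \<Rightarrow> real)
           (z :: nat \<Rightarrow> nat \<Rightarrow> 'a) (r :: nat \<Rightarrow> nat).
     weak_sol s p a \<mu> \<Omega> (v 0)
     \<and> (\<forall>i\<in>{1..k}. Dsp s p (v i) \<and> \<not> (AE x in lborel. v i x = 0) \<and> weak_sol s p (\<lambda>_. 0) \<mu> UNIV (v i))
     \<and> (\<forall>i\<in>{1..k}. (\<forall>n. 0 < lam i n) \<and> lam i \<longlonglongrightarrow> 0 \<and> (\<forall>n. z i n \<in> \<Omega> \<and> infdist (z i n) (frontier \<Omega>) \<ge> lam i n))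
     \<and> strict_mono r
     \<and> (\<lambda>n. gag s p (\<lambda>x. u (r n) x - v 0 x
           - (\<Sum>i\<in>{1..k}. lam i n powr ((s * p - N) / p)
                 * v i ((1 / lam i n) *\<^sub>R (x - z i n))))) \<longlonglongrightarrow> 0
     \<and> (\<lambda>n. gagp s p (u (r n))) \<longlonglongrightarrow> (\<Sum>i\<in>{0..k}. gagp s p (v i))
     \<and> Ifun s p \<Omega> a \<mu> (v 0) + (\<Sum>i\<in>{1..k}. Iinf s p \<mu> (v i)) = c"
proof -
  have D0: "Dsp0 s p \<Omega> (u n)" and D: "Dsp s p (u n)" for n using PS by (auto simp: PS_seq_def Dsp0_def)
  obtain K n0 where K: "\<And>n. n \<ge> n0 \<Longrightarrow> gagp s p (u n) \<le> K" using PS_bounded[OF PS] by blast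
  define u1 where "u1 n = u (n + n0)" for n
  have u1: "Dsp s p (u1 n)" "gagp s p (u1 n) \<le> K" for n by (auto simp: u1_def D K)
  obtain r1 v0 where r1: "strict_mono r1" and v0m: "v0 \<in> borel_measurable borel"
    and lim: "AE x in lborel. (\<lambda>n. u1 (r1 n) x) \<longlonglongrightarrow> v0 x"
    using Rellich[of u1, OF u1] by (elim exE conjE) (rule that, assumption+)
  define \<sigma> where "\<sigma> n = r1 n + n0" for n
  have \<sigma>: "strict_mono \<sigma>" using r1 by (simp add: \<sigma>_def strict_mono_def)
  define U where "U n = u (\<sigma> n)" for n
  have U: "Dsp s p (U n)" "gagp s p (U n) \<le> K" "Dsp0 s p \<Omega> (U n)" for n by (auto simp: U_def \<sigma>_def D D0 K)
  have Ulim: "AE x in lborel. (\<lambda>n. U n x) \<longlonglongrightarrow> v0 x" using lim by (simp add: U_def \<sigma>_def u1_def)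
  have [measurable]: "v0 \<in> borel_measurable borel" by fact
  have v0D: "Dsp s p v0" by (rule Dsp_limit(1)[OF U(1,2) Ulim v0m])
  obtain L where L: "\<And>n. Lint q lborel (U n) \<le> L" using Dsp_limit(2)[OF U(1,2) Ulim v0m] by blast
  have "AE x in lborel. \<forall>n. x \<notin> \<Omega> \<longrightarrow> U n x = 0"
    using U(3) by (subst AE_all_countable) (simp add: Dsp0_def)
  then have "AE x in lborel. x \<notin> \<Omega> \<longrightarrow> v0 x = 0"
    using Ulim by eventually_elim (auto simp: LIMSEQ_const_iff)
  then have v00: "Dsp0 s p \<Omega> v0" using v0D by (simp add: Dsp0_def)
  note PL = pot_limits[OF U(1,2) Ulim v0m]
  have PSU: "eventually (\<lambda>n. \<forall>\<phi>. Dsp0 s p \<Omega> \<phi> \<longrightarrow> \<bar>weak_form s p a \<mu> (U n) \<phi>\<bar> \<le> e * gag s p \<phi>) sequentially" if "0 < e" for e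
  proof -
    have "eventually (\<lambda>n. \<forall>\<phi>. Dsp0 s p \<Omega> \<phi> \<longrightarrow> \<bar>weak_form s p a \<mu> (u n) \<phi>\<bar> \<le> e * gag s p \<phi>) sequentially"
      using PS that unfolding PS_seq_def by blast
    then show ?thesis unfolding U_def by (rule eventually_subseq[OF \<sigma>])
  qed
  have sol: "weak_form s p a \<mu> v0 \<phi> = 0" if \<phi>: "Dsp0 s p \<Omega> \<phi>" for \<phi>
  proof -
    have \<phi>D: "Dsp s p \<phi>" using \<phi> by (simp add: Dsp0_def)
    have g: "0 \<le> gag s p \<phi>" by (simp add: gag_eq)
    have "(\<lambda>n. \<bar>WF \<mu> (U n) \<phi> - WF \<mu> v0 \<phi>\<bar>) \<longlonglongrightarrow> \<bar>WF \<mu> v0 \<phi> - WF \<mu> v0 \<phi>\<bar>"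
      by (intro tendsto_rabs tendsto_diff tendsto_const WF_limit[OF U(1,2) Ulim v0m \<phi>D])
    then have wl: "(\<lambda>n. \<bar>WF \<mu> (U n) \<phi> - WF \<mu> v0 \<phi>\<bar>) \<longlonglongrightarrow> 0" by simp
    have "\<bar>weak_form s p a \<mu> v0 \<phi>\<bar> \<le> 0"
    proof (rule field_le_epsilon)
      fix e :: real assume e: "0 < e"
      define d where "d = e / (3 * (gag s p \<phi> + 1))"
      have d: "d > 0" "d * gag s p \<phi> \<le> e / 3" using e g by (auto simp: d_def field_simps)
      have e3: "0 < e / 3" using e by simp
      have "eventually (\<lambda>n. \<bar>weak_form s p a \<mu> v0 \<phi>\<bar> \<le> 0 + e) sequentially"
        using order_tendstoD(2)[OF wl e3] PL(2)[OF d(1)] PSU[OF d(1)]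
      proof eventually_elim
        case (elim n)
        have "\<bar>weak_form s p a \<mu> (U n) \<phi>\<bar> \<le> d * gag s p \<phi>" using elim(3) \<phi> by blast
        moreover have "\<bar>(\<integral>x. (pot a x * Jp p (U n x)) * \<phi> x \<partial>lborel) - (\<integral>x. (pot a x * Jp p (v0 x)) * \<phi> x \<partial>lborel)\<bar> \<le> d * gag s p \<phi>"
          using elim(2) \<phi>D by blast
        ultimately show ?case
          using elim(1) d(2) unfolding weak_form_pot[OF U(3) \<phi>D] weak_form_pot[OF v00 \<phi>D] by linarith
      qed
      \<comment> \<open>The inequality no longer involves n, so holding eventually means
        holding.\<close>
      then show "\<bar>weak_form s p a \<mu> v0 \<phi>\<bar> \<le> 0 + e" unfolding eventually_const[OF sequentially_bot] .
    qed
    then show ?thesis by simp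
  qed
  have ws0: "weak_sol s p a \<mu> \<Omega> v0" unfolding weak_sol_def using v00 sol by blast
  define R where "R n x = U n x - v0 x" for n x
  have R: "Dsp s p (R n)" for n unfolding R_def[abs_def] by (rule Dsp_diff(1)[OF U(1) v0D])
  have R0: "Dsp0 s p \<Omega> (R n)" for n
  proof -
    have "AE x in lborel. x \<notin> \<Omega> \<longrightarrow> U n x = 0" "AE x in lborel. x \<notin> \<Omega> \<longrightarrow> v0 x = 0"
      using U(3) v00 by (auto simp: Dsp0_def)
    then have "AE x in lborel. x \<notin> \<Omega> \<longrightarrow> R n x = 0" by eventually_elim (simp add: R_def)
    then show ?thesis using R by (simp add: Dsp0_def)
  qed
  have Rb: "gagp s p (R n) \<le> 2 powr p * (K + gagp s p v0)" for n
  proof -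
    have "gagp s p (R n) \<le> 2 powr p * (gagp s p (U n) + gagp s p v0)"
      unfolding R_def[abs_def] by (rule Dsp_diff(2)[OF U(1) v0D])
    also have "\<dots> \<le> 2 powr p * (K + gagp s p v0)" using U(2) by (intro mult_left_mono add_right_mono) auto
    finally show ?thesis .
  qed
  have GU: "Lint p lborel (G (U n)) \<le> K" for n using U(2) by (simp add: gagp_eq[OF U(1)])
  have Gm: "G v0 \<in> borel_measurable lborel" and v0m': "v0 \<in> borel_measurable lborel" by simp_all
  note BG = Brezis_Lieb[OF p1 DspD(2)[OF U(1)] GU AE_G_tendsto[OF Ulim] Gm]
  note BQ = Brezis_Lieb[OF q1 DspD(1)[OF U(1)] L Ulim v0m']
  have GR: "G (R n) = (\<lambda>z. G (U n) z - G v0 z)" for n unfolding R_def[abs_def] G_diff ..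
  have sg: "(\<lambda>n. gagp s p (U n) - gagp s p (R n)) \<longlonglongrightarrow> gagp s p v0"
    using BG(1) unfolding gagp_eq[OF U(1)] gagp_eq[OF R] gagp_eq[OF v0D] GR .
  have sq: "(\<lambda>n. Lint q lborel (U n) - Lint q lborel (R n)) \<longlonglongrightarrow> Lint q lborel v0"
    using BQ(1) unfolding R_def[abs_def] .
  have PSR: "PSinf R"
    unfolding PSinf_def
  proof (intro conjI allI impI)
    show "Dsp0 s p \<Omega> (R n)" for n by (rule R0)
    show "\<exists>K. \<forall>n. gagp s p (R n) \<le> K" using Rb by blast
  next
    fix e :: real assume e: "0 < e"
    then have e3: "0 < e / 3" by simp
    have "eventually (\<lambda>n. \<forall>\<phi>. Dsp s p \<phi> \<longrightarrow> \<bar>WF \<mu> (U n) \<phi> - WF \<mu> (R n) \<phi> - WF \<mu> v0 \<phi>\<bar> \<le> e / 3 * gag s p \<phi>) sequentially"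
      by (rule WF_split[OF U(1) R v0D _ _ e3]) (use BG(2) BQ(2) in \<open>simp_all add: GR R_def\<close>)
    then show "eventually (\<lambda>n. \<forall>\<phi>. Dsp0 s p \<Omega> \<phi> \<longrightarrow> \<bar>WF \<mu> (R n) \<phi>\<bar> \<le> e * gag s p \<phi>) sequentially"
      using PL(2)[OF e3] PSU[OF e3]
    proof (eventually_elim, intro allI impI)
      fix n and \<phi> :: "'a \<Rightarrow> real"
      assume 1: "\<forall>\<phi>. Dsp s p \<phi> \<longrightarrow> \<bar>WF \<mu> (U n) \<phi> - WF \<mu> (R n) \<phi> - WF \<mu> v0 \<phi>\<bar> \<le> e / 3 * gag s p \<phi>"
        and 2: "\<forall>\<phi>. Dsp s p \<phi> \<longrightarrow> \<bar>(\<integral>x. (pot a x * Jp p (U n x)) * \<phi> x \<partial>lborel) - (\<integral>x. (pot a x * Jp p (v0 x)) * \<phi> x \<partial>lborel)\<bar> \<le> e / 3 * gag s p \<phi>"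
        and 3: "\<forall>\<phi>. Dsp0 s p \<Omega> \<phi> \<longrightarrow> \<bar>weak_form s p a \<mu> (U n) \<phi>\<bar> \<le> e / 3 * gag s p \<phi>" and \<phi>: "Dsp0 s p \<Omega> \<phi>"
      have \<phi>D: "Dsp s p \<phi>" using \<phi> by (simp add: Dsp0_def)
      have "e * gag s p \<phi> = e / 3 * gag s p \<phi> + e / 3 * gag s p \<phi> + e / 3 * gag s p \<phi>" by simp
      then show "\<bar>WF \<mu> (R n) \<phi>\<bar> \<le> e * gag s p \<phi>"
        using 1[rule_format, OF \<phi>D] 2[rule_format, OF \<phi>D] 3[rule_format, OF \<phi>] sol[OF \<phi>]
        unfolding weak_form_pot[OF U(3) \<phi>D] weak_form_pot[OF v00 \<phi>D] by linarith
    qed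
  next
    have fin: "emeasure lborel \<Omega> < \<infinity>" by (rule emeasure_bounded_finite[OF Omega(2)])
    have Os: "\<Omega> \<in> sets lborel" using Omega(1) by simp
    have I: "Lq (q / (q - 1)) lborel (indicator \<Omega>)"
      by (rule Lq_indicator(1)[OF Os, of "measure lborel \<Omega>"]) (use fin in \<open>auto simp: emeasure_eq_ennreal_measure less_top\<close>)
    \<comment> \<open>The strong form of the weak limit, tested with the indicator of the bounded
      set \<Omega>, gives L^1 convergence of the remainder to 0.\<close>
    have "(\<lambda>n. \<integral>x. \<bar>(U n x - v0 x) * indicator \<Omega> x\<bar> \<partial>lborel) \<longlonglongrightarrow> 0"
      by (rule Lq_weak_limit(1)[OF q1 conjugate_exponent(1,3)[OF q1] DspD(1)[OF U(1)] L Ulim v0m' I])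
    moreover have "(\<integral>x. \<bar>(U n x - v0 x) * indicator \<Omega> x\<bar> \<partial>lborel) = (\<integral>x. \<bar>R n x\<bar> \<partial>lborel)" for n
    proof (rule integral_cong_AE)
      have [measurable]: "R n \<in> borel_measurable borel" "U n \<in> borel_measurable borel" "\<Omega> \<in> sets borel"
        using R U(1) Dsp_measurable Omega(1) by auto
      show "(\<lambda>x. \<bar>(U n x - v0 x) * indicator \<Omega> x\<bar>) \<in> borel_measurable lborel" "(\<lambda>x. \<bar>R n x\<bar>) \<in> borel_measurable lborel"
        by measurable
      have "AE x in lborel. x \<notin> \<Omega> \<longrightarrow> R n x = 0" using R0 by (simp add: Dsp0_def)
      then show "AE x in lborel. \<bar>(U n x - v0 x) * indicator \<Omega> x\<bar> = \<bar>R n x\<bar>"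
        by eventually_elim (auto simp: R_def indicator_def)
    qed
    ultimately show "(\<lambda>n. \<integral>x. \<bar>R n x\<bar> \<partial>lborel) \<longlonglongrightarrow> 0" by simp
  qed
  \<comment> \<open>The energies of the remainders are only bounded so far; a further subsequence
    gives them a limit, which \<open>bubble_tree_exists\<close> needs as level.\<close>
  define f where "f n = gagp s p (R n)" for n
  define I where "I = {0..2 powr p * (K + gagp s p v0)}"
  have "compact I" by (simp add: I_def)
  moreover have "\<forall>n. f n \<in> I" using Rb by (simp add: f_def I_def)
  ultimately obtain lev r2 where r2: "strict_mono r2" and l2: "(f \<circ> r2) \<longlonglongrightarrow> lev"
    unfolding compact_def by blast
  have l2': "(\<lambda>n. gagp s p (R (r2 n))) \<longlonglongrightarrow> lev" using l2 by (simp add: o_def f_def)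
  have "PSinf (\<lambda>n. R (r2 n))" by (rule PSinf_subseq[OF PSR r2])
  from bubble_tree_exists[OF this l2'] obtain v k lam z r3 where B: "bubble_tree (\<lambda>n. R (r2 n)) v k lam z r3"
    by (elim exE) (rule that)
  then have r3: "strict_mono r3" by (simp add: bubble_tree_def)
  define \<tau> where "\<tau> n = r2 (r3 n)" for n
  have \<tau>: "strict_mono \<tau>" using strict_mono_o[OF r2 r3] by (simp add: \<tau>_def[abs_def] o_def)
  have G0: "(\<lambda>n. gagp s p (\<lambda>x. R (\<tau> n) x - (\<Sum>i\<in>{1..k}. bub (lam i n) (z i n) (v i) x))) \<longlonglongrightarrow> 0"
    and Sg: "(\<lambda>n. gagp s p (R (\<tau> n))) \<longlonglongrightarrow> (\<Sum>i\<in>{1..k}. gagp s p (v i))"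
    and Sq: "(\<lambda>n. Lint q lborel (R (\<tau> n))) \<longlonglongrightarrow> (\<Sum>i\<in>{1..k}. Lint q lborel (v i))"
    using B by (auto simp: bubble_tree_def \<tau>_def)
  \<comment> \<open>The tree uses the indices 1 to k; slot 0 receives the weak limit.\<close>
  define V where "V = v(0 := v0)"
  have V: "V 0 = v0" "\<And>i. i \<in> {1..k} \<Longrightarrow> V i = v i" by (auto simp: V_def)
  note sub = LIMSEQ_subseq_LIMSEQ[OF _ \<tau>, unfolded o_def]
  have "(\<lambda>n. (gagp s p (U (\<tau> n)) - gagp s p (R (\<tau> n))) + gagp s p (R (\<tau> n))) \<longlonglongrightarrow> gagp s p v0 + (\<Sum>i\<in>{1..k}. gagp s p (v i))"
    by (intro tendsto_add sub[OF sg] Sg)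
  then have gU: "(\<lambda>n. gagp s p (U (\<tau> n))) \<longlonglongrightarrow> gagp s p v0 + (\<Sum>i\<in>{1..k}. gagp s p (v i))" by simp
  have "(\<lambda>n. (Lint q lborel (U (\<tau> n)) - Lint q lborel (R (\<tau> n))) + Lint q lborel (R (\<tau> n))) \<longlonglongrightarrow> Lint q lborel v0 + (\<Sum>i\<in>{1..k}. Lint q lborel (v i))"
    by (intro tendsto_add sub[OF sq] Sq)
  then have qU: "(\<lambda>n. Lint q lborel (U (\<tau> n))) \<longlonglongrightarrow> Lint q lborel v0 + (\<Sum>i\<in>{1..k}. Lint q lborel (v i))" by simp
  have sum0: "(\<Sum>i\<in>{0..k}. gagp s p (V i)) = gagp s p v0 + (\<Sum>i\<in>{1..k}. gagp s p (v i))"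
  proof -
    have "(\<Sum>i\<in>{0..k}. gagp s p (V i)) = gagp s p (V 0) + (\<Sum>i\<in>{1..k}. gagp s p (V i))"
      by (simp add: sum.atLeast_Suc_atMost)
    also have "(\<Sum>i\<in>{1..k}. gagp s p (V i)) = (\<Sum>i\<in>{1..k}. gagp s p (v i))"
      by (rule sum.cong) (auto simp: V)
    finally show ?thesis by (simp add: V)
  qed
  have "(\<lambda>n. Ifun s p \<Omega> a \<mu> (U (\<tau> n))) \<longlonglongrightarrow> (gagp s p v0 + (\<Sum>i\<in>{1..k}. gagp s p (v i))) / p + potI v0 / p
      - \<mu> / q * (Lint q lborel v0 + (\<Sum>i\<in>{1..k}. Lint q lborel (v i)))"
    unfolding Ifun_pot using p0 by (intro tendsto_diff tendsto_add tendsto_divide tendsto_mult tendsto_const gU qU sub[OF PL(1)]) auto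
  moreover have "(\<lambda>n. Ifun s p \<Omega> a \<mu> (U (\<tau> n))) \<longlonglongrightarrow> c"
  proof -
    have "(\<lambda>n. Ifun s p \<Omega> a \<mu> (u n)) \<longlonglongrightarrow> c" using PS by (simp add: PS_seq_def)
    from LIMSEQ_subseq_LIMSEQ[OF this \<sigma>] have "(\<lambda>n. Ifun s p \<Omega> a \<mu> (U n)) \<longlonglongrightarrow> c" by (simp add: o_def U_def)
    then show ?thesis by (rule sub)
  qed
  ultimately have c: "(gagp s p v0 + (\<Sum>i\<in>{1..k}. gagp s p (v i))) / p + potI v0 / p
      - \<mu> / q * (Lint q lborel v0 + (\<Sum>i\<in>{1..k}. Lint q lborel (v i))) = c" by (rule LIMSEQ_unique)
  have Ii: "Iinf s p \<mu> w = gagp s p w / p - \<mu> / q * Lint q lborel w" for w :: "'a \<Rightarrow> real"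
    by (simp add: Iinf_def Lint_def q_def N_def)
  have "(\<Sum>i\<in>{1..k}. Iinf s p \<mu> (v i)) = (\<Sum>i\<in>{1..k}. gagp s p (v i)) / p - \<mu> / q * (\<Sum>i\<in>{1..k}. Lint q lborel (v i))"
    unfolding Ii by (simp add: sum_subtractf sum_divide_distrib sum_distrib_left)
  then have energy: "Ifun s p \<Omega> a \<mu> v0 + (\<Sum>i\<in>{1..k}. Iinf s p \<mu> (v i)) = c"
    unfolding Ifun_pot c[symmetric] by (simp add: add_divide_distrib distrib_left)
  have eI: "(\<Sum>i\<in>{1..k}. Iinf s p \<mu> (V i)) = (\<Sum>i\<in>{1..k}. Iinf s p \<mu> (v i))"
    by (rule sum.cong) (auto simp: V)
  have eB: "(\<Sum>i\<in>{1..k}. bub (lam i n) (z i n) (V i) x) = (\<Sum>i\<in>{1..k}. bub (lam i n) (z i n) (v i) x)" for n x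
    by (rule sum.cong) (auto simp: V)
  have st: "strict_mono (\<lambda>n. \<sigma> (\<tau> n))" using strict_mono_o[OF \<sigma> \<tau>] by (simp add: o_def)
  show ?thesis
  proof (intro exI conjI)
    show "weak_sol s p a \<mu> \<Omega> (V 0)" using ws0 V by simp
    show "\<forall>i\<in>{1..k}. Dsp s p (V i) \<and> \<not> (AE x in lborel. V i x = 0) \<and> weak_sol s p (\<lambda>_. 0) \<mu> UNIV (V i)"
      using B V by (simp add: bubble_tree_def)
    show "\<forall>i\<in>{1..k}. (\<forall>n. 0 < lam i n) \<and> lam i \<longlonglongrightarrow> 0 \<and> (\<forall>n. z i n \<in> \<Omega> \<and> lam i n \<le> infdist (z i n) (frontier \<Omega>))"
      using B by (simp add: bubble_tree_def)
    show "strict_mono (\<lambda>n. \<sigma> (\<tau> n))" by (rule st)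
    have "(\<lambda>n. gagp s p (\<lambda>x. u (\<sigma> (\<tau> n)) x - V 0 x - (\<Sum>i\<in>{1..k}. bub (lam i n) (z i n) (V i) x))) \<longlonglongrightarrow> 0"
      using G0 unfolding eB V(1) R_def U_def .
    from tendsto_powr2[OF this tendsto_const[of "1 / p"]] p0
    have "(\<lambda>n. gag s p (\<lambda>x. u (\<sigma> (\<tau> n)) x - V 0 x - (\<Sum>i\<in>{1..k}. bub (lam i n) (z i n) (V i) x))) \<longlonglongrightarrow> 0"
      by (simp add: gag_eq)
    then show "(\<lambda>n. gag s p (\<lambda>x. u (\<sigma> (\<tau> n)) x - V 0 x
           - (\<Sum>i\<in>{1..k}. lam i n powr ((s * p - N) / p)
                 * V i ((1 / lam i n) *\<^sub>R (x - z i n))))) \<longlonglongrightarrow> 0"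
      unfolding bub_def .
    show "(\<lambda>n. gagp s p (u (\<sigma> (\<tau> n)))) \<longlonglongrightarrow> (\<Sum>i\<in>{0..k}. gagp s p (V i))"
      using gU unfolding sum0 U_def .
    show "Ifun s p \<Omega> a \<mu> (V 0) + (\<Sum>i\<in>{1..k}. Iinf s p \<mu> (V i)) = c"
      using energy unfolding eI V(1) .
  qed
qed

end

end

theorem theorem1p1:
  fixes s p \<mu> c :: real and \<Omega> :: "'a::euclidean_space set"
    and a :: "'a \<Rightarrow> real" and u :: "nat \<Rightarrow> 'a \<Rightarrow> real"
  assumes NA: "NA s p \<mu> TYPE('a)"
    and p: "1 < p" and s: "0 < s" "s < 1" and sp: "s * p < real DIM('a)"
    and \<Omega>: "open \<Omega>" "bounded \<Omega>" "smooth_boundary \<Omega>"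
    and a: "a \<in> borel_measurable lborel"
      "set_integrable lborel \<Omega> (\<lambda>x. \<bar>a x\<bar> powr (real DIM('a) / (s * p)))"
    and \<mu>: "0 < \<mu>"
    and PS: "PS_seq s p \<Omega> a \<mu> c u"
  shows "\<exists>(v :: nat \<Rightarrow> 'a \<Rightarrow> real) (k :: nat) (lam :: nat \<Rightarrow> nat \<Rightarrow> real)
           (z :: nat \<Rightarrow> nat \<Rightarrow> 'a) (r :: nat \<Rightarrow> nat).
     weak_sol s p a \<mu> \<Omega> (v 0)
     \<and> (\<forall>i\<in>{1..k}. Dsp s p (v i) \<and> \<not> (AE x in lborel. v i x = 0)
          \<and> weak_sol s p (\<lambda>_. 0) \<mu> UNIV (v i))
     \<and> (\<forall>i\<in>{1..k}. (\<forall>n. 0 < lam i n) \<and> lam i \<longlonglongrightarrow> 0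
          \<and> (\<forall>n. z i n \<in> \<Omega> \<and> infdist (z i n) (frontier \<Omega>) \<ge> lam i n))
     \<and> strict_mono r
     \<and> (\<lambda>n. gag s p (\<lambda>x. u (r n) x - v 0 x
           - (\<Sum>i\<in>{1..k}. lam i n powr ((s * p - real DIM('a)) / p)
                 * v i ((1 / lam i n) *\<^sub>R (x - z i n))))) \<longlonglongrightarrow> 0
     \<and> (\<lambda>n. gagp s p (u (r n))) \<longlonglongrightarrow> (\<Sum>i\<in>{0..k}. gagp s p (v i))
     \<and> Ifun s p \<Omega> a \<mu> (v 0) + (\<Sum>i\<in>{1..k}. Iinf s p \<mu> (v i)) = c"
proof -
  interpret bubbling s p "real DIM('a)" "pstar (real DIM('a)) s p" "(real DIM('a) - s * p) / p" "TYPE('a)" \<mu> \<Omega>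
    by unfold_locales (use assms in auto)
  show ?thesis by (rule decomposition[OF a PS])
qed

end
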